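(* There is $V_0 > 0$ such that for every $V \in (0,V_0]$, all gaps allowed by the gap labeling theorem are open. That is, $$\{ N(E,V) : E \in \mathbb{R} \setminus \Sigma_V \} = \{ \{ m \alpha \} : m \in \mathbb{Z} \} \cup \{ 1 \}.$$
   Context: Let $\alpha = \frac{\sqrt{5}-1}{2}$. For $x\in\mathbb{R}$, $\{x\} = x - \lfloor x\rfloor$ denotes the fractional part of $x$. For $V>0$ and $\omega \in \mathbb{T} = \mathbb{R}/\mathbb{Z}$, the Fibonacci Hamiltonian is the bounded self-adjoint operator on $\ell^2(\mathbb{Z})$ given by $$[H_{V,\omega} \psi](n) = \psi(n+1) + \psi(n-1) + V \chi_{[1-\alpha,1)}(n\alpha + \omega \bmod 1)\, \psi(n).$$ Its spectrum does not depend on $\omega$; $\Sigma_V$ denotes the common spectrum, $\Sigma_V = \sigma(H_{V,\omega})$ for every $\omega \in \mathbb{T}$. Integrated density of states: for a finite interval $\Lambda\subset\mathbb{Z}$ let $H_{V,\omega}^\Lambda$ be the restriction of $H_{V,\omega}$ to $\Lambda$ with Dirichlet boundary conditions, and let $N(E,\omega,V,\Lambda)$ be the number of eigenvalues of $H_{V,\omega}^\Lambda$ that are less than or equal to $E$. Then $N(E,V) = \lim_{n\to\infty} \frac1n N(E,\omega,V,[1,n])$; it is known that the limit exists for every $\omega$ and does not depend on $\omega$. The gap labeling theorem says that $\{ N(E,V) : E \in \mathbb{R} \setminus \Sigma_V \} \subseteq \{ \{ m \alpha \} : m \in \mathbb{Z} \} \cup \{ 1 \}$ for every $V\neq 0$.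 *)

theory Defs
  imports "HOL-Analysis.Analysis" "Jordan_Normal_Form.Char_Poly"
begin

definition ell2 :: "(int \<Rightarrow> complex) set" where
  "ell2 = {\<psi>. (\<lambda>n. (cmod (\<psi> n))\<^sup>2) summable_on UNIV}"

definition ell2_norm :: "(int \<Rightarrow> complex) \<Rightarrow> real" where
  "ell2_norm \<psi> = sqrt (\<Sum>\<^sub>\<infinity>n\<in>UNIV. (cmod (\<psi> n))\<^sup>2)"

(* Operators are total functions on sequences; only their values on ell2 matter. *)
definition bounded_operator :: "((int \<Rightarrow> complex) \<Rightarrow> (int \<Rightarrow> complex)) \<Rightarrow> bool" where
  "bounded_operator T \<longleftrightarrow>
     (\<forall>\<psi>\<in>ell2. T \<psi> \<in> ell2) \<and>
     (\<forall>\<phi>\<in>ell2. \<forall>\<psi>\<in>ell2. \<forall>c. T (\<lambda>n. c * \<phi> n + \<psi> n) = (\<lambda>n. c * T \<phi> n + T \<psi> n)) \<and>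
     (\<exists>C. \<forall>\<psi>\<in>ell2. ell2_norm (T \<psi>) \<le> C * ell2_norm \<psi>)"

definition resolvent_set :: "((int \<Rightarrow> complex) \<Rightarrow> (int \<Rightarrow> complex)) \<Rightarrow> complex set" where
  "resolvent_set T =
     {z. \<exists>S. bounded_operator S \<and>
           (\<forall>\<psi>\<in>ell2. S (\<lambda>n. T \<psi> n - z * \<psi> n) = \<psi>) \<and>
           (\<forall>\<psi>\<in>ell2. (\<lambda>n. T (S \<psi>) n - z * S \<psi> n) = \<psi>)}"

definition spectrum :: "((int \<Rightarrow> complex) \<Rightarrow> (int \<Rightarrow> complex)) \<Rightarrow> complex set" where
  "spectrum T = - resolvent_set T"

definition alpha :: real where
  "alpha = (sqrt 5 - 1) / 2"

(* A phase in R/Z is given by any real representative: only its class modulo 1 enters. *)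
definition fib_potential :: "real \<Rightarrow> real \<Rightarrow> int \<Rightarrow> real" where
  "fib_potential V \<omega> n = V * indicator {1 - alpha..<1} (frac (of_int n * alpha + \<omega>))"

definition fib_hamiltonian :: "real \<Rightarrow> real \<Rightarrow> (int \<Rightarrow> complex) \<Rightarrow> (int \<Rightarrow> complex)" where
  "fib_hamiltonian V \<omega> \<psi> = (\<lambda>n. \<psi> (n + 1) + \<psi> (n - 1) + of_real (fib_potential V \<omega> n) * \<psi> n)"

(* The definite description is justified because the spectrum is known not to depend on the phase. *)
definition Sigma_V :: "real \<Rightarrow> complex set" where
  "Sigma_V V = (THE S. \<forall>\<omega>. spectrum (fib_hamiltonian V \<omega>) = S)"

(* Dirichlet restriction to {a..b}: the compression of the Hamiltonian to functions supported
   on {a..b}, in the basis of unit sequences; row i and column j stand for sites a + i, a + j. *)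
definition dirichlet_restriction :: "real \<Rightarrow> real \<Rightarrow> int \<Rightarrow> int \<Rightarrow> complex mat" where
  "dirichlet_restriction V \<omega> a b =
     mat (card {a..b}) (card {a..b})
       (\<lambda>(i, j). fib_hamiltonian V \<omega> (indicator {a + int j}) (a + int i))"

(* Eigenvalues at most E, counted with multiplicity (the matrix is Hermitian, so its eigenvalues
   are real and algebraic and geometric multiplicities coincide). *)
definition eigenvalue_count :: "real \<Rightarrow> real \<Rightarrow> real \<Rightarrow> int \<Rightarrow> int \<Rightarrow> nat" where
  "eigenvalue_count E \<omega> V a b =
     (let A = dirichlet_restriction V \<omega> a b
      in \<Sum>x | x \<le> E \<and> eigenvalue A (complex_of_real x). order (complex_of_real x) (char_poly A))"

(* The definite description is justified because the limit is known to exist for every phase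
   and not to depend on it. *)
definition ids :: "real \<Rightarrow> real \<Rightarrow> real" where
  "ids E V = (THE L. \<forall>\<omega>. (\<lambda>n. real (eigenvalue_count E \<omega> V 1 (int n)) / real n) \<longlonglongrightarrow> L)"

lemma ell2_norm_cong_shift:
  assumes "\<psi> \<in> ell2"
  shows "(\<lambda>n. (cmod (\<psi> (n + k)))\<^sup>2) summable_on UNIV"
    and "(\<Sum>\<^sub>\<infinity>n\<in>UNIV. (cmod (\<psi> (n + k)))\<^sup>2) = (ell2_norm \<psi>)\<^sup>2"
proof -
  have b: "bij_betw (\<lambda>n::int. n + k) UNIV UNIV"
    by (rule bij_betwI[where g = "\<lambda>n. n - k"]) auto
  show "(\<lambda>n. (cmod (\<psi> (n + k)))\<^sup>2) summable_on UNIV"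
    using summable_on_reindex_bij_betw[OF b, of "\<lambda>n. (cmod (\<psi> n))\<^sup>2"] assms
    by (simp add: ell2_def)
  show "(\<Sum>\<^sub>\<infinity>n\<in>UNIV. (cmod (\<psi> (n + k)))\<^sup>2) = (ell2_norm \<psi>)\<^sup>2"
    using infsum_reindex_bij_betw[OF b, of "\<lambda>n. (cmod (\<psi> n))\<^sup>2"]
    by (simp add: ell2_norm_def infsum_nonneg)
qed

lemma bounded_operator_fib_hamiltonian: "bounded_operator (fib_hamiltonian V \<omega>)"
proof -
  have pt: "(cmod (fib_hamiltonian V \<omega> \<psi> n))\<^sup>2
      \<le> 3 * ((cmod (\<psi> (n + 1)))\<^sup>2 + (cmod (\<psi> (n + (-1))))\<^sup>2 + V\<^sup>2 * (cmod (\<psi> (n + 0)))\<^sup>2)" for \<psi> n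
  proof -
    let ?x = "cmod (\<psi> (n + 1))" and ?y = "cmod (\<psi> (n - 1))" and ?z = "\<bar>V\<bar> * cmod (\<psi> n)"
    have "cmod (of_real (fib_potential V \<omega> n) * \<psi> n) \<le> ?z"
      by (auto simp: fib_potential_def norm_mult indicator_def)
    then have "cmod (fib_hamiltonian V \<omega> \<psi> n) \<le> ?x + ?y + ?z"
      unfolding fib_hamiltonian_def
      using norm_triangle_ineq[of "\<psi> (n + 1) + \<psi> (n - 1)" "of_real (fib_potential V \<omega> n) * \<psi> n"]
        norm_triangle_ineq[of "\<psi> (n + 1)" "\<psi> (n - 1)"] by linarith
    then have "(cmod (fib_hamiltonian V \<omega> \<psi> n))\<^sup>2 \<le> (?x + ?y + ?z)\<^sup>2"
      by (intro power_mono) auto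
    also have "\<dots> \<le> 3 * (?x\<^sup>2 + ?y\<^sup>2 + ?z\<^sup>2)"
    proof -
      have "0 \<le> (?x - ?y)\<^sup>2 + (?x - ?z)\<^sup>2 + (?y - ?z)\<^sup>2" by simp
      then show ?thesis by (simp add: power2_eq_square algebra_simps)
    qed
    finally show ?thesis by (simp add: power_mult_distrib)
  qed
  have main: "fib_hamiltonian V \<omega> \<psi> \<in> ell2 \<and>
      ell2_norm (fib_hamiltonian V \<omega> \<psi>) \<le> sqrt (3 * (2 + V\<^sup>2)) * ell2_norm \<psi>"
    if psi: "\<psi> \<in> ell2" for \<psi>
  proof -
    let ?f = "\<lambda>k n. (cmod (\<psi> (n + k)))\<^sup>2"
    let ?g = "\<lambda>n. 3 * (?f 1 n + ?f (-1) n + V\<^sup>2 * ?f 0 n)"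
    note s = ell2_norm_cong_shift(1)[OF psi]
    note i = ell2_norm_cong_shift(2)[OF psi]
    have s1: "(\<lambda>n. ?f 1 n + ?f (-1) n) summable_on UNIV"
      by (intro summable_on_add s)
    have s2: "(\<lambda>n. V\<^sup>2 * ?f 0 n) summable_on UNIV"
      by (intro summable_on_cmult_right s)
    have sg: "?g summable_on UNIV"
      by (intro summable_on_cmult_right summable_on_add s)
    have "infsum ?g UNIV = 3 * infsum (\<lambda>n. ?f 1 n + ?f (-1) n + V\<^sup>2 * ?f 0 n) UNIV"
      by (rule infsum_cmult_right) (intro summable_on_add s1 s2)
    also have "\<dots> = 3 * (infsum (?f 1) UNIV + infsum (?f (-1)) UNIV + infsum (\<lambda>n. V\<^sup>2 * ?f 0 n) UNIV)"
      by (simp only: infsum_add[OF s1 s2] infsum_add[OF s s])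
    also have "infsum (\<lambda>n. V\<^sup>2 * ?f 0 n) UNIV = V\<^sup>2 * infsum (?f 0) UNIV"
      by (rule infsum_cmult_right) (rule s)
    finally have ig: "infsum ?g UNIV = 3 * (2 + V\<^sup>2) * (ell2_norm \<psi>)\<^sup>2"
      by (simp only: i) (simp add: algebra_simps)
    have sh: "(\<lambda>n. (cmod (fib_hamiltonian V \<omega> \<psi> n))\<^sup>2) summable_on UNIV"
      by (rule summable_on_comparison_test[OF sg]) (use pt in auto)
    have "infsum (\<lambda>n. (cmod (fib_hamiltonian V \<omega> \<psi> n))\<^sup>2) UNIV \<le> infsum ?g UNIV"
      by (rule infsum_mono[OF sh sg]) (rule pt)
    then have "ell2_norm (fib_hamiltonian V \<omega> \<psi>) \<le> sqrt (3 * (2 + V\<^sup>2) * (ell2_norm \<psi>)\<^sup>2)"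
      unfolding ell2_norm_def[of "fib_hamiltonian V \<omega> \<psi>"] ig by (rule real_sqrt_le_mono)
    also have "\<dots> = sqrt (3 * (2 + V\<^sup>2)) * ell2_norm \<psi>"
      by (simp add: real_sqrt_mult ell2_norm_def infsum_nonneg)
    finally show ?thesis using sh by (simp add: ell2_def)
  qed
  show ?thesis
    unfolding bounded_operator_def
  proof (intro conjI ballI allI exI)
    show "fib_hamiltonian V \<omega> (\<lambda>n. c * \<phi> n + \<psi> n) =
        (\<lambda>n. c * fib_hamiltonian V \<omega> \<phi> n + fib_hamiltonian V \<omega> \<psi> n)" for \<phi> \<psi> c
      by (auto simp: fib_hamiltonian_def algebra_simps)
  qed (use main in blast)+
qed

end

theory Submission
  imports Defs
begin

text \<open>Let \<open>w\<^sub>k\<close> be the Fibonacci words and \<open>\<theta> = m * alpha + l\<close> a candidate rotation number. The lift to the angular line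
  of the transfer matrix of \<open>w\<^sub>k\<close>, minus the rotation by \<open>pi\<close> times the integer that \<open>\<theta>\<close> prescribes
  for \<open>w\<^sub>k\<close>, is a lift \<open>C\<^sub>k\<close> with \<open>C\<^sub>k\<^sub>+\<^sub>2\<close> the composition, in some order, of
  \<open>C\<^sub>k\<^sub>+\<^sub>1\<close> and \<open>C\<^sub>k\<close>. If at some energy \<open>C\<^sub>k\<close> and \<open>C\<^sub>k\<^sub>+\<^sub>1\<close> both move a common direction forward and
  another common one backward, then the cone between these directions is invariant, the energy lies in a
  gap, and the integrated density of states there is \<open>1 - \<theta>\<close> (rotation decreases with the energy).

  Suppose this never happens. If \<open>C\<^sub>k \<le> id\<close> then \<open>C\<^sub>k\<^sub>+\<^sub>2 \<le> C\<^sub>k\<^sub>+\<^sub>1\<close>, so at every energy \<open>C\<^sub>k\<^sub>+\<^sub>1 \<ge> id\<close> or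
  \<open>C\<^sub>k\<^sub>+\<^sub>2 \<le> id\<close>, and likewise with the inequalities reversed. Connectedness of the energy axis yields
  one energy at which \<open>C\<^sub>k \<le> id\<close> and \<open>C\<^sub>k \<ge> id\<close> hold alternately for all \<open>k\<close>. There the traces satisfy
  \<open>t\<^sub>k\<^sub>+\<^sub>3 \<ge> t\<^sub>k\<close> and \<open>\<bar>t\<^sub>k\<bar> \<le> 2\<close> eventually, hence converge along the residues mod 3. Twice each limit is the
  product of the other two, so the conserved Fricke invariant \<open>4 + V\<^sup>2\<close> equals the square of each limit,
  which is at most 4. (The remaining cases, in which the traces of even or of odd index are eventually
  at most \<open>-2\<close>, are impossible for small \<open>V\<close>.)

  Conversely, at an energy outside the spectrum solutions decay, so by Gordon's argument all traces
  eventually exceed 2 in modulus. Then \<open>w\<^sub>k\<close> has an integer rotation number for all large \<open>k\<close>; these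
  obey the Fibonacci recursion, by the Fricke invariant again, so the integrated density of
  states is in \<open>Z + alpha Z\<close>.\<close>

section \<open>Lifts of unimodular matrices to the angular line\<close>

text \<open>Lifts to the real line carry the argument because a gap is identified by an integer
  number of half turns, of which a matrix remembers only the parity. Being increasing and commuting
  with the shift by \<open>pi\<close>, lifts can be compared pointwise with the identity, and a
  displacement bounded at one direction is bounded at all.

  The alternation comes from the continued fraction of \<open>alpha\<close>:
  \<open>length (fibw k) * alpha\<close> exceeds the number of occupied sites by
  \<open>alpha ^ (k + 1)\<close> for even \<open>k\<close> and falls short of it by as much for odd
  \<open>k\<close>. A uniform rotation by \<open>pi * \<theta>\<close> per site would therefore move
  the relative lift by \<open>m * pi * alpha ^ (k + 1)\<close>, with a sign alternating in
  \<open>k\<close>; the sign of \<open>m\<close> decides which parity moves forward.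

  The order of concatenation alternates as well, so that the words follow the orbit of the phase
  between visits to the intervals \<open>[0, alpha ^ (2 * i))\<close>. Traces do not see this order.

  The definite descriptions of the spectrum and of the density of states mean something only after
  phase independence and convergence are known, so both are proved on the way, the latter at the
  energies that occur.\<close>

type_synonym mat2 = "real \<times> real \<times> real \<times> real"

fun mmul :: "mat2 \<Rightarrow> mat2 \<Rightarrow> mat2" where
  "mmul (a, b, c, d) (p, q, r, s) = (a*p + b*r, a*q + b * s, c*p + d*r, c*q + d * s)"

fun mdet :: "mat2 \<Rightarrow> real" where "mdet (a, b, c, d) = a*d - b*c"

fun mtr :: "mat2 \<Rightarrow> real" where "mtr (a, b, c, d) = a + d"

fun mapp :: "mat2 \<Rightarrow> real \<times> real \<Rightarrow> real \<times> real" where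
  "mapp (a, b, c, d) (x, y) = (a*x + b*y, c*x + d*y)"

fun wedge :: "real \<times> real \<Rightarrow> real \<times> real \<Rightarrow> real" where
  "wedge (x, y) (x', y') = x*y' - y*x'"

text \<open>A rotation by \<open>j\<close> half turns is (-1)^j, so this matrix belongs to a lift
  from which \<open>pi * j\<close> has been subtracted.\<close>

definition msgn :: "int \<Rightarrow> mat2 \<Rightarrow> mat2" where
  "msgn j M = (if even j then M else (case M of (a, b, c, d) \<Rightarrow> (-a, -b, -c, -d)))"

lemma mmul_assoc: "mmul (mmul A B) C = mmul A (mmul B C)"
  by (cases A; cases B; cases C) (simp add: algebra_simps)

lemma mapp_mmul: "mapp (mmul A B) v = mapp A (mapp B v)"
  by (cases A; cases B; cases v) (simp add: algebra_simps)

lemma mdet_mmul: "mdet (mmul A B) = mdet A * mdet B"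
  by (cases A; cases B) (simp add: algebra_simps)

lemma mtr_mmul_commute: "mtr (mmul A B) = mtr (mmul B A)"
  by (cases A; cases B) (simp add: algebra_simps)

lemma mmul_id [simp]: "mmul (1, 0, 0, 1) A = A" "mmul A (1, 0, 0, 1) = A"
  by (cases A; simp)+

lemma wedge_mapp: "wedge (mapp A v) (mapp A w) = mdet A * wedge v w"
  by (cases A; cases v; cases w) (simp add: algebra_simps)

lemma mdet_msgn [simp]: "mdet (msgn j M) = mdet M"
  by (cases M) (simp add: msgn_def)

lemma mtr_msgn: "mtr (msgn j M) = (if even j then mtr M else - mtr M)"
  by (cases M) (simp add: msgn_def)

lemma msgn_mmul: "msgn (i + j) (mmul A B) = mmul (msgn i A) (msgn j B)"
  by (cases A; cases B) (auto simp: msgn_def)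

abbreviation dir :: "real \<Rightarrow> real \<times> real" where "dir \<phi> \<equiv> (cos \<phi>, sin \<phi>)"

lemma wedge_dir: "wedge (dir a) (dir b) = sin (b - a)"
  by (simp add: sin_diff algebra_simps)

text \<open>Equivariance under \<open>pi\<close> lets \<open>F\<close> descend to lines through the
  origin, while the positive factor \<open>r\<close> keeps track of the sign: adding
  \<open>pi\<close> to \<open>F\<close> replaces \<open>M\<close> by its negative.\<close>

definition lifts :: "mat2 \<Rightarrow> (real \<Rightarrow> real) \<Rightarrow> bool" where
  "lifts M F \<longleftrightarrow> continuous_on UNIV F \<and> (\<forall>\<phi>. F (\<phi> + pi) = F \<phi> + pi) \<and>
     (\<forall>\<phi>. \<exists>r>0. mapp M (dir \<phi>) = (r * cos (F \<phi>), r * sin (F \<phi>)))"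

lemma liftsD:
  assumes "lifts M F"
  shows "continuous_on UNIV F" "F (\<phi> + pi) = F \<phi> + pi"
    "\<exists>r>0. mapp M (dir \<phi>) = (r * cos (F \<phi>), r * sin (F \<phi>))"
  using assms by (auto simp: lifts_def)

lemma mapp_scale: "mapp M (r * x, r * y) = (r * fst (mapp M (x, y)), r * snd (mapp M (x, y)))"
  by (cases M) (simp add: algebra_simps)

lemma cos_sin_diff_pi_int:
  "cos (x - pi * of_int j) = (if even j then cos x else - cos x)"
  "sin (x - pi * of_int j) = (if even j then sin x else - sin x)"
proof -
  have c: "cos (x - pi * of_int (2 * k)) = cos x" "sin (x - pi * of_int (2 * k)) = sin x" for k x
    using cos_int_2pin[of k] sin_int_2pin[of k] by (simp_all add: cos_diff sin_diff ac_simps)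
  have o: "x - pi * of_int (2 * k + 1) = (x - pi) - pi * of_int (2 * k)" for k
    by (simp add: algebra_simps)
  have "\<exists>k. j = 2 * k \<or> j = 2 * k + 1" by presburger
  then obtain k where k: "j = 2 * k \<or> j = 2 * k + 1" by blast
  then show "cos (x - pi * of_int j) = (if even j then cos x else - cos x)"
    using c[of x k] c[of "x - pi" k] o[of k] by (auto simp: cos_diff simp del: of_int_mult of_int_add)
  show "sin (x - pi * of_int j) = (if even j then sin x else - sin x)"
    using k c[of x k] c[of "x - pi" k] o[of k] by (auto simp: sin_diff simp del: of_int_mult of_int_add)
qed

lemma lifts_id: "lifts (1, 0, 0, 1) (\<lambda>\<phi>. \<phi>)"
  unfolding lifts_def by (auto intro!: exI[of _ 1])

lemma lifts_comp:
  assumes "lifts M F" "lifts N G"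
  shows "lifts (mmul M N) (\<lambda>\<phi>. F (G \<phi>))"
  unfolding lifts_def
proof (intro conjI allI)
  show "continuous_on UNIV (\<lambda>\<phi>. F (G \<phi>))"
    using continuous_on_compose2[OF liftsD(1)[OF assms(1)] liftsD(1)[OF assms(2)]] by simp
  show "F (G (\<phi> + pi)) = F (G \<phi>) + pi" for \<phi>
    by (simp add: liftsD(2)[OF assms(1)] liftsD(2)[OF assms(2)])
  fix \<phi>
  obtain r where r: "r > 0" "mapp N (dir \<phi>) = (r * cos (G \<phi>), r * sin (G \<phi>))"
    using liftsD(3)[OF assms(2)] by blast
  obtain s where s: "s > 0" "mapp M (dir (G \<phi>)) = (s * cos (F (G \<phi>)), s * sin (F (G \<phi>)))"
    using liftsD(3)[OF assms(1)] by blast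
  have "mapp (mmul M N) (dir \<phi>) = ((r * s) * cos (F (G \<phi>)), (r * s) * sin (F (G \<phi>)))"
    unfolding mapp_mmul r(2) mapp_scale s(2) by simp
  then show "\<exists>r>0. mapp (mmul M N) (dir \<phi>) = (r * cos (F (G \<phi>)), r * sin (F (G \<phi>)))"
    using r(1) s(1) by (intro exI[of _ "r * s"]) auto
qed

lemma lifts_shift_nat:
  assumes "lifts M F" shows "F (\<phi> + pi * real n) = F \<phi> + pi * real n"
proof (induction n)
  case (Suc n)
  have "F (\<phi> + pi * real (Suc n)) = F ((\<phi> + pi * real n) + pi)" by (simp add: algebra_simps)
  then show ?case using Suc liftsD(2)[OF assms, of "\<phi> + pi * real n"] by (simp add: algebra_simps)
qed simp

lemma lifts_shift:
  assumes "lifts M F" shows "F (\<phi> + pi * of_int j) = F \<phi> + pi * of_int j"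
proof (cases "j \<ge> 0")
  case True
  then show ?thesis using lifts_shift_nat[OF assms, of \<phi> "nat j"] by simp
next
  case False
  then show ?thesis using lifts_shift_nat[OF assms, of "\<phi> + pi * of_int j" "nat (-j)"] by simp
qed

lemma lifts_msgn:
  assumes "lifts M F" shows "lifts (msgn j M) (\<lambda>\<phi>. F \<phi> - pi * of_int j)"
  unfolding lifts_def
proof (intro conjI allI)
  show "continuous_on UNIV (\<lambda>\<phi>. F \<phi> - pi * real_of_int j)"
    by (intro continuous_intros liftsD(1)[OF assms])
  show "F (\<phi> + pi) - pi * of_int j = F \<phi> - pi * of_int j + pi" for \<phi>
    using liftsD(2)[OF assms] by simp
  fix \<phi>
  obtain r where r: "r > 0" "mapp M (dir \<phi>) = (r * cos (F \<phi>), r * sin (F \<phi>))"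
    using liftsD(3)[OF assms] by blast
  show "\<exists>r>0. mapp (msgn j M) (dir \<phi>) =
      (r * cos (F \<phi> - pi * of_int j), r * sin (F \<phi> - pi * of_int j))"
    using r by (intro exI[of _ r]) (cases M; auto simp: msgn_def cos_sin_diff_pi_int)
qed

text \<open>Determinant 1 preserves \<open>wedge\<close>, so
  \<open>sin (F \<psi> - F \<phi>)\<close> has the sign of \<open>sin (\<psi> - \<phi>)\<close>. For
  directions less than \<open>pi\<close> apart continuity then excludes a negative difference of the
  images, and equivariance extends this to all pairs.\<close>

lemma lifts_strict_mono:
  assumes L: "lifts M F" and d: "mdet M = 1"
  shows "strict_mono F"
proof -
  have sin_pos: "sin (F \<psi> - F \<phi>) > 0" if "\<phi> < \<psi>" "\<psi> < \<phi> + pi" for \<phi> \<psi>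
  proof -
    obtain r where r: "r > 0" "mapp M (dir \<phi>) = (r * cos (F \<phi>), r * sin (F \<phi>))"
      using liftsD(3)[OF L] by blast
    obtain s where s: "s > 0" "mapp M (dir \<psi>) = (s * cos (F \<psi>), s * sin (F \<psi>))"
      using liftsD(3)[OF L] by blast
    have "wedge (mapp M (dir \<phi>)) (mapp M (dir \<psi>)) = sin (\<psi> - \<phi>)"
      unfolding wedge_mapp d wedge_dir by simp
    also have "\<dots> > 0" using that by (intro sin_gt_zero) auto
    also have "wedge (mapp M (dir \<phi>)) (mapp M (dir \<psi>)) = (r * s) * sin (F \<psi> - F \<phi>)"
      unfolding r(2) s(2) by (simp add: sin_diff algebra_simps)
    finally show ?thesis using mult_pos_pos[OF r(1) s(1)] by (rule zero_less_mult_pos)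
  qed
  have short: "F \<phi> < F \<psi>" if h: "\<phi> < \<psi>" "\<psi> < \<phi> + pi" for \<phi> \<psi>
  proof (rule ccontr)
    assume "\<not> F \<phi> < F \<psi>"
    then have le: "F \<psi> - F \<phi> \<le> 0" by simp
    \<comment> \<open>The sine is nonpositive on [-pi, 0], so a nonpositive difference would have to
      lie below -pi. On its way down from 0 it would equal -pi/2, where the sine is
      negative.\<close>
    have "F \<psi> - F \<phi> < - pi"
    proof (rule ccontr)
      assume "\<not> F \<psi> - F \<phi> < - pi"
      then have "sin (- (F \<psi> - F \<phi>)) \<ge> 0" using le by (intro sin_ge_zero) auto
      then show False using sin_pos[OF h] unfolding sin_minus by simp
    qed
    then have "\<exists>x\<ge>\<phi>. x \<le> \<psi> \<and> F x - F \<phi> = - (pi/2)"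
      using h by (intro IVT2') (auto intro!: continuous_intros continuous_on_subset[OF liftsD(1)[OF L]])
    then obtain x where x: "\<phi> \<le> x" "x \<le> \<psi>" "F x - F \<phi> = - (pi/2)" by blast
    with sin_pos[of \<phi> x] h show False by (cases "x = \<phi>") auto
  qed
  show ?thesis
  proof (rule strict_monoI)
    fix \<phi> \<psi> :: real assume lt: "\<phi> < \<psi>"
    define n where "n = \<lfloor>(\<psi> - \<phi>) / pi\<rfloor>"
    have n0: "n \<ge> 0" using lt by (simp add: n_def)
    have "of_int n \<le> (\<psi> - \<phi>) / pi" "(\<psi> - \<phi>) / pi < of_int n + 1"
      unfolding n_def by linarith+
    then have b: "\<phi> \<le> \<psi> - pi * of_int n" "\<psi> - pi * of_int n < \<phi> + pi"
      by (simp_all add: field_simps)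
    have eq: "F \<psi> = F (\<psi> - pi * of_int n) + pi * of_int n"
      using lifts_shift[OF L, of "\<psi> - pi * of_int n" n] by simp
    show "F \<phi> < F \<psi>"
    proof (cases "\<phi> = \<psi> - pi * of_int n")
      case True
      then have "of_int n > (0::real)" using lt by (simp add: zero_less_mult_iff)
      then show ?thesis using eq True by simp
    next
      case False
      then have "F \<phi> < F (\<psi> - pi * of_int n)" using b by (intro short) auto
      moreover have "pi * of_int n \<ge> 0" using n0 by simp
      ultimately show ?thesis using eq by linarith
    qed
  qed
qed

text \<open>The step matrix is a quarter turn followed by the shear \<open>(1, e, 0, 1)\<close>. The
  complex number is the quotient of the sheared direction by the direction itself, so its argument
  is the angle added by the shear. It avoids the branch cut of \<open>Arg\<close>, which makes the
  lift jointly continuous and its displacement smaller than \<open>pi\<close>.\<close>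

definition shear_lift :: "real \<Rightarrow> real \<Rightarrow> real" where
  "shear_lift e \<phi> = \<phi> + Arg (Complex (1 + e * sin \<phi> * cos \<phi>) (- e * (sin \<phi>)\<^sup>2))"

definition step_lift :: "real \<Rightarrow> real \<Rightarrow> real" where
  "step_lift e \<phi> = shear_lift e (\<phi> + pi / 2)"

definition step_mat :: "real \<Rightarrow> mat2" where "step_mat e = (e, -1, 1, 0)"

lemma mdet_step_mat [simp]: "mdet (step_mat e) = 1" by (simp add: step_mat_def)

lemma shear_arg_nonpos:
  "Complex (1 + e * sin \<phi> * cos \<phi>) (- e * (sin \<phi>)\<^sup>2) \<notin> \<real>\<^sub>\<le>\<^sub>0"
  by (auto simp: complex_nonpos_Reals_iff)

lemma shear_lift_cont:
  fixes S :: "real set"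
  assumes "continuous_on S f" "continuous_on S g"
  shows "continuous_on S (\<lambda>x. shear_lift (f x) (g x))"
  unfolding shear_lift_def
  by (intro continuous_intros continuous_on_sin continuous_on_cos assms continuous_on_Complex shear_arg_nonpos ballI)

lemma step_lift_cont:
  fixes S :: "real set"
  assumes "continuous_on S f" "continuous_on S g"
  shows "continuous_on S (\<lambda>x. step_lift (f x) (g x))"
  unfolding step_lift_def by (intro shear_lift_cont continuous_intros assms)

lemma shear_lift_dir:
  "\<exists>r>0. (cos \<phi> + e * sin \<phi>, sin \<phi>) = (r * cos (shear_lift e \<phi>), r * sin (shear_lift e \<phi>))"
proof -
  define w where "w = Complex (1 + e * sin \<phi> * cos \<phi>) (- e * (sin \<phi>)\<^sup>2)"
  have w0: "w \<noteq> 0" using shear_arg_nonpos[of e \<phi>] unfolding w_def by auto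
  have "of_real (cmod w) * cis (shear_lift e \<phi>) = w * cis \<phi>"
    using rcis_cmod_Arg[of w] unfolding shear_lift_def w_def[symmetric] rcis_def
    by (simp add: cis_mult[symmetric] ac_simps)
  moreover have "w * cis \<phi> = Complex (cos \<phi> + e * sin \<phi>) (sin \<phi>)"
  proof (rule complex_eqI)
    have "e * sin \<phi> * (cos \<phi> * cos \<phi>) + e * sin \<phi> * (sin \<phi> * sin \<phi>) = e * sin \<phi>"
      unfolding distrib_left[symmetric] using sin_cos_squared_add3[of \<phi>] by simp
    then show "Re (w * cis \<phi>) = Re (Complex (cos \<phi> + e * sin \<phi>) (sin \<phi>))"
      by (simp add: w_def power2_eq_square algebra_simps)
    show "Im (w * cis \<phi>) = Im (Complex (cos \<phi> + e * sin \<phi>) (sin \<phi>))"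
      by (simp add: w_def power2_eq_square algebra_simps)
  qed
  ultimately have "of_real (cmod w) * cis (shear_lift e \<phi>) = Complex (cos \<phi> + e * sin \<phi>) (sin \<phi>)" by simp
  then have "cos \<phi> + e * sin \<phi> = cmod w * cos (shear_lift e \<phi>)" "sin \<phi> = cmod w * sin (shear_lift e \<phi>)"
    by (auto simp: complex_eq_iff)
  then show ?thesis using w0 by (intro exI[of _ "cmod w"]) auto
qed

lemma lifts_step: "lifts (step_mat e) (step_lift e)"
  unfolding lifts_def
proof (intro conjI allI)
  show "continuous_on UNIV (step_lift e)"
    by (intro step_lift_cont continuous_intros)
  show "step_lift e (\<phi> + pi) = step_lift e \<phi> + pi" for \<phi>
  proof -
    have "\<phi> + pi + pi/2 = (\<phi> + pi/2) + pi" by simp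
    then show ?thesis unfolding step_lift_def shear_lift_def
      by (simp only: sin_periodic_pi cos_periodic_pi) simp
  qed
  show "\<exists>r>0. mapp (step_mat e) (dir \<phi>) = (r * cos (step_lift e \<phi>), r * sin (step_lift e \<phi>))" for \<phi>
    using shear_lift_dir[of "\<phi> + pi/2" e]
    by (simp add: step_lift_def step_mat_def cos_add sin_add algebra_simps)
qed

lemma shear_lift_bound: "\<bar>shear_lift e \<phi> - \<phi>\<bar> < pi"
proof -
  let ?w = "Complex (1 + e * sin \<phi> * cos \<phi>) (- e * (sin \<phi>)\<^sup>2)"
  have "Arg ?w \<noteq> pi"
    using shear_arg_nonpos[of e \<phi>] by (auto simp: Arg_eq_pi complex_nonpos_Reals_iff)
  then show ?thesis using Arg_bounded[of ?w] by (auto simp: shear_lift_def abs_less_iff)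
qed

lemma step_lift_bound: "\<bar>step_lift e \<phi> - \<phi>\<bar> < 2 * pi"
  using shear_lift_bound[of e "\<phi> + pi/2"] unfolding step_lift_def abs_less_iff by (simp add: field_simps)

lemma shear_lift_pi_int [simp]: "shear_lift e (pi * of_int n) = pi * of_int n"
proof -
  have "sin (pi * of_int n) = 0" by (auto simp: sin_zero_iff_int2)
  then show ?thesis by (simp add: shear_lift_def one_complex.code[symmetric])
qed


lemma lifts_shear: "lifts (1, e, 0, 1) (shear_lift e)"
  unfolding lifts_def
proof (intro conjI allI)
  show "continuous_on UNIV (shear_lift e)"
    by (intro shear_lift_cont continuous_intros)
  show "shear_lift e (\<phi> + pi) = shear_lift e \<phi> + pi" for \<phi>
    by (simp add: shear_lift_def)
  show "\<exists>r>0. mapp (1, e, 0, 1) (dir \<phi>) = (r * cos (shear_lift e \<phi>), r * sin (shear_lift e \<phi>))" for \<phi>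
    using shear_lift_dir[of \<phi> e] by simp
qed

lemma strict_mono_shear_lift: "strict_mono (shear_lift e)"
  by (rule lifts_strict_mono[OF lifts_shear]) simp

lemma shear_lift_interval:
  assumes "pi * of_int n \<le> \<phi>" "\<phi> < pi * of_int (n + 1)"
  shows "pi * of_int n \<le> shear_lift e \<phi>" "shear_lift e \<phi> < pi * of_int (n + 1)"
  using strict_mono_less_eq[OF strict_mono_shear_lift[of e], of "pi * of_int n" \<phi>]
    strict_mono_less[OF strict_mono_shear_lift[of e], of \<phi> "pi * of_int (n + 1)"] assms
  by (simp_all only: shear_lift_pi_int)

lemma lifts_same_sin:
  assumes "lifts M F" "lifts M G"
  shows "sin (F \<phi> - G \<phi>) = 0"
proof -
  obtain r where r: "r > 0" "mapp M (dir \<phi>) = (r * cos (F \<phi>), r * sin (F \<phi>))"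
    using liftsD(3)[OF assms(1)] by blast
  obtain s where s: "s > 0" "mapp M (dir \<phi>) = (s * cos (G \<phi>), s * sin (G \<phi>))"
    using liftsD(3)[OF assms(2)] by blast
  have e: "r * cos (F \<phi>) = s * cos (G \<phi>)" "r * sin (F \<phi>) = s * sin (G \<phi>)" using r s by auto
  have "r * sin (F \<phi> - G \<phi>) = (r * sin (F \<phi>)) * cos (G \<phi>) - (r * cos (F \<phi>)) * sin (G \<phi>)"
    by (simp add: sin_diff algebra_simps)
  also have "\<dots> = 0" unfolding e by simp
  finally show ?thesis using r(1) by simp
qed

lemma sin_zero_abs_less_pi:
  assumes "sin x = 0" "\<bar>x\<bar> < pi" shows "x = 0"
  using assms sin_eq_0_pi[of x] by (auto simp: abs_less_iff)

text \<open>Both sides lift the same matrix and hence differ by a multiple of \<open>pi\<close>.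
  Since shears fix the multiples of \<open>pi\<close>, both keep \<open>\<phi>\<close> between the
  same two neighbours, so the difference is smaller than \<open>pi\<close>.\<close>

lemma shear_lift_add: "shear_lift (d + e) \<phi> = shear_lift d (shear_lift e \<phi>)"
proof -
  define n where "n = \<lfloor>\<phi> / pi\<rfloor>"
  have "of_int n \<le> \<phi> / pi" "\<phi> / pi < of_int (n + 1)"
    unfolding n_def by linarith+
  then have n: "pi * of_int n \<le> \<phi>" "\<phi> < pi * of_int (n + 1)"
    by (simp_all add: field_simps)
  have "lifts (mmul (1, d, 0, 1) (1, e, 0, 1)) (\<lambda>\<phi>. shear_lift d (shear_lift e \<phi>))"
    by (intro lifts_comp lifts_shear)
  moreover have "mmul (1, d, 0, 1) (1, e, 0, 1) = (1, d + e, 0, 1)" by simp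
  ultimately have "sin (shear_lift (d + e) \<phi> - shear_lift d (shear_lift e \<phi>)) = 0"
    using lifts_same_sin[OF lifts_shear] by metis
  moreover have "\<bar>shear_lift (d + e) \<phi> - shear_lift d (shear_lift e \<phi>)\<bar> < pi"
    using shear_lift_interval[OF n, of "d + e"]
      shear_lift_interval[OF shear_lift_interval[OF n, of e], of d]
    by (simp add: abs_less_iff algebra_simps)
  ultimately show ?thesis using sin_zero_abs_less_pi by fastforce
qed

lemma shear_lift_le:
  assumes "d \<ge> 0" shows "shear_lift d \<phi> \<le> \<phi>"
proof -
  let ?w = "Complex (1 + d * sin \<phi> * cos \<phi>) (- d * (sin \<phi>)\<^sup>2)"
  have "\<not> 0 < Im ?w" using assms by (simp add: not_less)
  moreover have "Arg ?w \<noteq> pi"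
    using shear_arg_nonpos[of d \<phi>] by (auto simp: Arg_eq_pi complex_nonpos_Reals_iff)
  ultimately have "Arg ?w \<le> 0"
    using Arg_lt_pi[of ?w] Arg_bounded[of ?w] by linarith
  then show ?thesis by (simp add: shear_lift_def)
qed

lemma shear_lift_less:
  assumes "d > 0" "sin \<phi> \<noteq> 0" shows "shear_lift d \<phi> < \<phi>"
proof -
  let ?w = "Complex (1 + d * sin \<phi> * cos \<phi>) (- d * (sin \<phi>)\<^sup>2)"
  have "Im ?w < 0" using assms by simp
  then have "Arg ?w \<noteq> 0" by (metis Arg_eq_0 complex_is_Real_iff less_irrefl)
  then show ?thesis using shear_lift_le[of d \<phi>] assms by (auto simp: shear_lift_def)
qed

text \<open>Raising the energy composes the step with one more shear, and that shear turns
  clockwise.\<close>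

lemma step_lift_antimono:
  assumes "e \<le> e'" shows "step_lift e' \<phi> \<le> step_lift e \<phi>"
  using shear_lift_add[of "e' - e" e "\<phi> + pi/2"] shear_lift_le[of "e' - e"] assms
  by (simp add: step_lift_def)

text \<open>A shear turns strictly except at horizontal directions. The quarter turn takes 0 to
  \<open>pi / 2\<close>, which the first shear keeps strictly between 0 and
  \<open>pi\<close>.\<close>

lemma step_lift_zero_less:
  assumes "e < e'" shows "step_lift e' 0 < step_lift e 0"
proof -
  have "sin (shear_lift e (pi/2)) \<noteq> 0"
  proof
    assume "sin (shear_lift e (pi/2)) = 0"
    moreover have "0 < shear_lift e (pi/2)"
      using strict_mono_less[OF strict_mono_shear_lift, of e 0 "pi/2"] shear_lift_pi_int[of e 0] by simp
    moreover have "shear_lift e (pi/2) < pi"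
      using strict_mono_less[OF strict_mono_shear_lift, of e "pi/2" pi] shear_lift_pi_int[of e 1] by simp
    ultimately show False using sin_gt_zero by fastforce
  qed
  then show ?thesis
    using shear_lift_add[of "e' - e" e "pi/2"] shear_lift_less[of "e' - e"] assms
    by (simp add: step_lift_def)
qed

lemma strict_mono_step_lift: "strict_mono (step_lift e)"
  by (rule lifts_strict_mono[OF lifts_step]) simp

section \<open>Cocycles over words\<close>

text \<open>The head of the word is the leftmost site and acts first, so matrices of concatenated
  words multiply in reverse order. \<open>True\<close> marks a site carrying the potential.\<close>

fun wlift :: "real \<Rightarrow> real \<Rightarrow> bool list \<Rightarrow> real \<Rightarrow> real" where
  "wlift V E [] \<phi> = \<phi>"
| "wlift V E (b # w) \<phi> = wlift V E w (step_lift (E - (if b then V else 0)) \<phi>)"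

fun wmat :: "real \<Rightarrow> real \<Rightarrow> bool list \<Rightarrow> mat2" where
  "wmat V E [] = (1, 0, 0, 1)"
| "wmat V E (b # w) = mmul (wmat V E w) (step_mat (E - (if b then V else 0)))"

lemma wlift_append: "wlift V E (u @ v) \<phi> = wlift V E v (wlift V E u \<phi>)"
  by (induction u arbitrary: \<phi>) auto

lemma wmat_append: "wmat V E (u @ v) = mmul (wmat V E v) (wmat V E u)"
  by (induction u) (auto simp: mmul_assoc)

lemma lifts_wlift: "lifts (wmat V E w) (wlift V E w)"
proof (induction w)
  case Nil
  then show ?case using lifts_id by (simp add: fun_eq_iff[symmetric])
next
  case (Cons b w)
  have "wlift V E (b # w) = (\<lambda>\<phi>. wlift V E w (step_lift (E - (if b then V else 0)) \<phi>))" by auto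
  then show ?case using lifts_comp[OF Cons lifts_step] by simp
qed

lemma mdet_wmat [simp]: "mdet (wmat V E w) = 1"
  by (induction w) (auto simp: mdet_mmul)

lemma strict_mono_wlift: "strict_mono (wlift V E w)"
  by (rule lifts_strict_mono[OF lifts_wlift]) simp

lemma wlift_bound: "\<bar>wlift V E w \<phi> - \<phi>\<bar> \<le> 2 * pi * length w"
proof (induction w arbitrary: \<phi>)
  case (Cons b w)
  let ?s = "step_lift (E - (if b then V else 0)) \<phi>"
  have "\<bar>wlift V E w ?s - ?s\<bar> \<le> 2 * pi * length w" by (rule Cons)
  moreover have "\<bar>?s - \<phi>\<bar> < 2 * pi" by (rule step_lift_bound)
  ultimately show ?case by (simp add: algebra_simps)
qed simp

lemma continuous_wlift_energy:
  assumes "continuous_on UNIV g"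
  shows "continuous_on UNIV (\<lambda>E. wlift V E w (g E))"
  using assms
proof (induction w arbitrary: g)
  case (Cons b w)
  show ?case unfolding wlift.simps
    by (rule Cons.IH) (intro step_lift_cont continuous_intros Cons.prems)
qed simp

lemma wlift_antimono:
  assumes "E \<le> E'" "\<phi>' \<le> \<phi>"
  shows "wlift V E' w \<phi>' \<le> wlift V E w \<phi>"
  using assms(2)
proof (induction w arbitrary: \<phi> \<phi>')
  case (Cons b w)
  have "step_lift (E' - (if b then V else 0)) \<phi>' \<le> step_lift (E' - (if b then V else 0)) \<phi>"
    using Cons.prems by (simp add: strict_mono_less_eq[OF strict_mono_step_lift])
  also have "\<dots> \<le> step_lift (E - (if b then V else 0)) \<phi>"
    using assms(1) by (intro step_lift_antimono) auto
  finally show ?case unfolding wlift.simps by (rule Cons.IH)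
qed simp

lemma wlift_zero_less:
  assumes "E < E'" "w \<noteq> []" shows "wlift V E' w 0 < wlift V E w 0"
proof (cases w)
  case (Cons b u)
  let ?v = "if b then V else 0"
  have "wlift V E' u (step_lift (E' - ?v) 0) \<le> wlift V E u (step_lift (E' - ?v) 0)"
    using assms(1) by (intro wlift_antimono) auto
  also have "\<dots> < wlift V E u (step_lift (E - ?v) 0)"
    using assms(1) by (simp only: strict_mono_less[OF strict_mono_wlift]) (auto intro: step_lift_zero_less)
  finally show ?thesis using Cons by simp
qed (use assms in simp)

text \<open>For the candidate rotation number \<open>m * alpha + l\<close> every site carries the rotation \<open>l * pi\<close>, and
  \<open>(m + l) * pi\<close> if it is occupied; \<open>clift\<close> is the cocycle relative to this rotation.\<close>

definition wlab :: "int \<Rightarrow> int \<Rightarrow> bool list \<Rightarrow> int" where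
  "wlab m l w = m * int (length (filter id w)) + l * int (length w)"

definition clift :: "int \<Rightarrow> int \<Rightarrow> real \<Rightarrow> real \<Rightarrow> bool list \<Rightarrow> real \<Rightarrow> real" where
  "clift m l V E w \<phi> = wlift V E w \<phi> - pi * of_int (wlab m l w)"

definition cmat :: "int \<Rightarrow> int \<Rightarrow> real \<Rightarrow> real \<Rightarrow> bool list \<Rightarrow> mat2" where
  "cmat m l V E w = msgn (wlab m l w) (wmat V E w)"

lemma wlab_append: "wlab m l (u @ v) = wlab m l u + wlab m l v"
  by (simp add: wlab_def algebra_simps)

lemma lifts_clift: "lifts (cmat m l V E w) (clift m l V E w)"
  using lifts_msgn[OF lifts_wlift] by (simp add: cmat_def clift_def[abs_def])

lemma clift_append: "clift m l V E (u @ v) \<phi> = clift m l V E v (clift m l V E u \<phi>)"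
  using lifts_shift[OF lifts_wlift, of V E v "wlift V E u \<phi>" "- wlab m l u"]
  by (simp add: clift_def wlift_append wlab_append algebra_simps)

lemma cmat_append: "cmat m l V E (u @ v) = mmul (cmat m l V E v) (cmat m l V E u)"
  unfolding cmat_def wmat_append wlab_append by (subst add.commute) (rule msgn_mmul)

lemma mdet_cmat [simp]: "mdet (cmat m l V E w) = 1"
  by (simp add: cmat_def)

lemma strict_mono_clift: "strict_mono (clift m l V E w)"
  by (rule lifts_strict_mono[OF lifts_clift]) simp

lemma continuous_clift_energy: "continuous_on UNIV (\<lambda>E. clift m l V E w \<phi>)"
  unfolding clift_def by (intro continuous_intros continuous_wlift_energy)

lemma clift_bound:
  "\<bar>clift m l V E w \<phi> - \<phi>\<bar> \<le> pi * (2 + \<bar>m\<bar> + \<bar>l\<bar>) * length w"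
proof -
  have "length (filter id w) \<le> length w" by simp
  then have "\<bar>m\<bar> * int (length (filter id w)) \<le> \<bar>m\<bar> * int (length w)"
    by (intro mult_left_mono) auto
  then have "\<bar>wlab m l w\<bar> \<le> (\<bar>m\<bar> + \<bar>l\<bar>) * int (length w)"
    using abs_triangle_ineq[of "m * int (length (filter id w))" "l * int (length w)"]
    unfolding wlab_def by (simp add: abs_mult distrib_right)
  then have "pi * of_int \<bar>wlab m l w\<bar> \<le> pi * of_int ((\<bar>m\<bar> + \<bar>l\<bar>) * int (length w))"
    by (intro mult_left_mono of_int_le_iff[THEN iffD2]) auto
  then have "\<bar>pi * of_int (wlab m l w)\<bar> \<le> pi * (\<bar>m\<bar> + \<bar>l\<bar>) * length w"
    by (simp add: abs_mult)
  moreover have "\<bar>clift m l V E w \<phi> - \<phi>\<bar> \<le> \<bar>wlift V E w \<phi> - \<phi>\<bar> + \<bar>pi * of_int (wlab m l w)\<bar>"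
    unfolding clift_def by linarith
  ultimately show ?thesis using wlift_bound[of V E w \<phi>] by (simp add: algebra_simps)
qed

section \<open>Itineraries of the rotation\<close>

lemma alpha_bounds: "1/2 < alpha" "alpha < 1" "0 < alpha"
proof -
  have "2 < sqrt 5" by (rule real_less_rsqrt) simp
  moreover have "sqrt 5 < 3" by (rule real_less_lsqrt) auto
  ultimately show "1/2 < alpha" "alpha < 1" "0 < alpha" unfolding alpha_def by auto
qed

lemma alpha_sq: "alpha * alpha = 1 - alpha"
  unfolding alpha_def by (simp add: field_simps)

lemma alpha_power_Suc2: "alpha ^ Suc (Suc n) = alpha ^ n - alpha ^ Suc n"
proof -
  have "alpha ^ Suc (Suc n) = (alpha * alpha) * alpha ^ n" by simp
  also have "\<dots> = alpha ^ n - alpha ^ Suc n" unfolding alpha_sq by (simp add: algebra_simps)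
  finally show ?thesis .
qed

lemma alpha_power_pos [simp]: "0 < alpha ^ n" using alpha_bounds by simp

lemma alpha_power_Suc_less: "alpha ^ Suc n < alpha ^ n"
  using alpha_bounds by (simp add: power_Suc_less)

text \<open>With this alternating order, \<open>fibw (2 * i)\<close> and
  \<open>fibw (2 * i + 1)\<close> are the two words read by the rotation between visits to an
  interval whose left end is always 0; see \<open>itinerary\<close>.\<close>

fun fibw :: "nat \<Rightarrow> bool list" where
  "fibw 0 = [False]"
| "fibw (Suc 0) = [True]"
| "fibw (Suc (Suc n)) = (if even n then fibw n @ fibw (Suc n) else fibw (Suc n) @ fibw n)"

abbreviation occn :: "bool list \<Rightarrow> nat" where "occn w \<equiv> length (filter id w)"

definition occ :: "real \<Rightarrow> int \<Rightarrow> bool" where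
  "occ \<omega> n \<longleftrightarrow> 1 - alpha \<le> frac (of_int n * alpha + \<omega>)"

definition pos :: "real \<Rightarrow> int \<Rightarrow> real" where
  "pos \<omega> n = frac (of_int n * alpha + \<omega>)"

definition window :: "real \<Rightarrow> int \<Rightarrow> nat \<Rightarrow> bool list" where
  "window \<omega> n L = map (\<lambda>j. occ \<omega> (n + int j)) [0..<L]"

lemma fib_potential_occ: "fib_potential V \<omega> n = (if occ \<omega> n then V else 0)"
  by (simp add: fib_potential_def occ_def indicator_def frac_lt_1)

lemma length_window [simp]: "length (window \<omega> n L) = L" by (simp add: window_def)

lemma window_0 [simp]: "window \<omega> n 0 = []" by (simp add: window_def)

lemma window_add: "window \<omega> n (L + M) = window \<omega> n L @ window \<omega> (n + int L) M"
proof -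
  have "[0..<L + M] = [0..<L] @ map (\<lambda>j. L + j) [0..<M]"
    by (rule nth_equalityI) (auto simp: nth_append)
  then show ?thesis by (simp add: window_def o_def algebra_simps)
qed

lemma window_Suc: "window \<omega> n (Suc L) = occ \<omega> n # window \<omega> (n + 1) L"
  using window_add[of \<omega> n 1 L] by (simp add: window_def)

lemma pos_bounds: "0 \<le> pos \<omega> n" "pos \<omega> n < 1"
  by (simp_all add: pos_def frac_lt_1)

lemma pos_unique:
  assumes "0 \<le> y" "y < 1" "of_int n * alpha + \<omega> = y + of_int k"
  shows "pos \<omega> n = y"
  using assms by (simp add: pos_def frac_unique_iff)

lemma pos_eq: "of_int n * alpha + \<omega> = pos \<omega> n + of_int \<lfloor>of_int n * alpha + \<omega>\<rfloor>"
  by (simp add: pos_def frac_def)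

lemma pos_Suc: "pos \<omega> (n + 1) = pos \<omega> n + alpha - (if occ \<omega> n then 1 else 0)"
proof (rule pos_unique)
  have o: "occ \<omega> n \<longleftrightarrow> 1 - alpha \<le> pos \<omega> n" by (simp add: occ_def pos_def)
  show "0 \<le> pos \<omega> n + alpha - (if occ \<omega> n then 1 else 0)"
    "pos \<omega> n + alpha - (if occ \<omega> n then 1 else 0) < 1"
    using pos_bounds[of \<omega> n] alpha_bounds o by auto
  show "of_int (n + 1) * alpha + \<omega> = pos \<omega> n + alpha - (if occ \<omega> n then 1 else 0) +
      of_int (\<lfloor>of_int n * alpha + \<omega>\<rfloor> + (if occ \<omega> n then 1 else 0))"
    using pos_eq[of n \<omega>] by (simp add: algebra_simps)
qed

lemma occn_window: "real (occn (window \<omega> n L)) = L * alpha + pos \<omega> n - pos \<omega> (n + int L)"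
proof (induction L arbitrary: n)
  case (Suc L)
  have "pos \<omega> (n + int (Suc L)) = pos \<omega> (n + 1 + int L)" by (simp add: algebra_simps)
  then show ?case using Suc[of "n + 1"] pos_Suc[of \<omega> n]
    by (cases "occ \<omega> n") (simp_all add: window_Suc algebra_simps)
qed simp

lemma occn_window_bound: "\<bar>real (occn (window \<omega> n L)) - L * alpha\<bar> \<le> 1"
  using occn_window[of \<omega> n L] pos_bounds[of \<omega> n] pos_bounds[of \<omega> "n + int L"] by linarith

text \<open>Rauzy induction: the return map to \<open>[0, alpha ^ (2 * i))\<close> exchanges two
  intervals, moving one by \<open>alpha ^ (2 * i + 1)\<close> to the right and the other by
  \<open>alpha ^ (2 * i + 2)\<close> to the left. On the next smaller interval the left part reads
  the even word and then the odd one, and the right part needs one further odd word to come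
  back.\<close>

lemma itinerary:
  shows "pos \<omega> n < alpha ^ (2*i+2) \<Longrightarrow> window \<omega> n (length (fibw (2*i))) = fibw (2*i) \<and>
      pos \<omega> (n + int (length (fibw (2*i)))) = pos \<omega> n + alpha ^ (2*i+1)"
    and "alpha ^ (2*i+2) \<le> pos \<omega> n \<Longrightarrow> pos \<omega> n < alpha ^ (2*i) \<Longrightarrow>
      window \<omega> n (length (fibw (2*i+1))) = fibw (2*i+1) \<and>
      pos \<omega> (n + int (length (fibw (2*i+1)))) = pos \<omega> n - alpha ^ (2*i+2)"
proof (induction i arbitrary: n)
  case 0
  have o: "occ \<omega> n \<longleftrightarrow> 1 - alpha \<le> pos \<omega> n" for n by (simp add: occ_def pos_def)
  { case 1 then show ?case using pos_Suc[of \<omega> n] o[of n] by (simp add: window_Suc alpha_sq) }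
  { case 2 then show ?case using pos_Suc[of \<omega> n] o[of n] by (simp add: window_Suc alpha_sq) }
next
  case (Suc i)
  let ?A = "fibw (2*i)" and ?B = "fibw (2*i+1)"
  let ?a = "alpha ^ (2*i+2)" and ?b = "alpha ^ (2*i+1)"
  have e: "2 * Suc i = Suc (Suc (2*i))" "2 * Suc i + 1 = Suc (Suc (Suc (2*i)))" by simp_all
  have w: "fibw (2 * Suc i) = ?A @ ?B" "fibw (2 * Suc i + 1) = (?A @ ?B) @ ?B" by simp_all
  have p: "alpha ^ (2*i) = ?a + ?b" "alpha ^ (2 * Suc i + 1) = ?b - ?a" "alpha ^ (2 * Suc i + 2) = ?a - (?b - ?a)"
    using alpha_power_Suc2[of "2*i"] alpha_power_Suc2[of "2*i+1"] alpha_power_Suc2[of "2*i+2"] by simp_all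
  have lt: "?a < ?b" using alpha_power_Suc_less[of "2*i+1"] by simp
  have lt2: "0 < ?a - (?b - ?a)" unfolding p(3)[symmetric] by (rule alpha_power_pos)
  have AB: "window \<omega> n (length (?A @ ?B)) = ?A @ ?B \<and>
      pos \<omega> (n + int (length (?A @ ?B))) = pos \<omega> n + (?b - ?a)" if h: "pos \<omega> n < ?a" for n
  proof -
    from Suc.IH(1)[OF h] have 1: "window \<omega> n (length ?A) = ?A"
      "pos \<omega> (n + int (length ?A)) = pos \<omega> n + ?b" by auto
    have "?a \<le> pos \<omega> (n + int (length ?A))" "pos \<omega> (n + int (length ?A)) < alpha ^ (2*i)"
      using h lt pos_bounds[of \<omega> n] unfolding 1 p by linarith+
    from Suc.IH(2)[OF this] 1 show ?thesis by (simp add: window_add algebra_simps)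
  qed
  { case 1
    then have "pos \<omega> n < ?a" using lt unfolding p by linarith
    from AB[OF this] show ?case unfolding w p by simp }
  { case 2
    have h: "pos \<omega> n < ?a" using 2(2) by simp
    have 1: "window \<omega> n (length (?A @ ?B)) = ?A @ ?B"
      "pos \<omega> (n + int (length (?A @ ?B))) = pos \<omega> n + (?b - ?a)" using AB[OF h] by auto
    have "?a \<le> pos \<omega> (n + int (length (?A @ ?B)))" "pos \<omega> (n + int (length (?A @ ?B))) < alpha ^ (2*i)"
      using 2(1) h lt lt2 pos_bounds[of \<omega> n] unfolding 1 p by linarith+
    from Suc.IH(2)[OF this] 1 show ?case unfolding w p
      by (simp only: length_append[of "?A @ ?B"] window_add) (simp add: algebra_simps) }
qed

lemma length_fibw_ge: "k \<le> length (fibw k)" and length_fibw_pos: "0 < length (fibw k)"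
proof (induction k rule: fibw.induct)
  case (3 n)
  then show "Suc (Suc n) \<le> length (fibw (Suc (Suc n)))" "0 < length (fibw (Suc (Suc n)))"
    by (auto simp flip: length_greater_0_conv)
qed auto

lemma fibw_rotation:
  "length (fibw (2*i)) * alpha = occn (fibw (2*i)) + alpha ^ (2*i+1) \<and>
   length (fibw (2*i+1)) * alpha = occn (fibw (2*i+1)) - alpha ^ (2*i+2)"
proof (induction i)
  case 0
  then show ?case using alpha_sq by (simp add: power2_eq_square)
next
  case (Suc i)
  then show ?case
    using alpha_power_Suc2[of "2*i"] alpha_power_Suc2[of "2*i+1"] alpha_power_Suc2[of "2*i+2"]
    by (simp add: algebra_simps)
qed

lemma return_forward: "\<exists>n'\<ge>n. pos \<omega> n' < alpha ^ (2*i)"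
proof (induction i)
  case 0
  then show ?case using pos_bounds[of \<omega> n] by auto
next
  case (Suc i)
  then obtain n' where n': "n' \<ge> n" "pos \<omega> n' < alpha ^ (2*i)" by blast
  let ?L = "int (length (fibw (2*i+1)))"
  let ?a = "alpha ^ (2*i+2)" and ?b = "alpha ^ (2*i+1)"
  have p: "alpha ^ (2*i) = ?a + ?b" using alpha_power_Suc2[of "2*i"] by simp
  \<comment> \<open>A position below \<open>?a + ?b\<close> is thus below \<open>3 * ?a\<close>, so
    at most two passages through the odd word bring it below \<open>?a\<close>.\<close>
  have lt: "?b < 2 * ?a" using alpha_power_Suc2[of "2*i+1"] alpha_power_Suc_less[of "2*i+2"] by simp
  have e: "2 * Suc i = 2 * i + 2" by simp
  show ?case
  proof (cases "pos \<omega> n' < ?a")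
    case False
    then have 1: "pos \<omega> (n' + ?L) = pos \<omega> n' - ?a" using itinerary(2)[of i \<omega> n'] n' by auto
    show ?thesis
    proof (cases "pos \<omega> (n' + ?L) < ?a")
      case False
      then have "pos \<omega> (n' + ?L + ?L) = pos \<omega> (n' + ?L) - ?a"
        using itinerary(2)[of i \<omega> "n' + ?L"] n' 1 alpha_power_pos[of "2*i+2"] by auto
      then have "pos \<omega> (n' + ?L + ?L) < ?a" using 1 n'(2) lt p by linarith
      then show ?thesis unfolding e using n'(1) by (intro exI[of _ "n' + ?L + ?L"]) auto
    qed (use n'(1) in \<open>intro exI[of _ "n' + ?L"], simp\<close>)
  qed (use n'(1) in auto)
qed

lemma alpha_power_small: "0 < \<epsilon> \<Longrightarrow> \<exists>i. alpha ^ i < \<epsilon>"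
  using real_arch_pow_inv[of \<epsilon> alpha] alpha_bounds by auto

lemma step_into_interval:
  fixes x y b :: real
  assumes "0 < b" "x \<le> y"
  shows "\<exists>j::nat. y \<le> x + j * b \<and> x + j * b < y + b"
proof -
  define j where "j = nat \<lceil>(y - x) / b\<rceil>"
  have "(y - x) / b \<ge> 0" using assms by simp
  then have "real j = of_int \<lceil>(y - x) / b\<rceil>" unfolding j_def by simp
  then have "(y - x) / b \<le> real j" "real j < (y - x) / b + 1" by linarith+
  then show ?thesis using assms(1) by (intro exI[of _ j]) (auto simp: field_simps)
qed

text \<open>Advancing by the length of an even word moves the orbit by
  \<open>alpha ^ (2 * i + 1)\<close> modulo 1. Steps shorter than \<open>\<epsilon>\<close> cannot
  jump over an interval of that length.\<close>

lemma rotation_dense: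
  fixes \<epsilon> :: real
  assumes "0 < \<epsilon>"
  shows "\<exists>n\<ge>N. \<exists>k::int. y \<le> of_int n * alpha + \<omega> + of_int k \<and> of_int n * alpha + \<omega> + of_int k < y + \<epsilon>"
proof -
  obtain i where i: "alpha ^ i < \<epsilon>" using alpha_power_small[OF assms] by blast
  let ?b = "alpha ^ (2*i+1)" and ?A = "fibw (2*i)"
  have "?b \<le> alpha ^ i" using alpha_bounds by (intro power_decreasing) auto
  then have b: "?b < \<epsilon>" using i by linarith
  define x where "x = of_int N * alpha + \<omega>"
  define k where "k = \<lfloor>y - x\<rfloor>"
  have "x + of_int k \<le> y" unfolding k_def by linarith
  then obtain j :: nat where j: "y \<le> x + of_int k + j * ?b" "x + of_int k + j * ?b < y + ?b"
    using step_into_interval[OF alpha_power_pos, of "x + of_int k" y] by blast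
  have l: "real (length ?A) * alpha = occn ?A + ?b" using fibw_rotation[of i] by blast
  have "of_int (N + int j * int (length ?A)) * alpha + \<omega> = x + j * (real (length ?A) * alpha)"
    by (simp add: x_def algebra_simps)
  also have "\<dots> = x + j * ?b + of_int (int j * int (occn ?A))"
    unfolding l by (simp add: algebra_simps)
  finally have e: "of_int (N + int j * int (length ?A)) * alpha + \<omega> + of_int (k - int j * int (occn ?A)) =
      x + of_int k + j * ?b" by simp
  show ?thesis
    by (rule exI[of _ "N + int j * int (length ?A)"], intro conjI exI[of _ "k - int j * int (occn ?A)"])
      (use e j b in auto)
qed

text \<open>Going back by the length of an odd word raises the position by \<open>?a\<close> modulo
  1. The first such step past 1 overshoots by less than \<open>?a\<close> and so lands near
  0.\<close>

lemma return_backward: "\<exists>n\<le>N. pos \<omega> n < alpha ^ (2*i)"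
proof -
  let ?a = "alpha ^ (2*i+2)" and ?B = "fibw (2*i+1)"
  obtain j :: nat where j: "1 \<le> pos \<omega> N + j * ?a" "pos \<omega> N + j * ?a < 1 + ?a"
    using step_into_interval[OF alpha_power_pos less_imp_le[OF pos_bounds(2)]] by blast
  have l: "real (length ?B) * alpha = occn ?B - ?a" using fibw_rotation[of i] by blast
  have "alpha ^ (2*i+2) < alpha ^ (2*i+1)" using alpha_power_Suc_less[of "2*i+1"] by simp
  moreover have "alpha ^ (2*i+1) < alpha ^ (2*i)" using alpha_power_Suc_less[of "2*i"] by simp
  moreover have "alpha ^ (2*i) \<le> 1" using alpha_bounds by (intro power_le_one) auto
  ultimately have a1: "?a \<le> alpha ^ (2*i)" "alpha ^ (2*i) \<le> 1" "?a < 1" by linarith+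
  have "of_int (N - int j * int (length ?B)) * alpha + \<omega> =
      (of_int N * alpha + \<omega>) - j * (real (length ?B) * alpha)"
    by (simp add: algebra_simps)
  also have "\<dots> = pos \<omega> N + j * ?a - 1 + of_int (\<lfloor>of_int N * alpha + \<omega>\<rfloor> + 1 - int j * int (occn ?B))"
    unfolding l using pos_eq[of N \<omega>] by (simp add: algebra_simps)
  finally have eq: "of_int (N - int j * int (length ?B)) * alpha + \<omega> = \<dots>" .
  have "pos \<omega> (N - int j * int (length ?B)) = pos \<omega> N + j * ?a - 1"
    by (rule pos_unique[OF _ _ eq]) (use j a1 in linarith)+
  then have "pos \<omega> (N - int j * int (length ?B)) < alpha ^ (2*i)" using j a1 by linarith
  moreover have "N - int j * int (length ?B) \<le> N" by simp
  ultimately show ?thesis by blast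
qed

text \<open>The occupied arc is closed on the left and open on the right, so a small increase of the
  phase changes no letter of a finite window, even if an orbit point sits at an end of the
  arc.\<close>

lemma occ_right_stable:
  "\<exists>\<epsilon>>0. \<forall>y n. \<bar>n\<bar> \<le> int L \<longrightarrow> \<omega> \<le> y \<longrightarrow> y < \<omega> + \<epsilon> \<longrightarrow> occ y n = occ \<omega> n"
proof -
  have one: "\<exists>\<epsilon>>0. \<forall>y. \<omega> \<le> y \<longrightarrow> y < \<omega> + \<epsilon> \<longrightarrow> occ y n = occ \<omega> n" for n
  proof -
    define d where "d = (if occ \<omega> n then 1 - pos \<omega> n else 1 - alpha - pos \<omega> n)"
    have o: "occ y n \<longleftrightarrow> 1 - alpha \<le> pos y n" for y by (simp add: occ_def pos_def)
    have d0: "0 < d" using pos_bounds[of \<omega> n] o[of \<omega>] by (auto simp: d_def)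
    have "occ y n = occ \<omega> n" if "\<omega> \<le> y" "y < \<omega> + d" for y
    proof -
      have "pos y n = pos \<omega> n + (y - \<omega>)"
        using that pos_bounds[of \<omega> n] alpha_bounds pos_eq[of n \<omega>]
        by (intro pos_unique[where k = "\<lfloor>of_int n * alpha + \<omega>\<rfloor>"]) (auto simp: d_def split: if_splits)
      then show ?thesis using that o[of y] o[of \<omega>] by (auto simp: d_def split: if_splits)
    qed
    then show ?thesis using d0 by blast
  qed
  show ?thesis
  proof (induction L)
    case 0
    then show ?case using one[of 0] by auto
  next
    case (Suc L)
    then obtain \<epsilon> where e: "\<epsilon> > 0"
      "\<And>y n. \<bar>n\<bar> \<le> int L \<Longrightarrow> \<omega> \<le> y \<Longrightarrow> y < \<omega> + \<epsilon> \<Longrightarrow> occ y n = occ \<omega> n" by blast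
    obtain \<epsilon>1 where e1: "\<epsilon>1 > 0" "\<And>y. \<omega> \<le> y \<Longrightarrow> y < \<omega> + \<epsilon>1 \<Longrightarrow> occ y (int (Suc L)) = occ \<omega> (int (Suc L))"
      using one[of "int (Suc L)"] by blast
    obtain \<epsilon>2 where e2: "\<epsilon>2 > 0" "\<And>y. \<omega> \<le> y \<Longrightarrow> y < \<omega> + \<epsilon>2 \<Longrightarrow> occ y (- int (Suc L)) = occ \<omega> (- int (Suc L))"
      using one[of "- int (Suc L)"] by blast
    have "occ y n = occ \<omega> n" if "\<bar>n\<bar> \<le> int (Suc L)" "\<omega> \<le> y" "y < \<omega> + min \<epsilon> (min \<epsilon>1 \<epsilon>2)" for y n
    proof -
      have "\<bar>n\<bar> \<le> int L \<or> n = int (Suc L) \<or> n = - int (Suc L)" using that(1) by linarith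
      then show ?thesis using that(2,3) e(2)[of n y] e1(2)[of y] e2(2)[of y] by auto
    qed
    moreover have "0 < min \<epsilon> (min \<epsilon>1 \<epsilon>2)" using e(1) e1(1) e2(1) by simp
    ultimately show ?case by blast
  qed
qed

lemma occ_translate: "occ (of_int s * alpha + \<omega> + of_int k) n = occ \<omega> (n + s)"
proof -
  have "of_int n * alpha + (of_int s * alpha + \<omega> + of_int k) = (of_int (n + s) * alpha + \<omega>) + of_int k"
    by (simp add: algebra_simps)
  then show ?thesis unfolding occ_def by (simp only: frac_add_of_int_right)
qed

text \<open>Every finite pattern of one phase occurs in every other phase. This carries estimates on
  finitely supported sequences from one phase to all.\<close>

lemma occ_recurrence: "\<exists>s. \<forall>n. \<bar>n\<bar> \<le> int L \<longrightarrow> occ \<omega> (n + s) = occ \<omega>' n"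
proof -
  obtain \<epsilon> where e: "\<epsilon> > 0" "\<And>y n. \<bar>n\<bar> \<le> int L \<Longrightarrow> \<omega>' \<le> y \<Longrightarrow> y < \<omega>' + \<epsilon> \<Longrightarrow> occ y n = occ \<omega>' n"
    using occ_right_stable[of L \<omega>'] by blast
  obtain s k where "\<omega>' \<le> of_int s * alpha + \<omega> + of_int k" "of_int s * alpha + \<omega> + of_int k < \<omega>' + \<epsilon>"
    using rotation_dense[OF e(1), of 0 \<omega>' \<omega>] by blast
  with e(2) have "\<forall>n. \<bar>n\<bar> \<le> int L \<longrightarrow> occ (of_int s * alpha + \<omega> + of_int k) n = occ \<omega>' n" by blast
  then show ?thesis unfolding occ_translate by blast
qed

section \<open>The trace map\<close>

abbreviation fmat :: "int \<Rightarrow> int \<Rightarrow> real \<Rightarrow> real \<Rightarrow> nat \<Rightarrow> mat2" where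
  "fmat m l V E k \<equiv> cmat m l V E (fibw k)"

abbreviation flift :: "int \<Rightarrow> int \<Rightarrow> real \<Rightarrow> real \<Rightarrow> nat \<Rightarrow> real \<Rightarrow> real" where
  "flift m l V E k \<equiv> clift m l V E (fibw k)"

lemma fmat_rec:
  "fmat m l V E (Suc (Suc k)) =
    (if even k then mmul (fmat m l V E (Suc k)) (fmat m l V E k)
     else mmul (fmat m l V E k) (fmat m l V E (Suc k)))"
  by (simp add: cmat_append)

lemma flift_rec:
  "flift m l V E (Suc (Suc k)) \<phi> =
    (if even k then flift m l V E (Suc k) (flift m l V E k \<phi>)
     else flift m l V E k (flift m l V E (Suc k) \<phi>))"
  by (simp add: clift_append)

lemma mtr_square_mul:
  assumes "mdet B = 1"
  shows "mtr (mmul B (mmul B A)) = mtr B * mtr (mmul B A) - mtr A"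
proof -
  obtain a b c d where B: "B = (a, b, c, d)" by (cases B)
  obtain p q r s where A: "A = (p, q, r, s)" by (cases A)
  have d: "a * d = 1 + b * c" using assms B by simp
  have "mtr B * mtr (mmul B A) - mtr A - mtr (mmul B (mmul B A)) = (a * d - b * c - 1) * (p + s)"
    unfolding A B by (simp add: algebra_simps)
  then show ?thesis using d by simp
qed

text \<open>Up to cyclic rotation, \<open>fibw (k + 3)\<close> is \<open>fibw k\<close> followed by
  two copies of \<open>fibw (k + 1)\<close>, whichever order the recursion takes. The trace ignores
  cyclic rotation, and \<open>mtr_square_mul\<close> reduces the square.\<close>

lemma trace_rec:
  "mtr (fmat m l V E (k + 3)) =
    mtr (fmat m l V E (k + 2)) * mtr (fmat m l V E (k + 1)) - mtr (fmat m l V E k)"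
proof -
  let ?A = "fmat m l V E k" and ?B = "fmat m l V E (k + 1)"
  have 2: "mtr (fmat m l V E (k + 2)) = mtr (mmul ?B ?A)"
    using fmat_rec[of m l V E k] mtr_mmul_commute[of ?A ?B] by (simp split: if_splits)
  have k: "k + 3 = Suc (Suc (Suc k))" "k + 1 = Suc k" by simp_all
  have 3: "mtr (fmat m l V E (k + 3)) = mtr (mmul ?B (mmul ?B ?A))"
  proof (cases "even k")
    case True
    then show ?thesis
      using fmat_rec[of m l V E k] fmat_rec[of m l V E "Suc k"] unfolding k by (simp del: fibw.simps)
  next
    case False
    then have "fmat m l V E (k + 3) = mmul (mmul ?A ?B) ?B"
      using fmat_rec[of m l V E k] fmat_rec[of m l V E "Suc k"] unfolding k by (simp del: fibw.simps)
    then show ?thesis by (metis mmul_assoc mtr_mmul_commute)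
  qed
  show ?thesis using mtr_square_mul[of ?B ?A] 2 3 by (simp add: mult.commute)
qed

text \<open>The signs of the labels multiply to 1 over three consecutive words, because the third
  label is the sum of the other two. The value is therefore independent of \<open>m\<close> and
  \<open>l\<close>, and it is read off from the traces \<open>E\<close>, \<open>E - V\<close> and
  \<open>E * (E - V) - 2\<close>.\<close>

lemma fricke:
  defines "t \<equiv> \<lambda>m l V E k. mtr (fmat m l V E k)"
  shows "(t m l V E k)\<^sup>2 + (t m l V E (k+1))\<^sup>2 + (t m l V E (k+2))\<^sup>2 -
    t m l V E k * t m l V E (k+1) * t m l V E (k+2) = 4 + V\<^sup>2"
proof (induction k)
  case 0
  have e: "t m l V E (Suc (Suc 0)) = (if even m then 1 else -1) * (E * (E - V) - 2)"
    "t m l V E (Suc 0) = (if even (m + l) then 1 else -1) * (E - V)"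
    "t m l V E 0 = (if even l then 1 else -1) * E"
    unfolding t_def cmat_def mtr_msgn by (auto simp: wlab_def step_mat_def)
  have i: "0 + 1 = Suc 0" "0 + 2 = Suc (Suc 0)" by simp_all
  show ?case unfolding i e
    by (cases "even m"; cases "even l") (simp_all add: power2_eq_square algebra_simps)
next
  case (Suc k)
  have t3: "t m l V E (k + 3) = t m l V E (k + 2) * t m l V E (k + 1) - t m l V E k"
    unfolding t_def by (rule trace_rec)
  have i: "Suc k = k + 1" "k + 1 + 1 = k + 2" "k + 1 + 2 = k + 3" by simp_all
  have h: "x\<^sup>2 + y\<^sup>2 + (y * x - z)\<^sup>2 - x * y * (y * x - z) = z\<^sup>2 + x\<^sup>2 + y\<^sup>2 - z * x * y" for x y z :: real
    by (simp add: power2_eq_square algebra_simps)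
  show ?case unfolding i t3 h by (rule Suc)
qed

section \<open>Square-summable sequences and Jacobi recursions\<close>

lemma ell2_norm_sq: "(ell2_norm \<psi>)\<^sup>2 = (\<Sum>\<^sub>\<infinity>n\<in>UNIV. (cmod (\<psi> n))\<^sup>2)"
  by (simp add: ell2_norm_def infsum_nonneg)

lemma ell2_norm_nonneg: "0 \<le> ell2_norm \<psi>"
  by (simp add: ell2_norm_def infsum_nonneg)

lemma ell2_sum_le:
  assumes "\<psi> \<in> ell2" "finite F"
  shows "(\<Sum>n\<in>F. (cmod (\<psi> n))\<^sup>2) \<le> (ell2_norm \<psi>)\<^sup>2"
  unfolding ell2_norm_sq
  by (rule finite_sum_le_infsum) (use assms in \<open>auto simp: ell2_def\<close>)

lemma finite_int_subset_interval:
  fixes F :: "int set"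
  assumes "finite F" shows "\<exists>N. F \<subseteq> {- int N..int N}"
proof (cases "F = {}")
  case False
  define N where "N = nat (Max (abs ` F))"
  have "\<bar>n\<bar> \<le> int N" if "n \<in> F" for n
  proof -
    have "\<bar>n\<bar> \<le> Max (abs ` F)" using that assms by (intro Max_ge) auto
    then show ?thesis unfolding N_def by linarith
  qed
  then have "F \<subseteq> {- int N..int N}" by (force simp: abs_le_iff)
  then show ?thesis by blast
qed auto

lemma ell2I_bound:
  assumes "\<And>N. (\<Sum>n\<in>{- int N..int N}. (cmod (\<psi> n))\<^sup>2) \<le> C"
  shows "\<psi> \<in> ell2" "(ell2_norm \<psi>)\<^sup>2 \<le> C"
proof -
  have le: "(\<Sum>n\<in>F. (cmod (\<psi> n))\<^sup>2) \<le> C" if F: "finite F" for F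
  proof -
    obtain N where N: "F \<subseteq> {- int N..int N}" using finite_int_subset_interval[OF F] by blast
    have "(\<Sum>n\<in>F. (cmod (\<psi> n))\<^sup>2) \<le> (\<Sum>n\<in>{- int N..int N}. (cmod (\<psi> n))\<^sup>2)"
      by (rule sum_mono2) (use N in auto)
    then show ?thesis using assms[of N] by linarith
  qed
  have s: "(\<lambda>n. (cmod (\<psi> n))\<^sup>2) summable_on UNIV"
    by (rule nonneg_bdd_above_summable_on) (auto intro!: bdd_aboveI[of _ C] le)
  then show "\<psi> \<in> ell2" by (simp add: ell2_def)
  show "(ell2_norm \<psi>)\<^sup>2 \<le> C"
    unfolding ell2_norm_sq by (rule infsum_le_finite_sums[OF s]) (use le in auto)
qed

lemma ell2_finite_support:
  assumes "\<And>n. n \<notin> {a..b} \<Longrightarrow> \<psi> n = 0"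
  shows "\<psi> \<in> ell2" "(ell2_norm \<psi>)\<^sup>2 = (\<Sum>n\<in>{a..b}. (cmod (\<psi> n))\<^sup>2)"
proof -
  have "(\<lambda>n. (cmod (\<psi> n))\<^sup>2) summable_on UNIV \<longleftrightarrow> (\<lambda>n. (cmod (\<psi> n))\<^sup>2) summable_on {a..b}"
    by (rule summable_on_cong_neutral) (use assms in auto)
  then show "\<psi> \<in> ell2" by (simp add: ell2_def)
  have "(\<Sum>\<^sub>\<infinity>n\<in>UNIV. (cmod (\<psi> n))\<^sup>2) = (\<Sum>\<^sub>\<infinity>n\<in>{a..b}. (cmod (\<psi> n))\<^sup>2)"
    by (rule infsum_cong_neutral) (use assms in auto)
  then show "(ell2_norm \<psi>)\<^sup>2 = (\<Sum>n\<in>{a..b}. (cmod (\<psi> n))\<^sup>2)" by (simp add: ell2_norm_sq)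
qed

lemma ell2_lincomb:
  assumes "\<phi> \<in> ell2" "\<psi> \<in> ell2"
  shows "(\<lambda>n. c * \<phi> n + \<psi> n) \<in> ell2"
proof (rule ell2I_bound)
  fix N
  have "(cmod (c * \<phi> n + \<psi> n))\<^sup>2 \<le> 2 * ((cmod c)\<^sup>2 * (cmod (\<phi> n))\<^sup>2 + (cmod (\<psi> n))\<^sup>2)" for n
  proof -
    have "(cmod (c * \<phi> n + \<psi> n))\<^sup>2 \<le> (cmod (c * \<phi> n) + cmod (\<psi> n))\<^sup>2"
      by (intro power_mono norm_triangle_ineq) auto
    also have "\<dots> \<le> 2 * ((cmod (c * \<phi> n))\<^sup>2 + (cmod (\<psi> n))\<^sup>2)"
      using sum_squares_bound[of "cmod (c * \<phi> n)" "cmod (\<psi> n)"] by (simp add: power2_sum)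
    finally show ?thesis by (simp add: norm_mult power_mult_distrib)
  qed
  then have "(\<Sum>n\<in>{- int N..int N}. (cmod (c * \<phi> n + \<psi> n))\<^sup>2) \<le>
      (\<Sum>n\<in>{- int N..int N}. 2 * ((cmod c)\<^sup>2 * (cmod (\<phi> n))\<^sup>2 + (cmod (\<psi> n))\<^sup>2))"
    by (rule sum_mono)
  also have "\<dots> = 2 * ((cmod c)\<^sup>2 * (\<Sum>n\<in>{- int N..int N}. (cmod (\<phi> n))\<^sup>2) +
      (\<Sum>n\<in>{- int N..int N}. (cmod (\<psi> n))\<^sup>2))"
    by (simp add: sum.distrib sum_distrib_left)
  also have "\<dots> \<le> 2 * ((cmod c)\<^sup>2 * (ell2_norm \<phi>)\<^sup>2 + (ell2_norm \<psi>)\<^sup>2)"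
    using ell2_sum_le[OF assms(1)] ell2_sum_le[OF assms(2)] by (intro mult_left_mono add_mono) auto
  finally show "(\<Sum>n\<in>{- int N..int N}. (cmod (c * \<phi> n + \<psi> n))\<^sup>2) \<le>
    2 * ((cmod c)\<^sup>2 * (ell2_norm \<phi>)\<^sup>2 + (ell2_norm \<psi>)\<^sup>2)" .
qed

lemma ell2_small:
  assumes "\<psi> \<in> ell2" "0 < \<epsilon>"
  shows "\<exists>N. \<forall>n. int N < \<bar>n\<bar> \<longrightarrow> (cmod (\<psi> n))\<^sup>2 < \<epsilon>"
proof -
  define F where "F = {n. \<epsilon> \<le> (cmod (\<psi> n))\<^sup>2}"
  have "finite F"
  proof (rule ccontr)
    assume "infinite F"
    obtain k :: nat where k: "(ell2_norm \<psi>)\<^sup>2 / \<epsilon> < k" using reals_Archimedean2 by blast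
    obtain B where B: "finite B" "card B = k" "B \<subseteq> F"
      using infinite_arbitrarily_large[OF \<open>infinite F\<close>] by blast
    have "k * \<epsilon> = (\<Sum>n\<in>B. \<epsilon>)" using B by simp
    also have "\<dots> \<le> (\<Sum>n\<in>B. (cmod (\<psi> n))\<^sup>2)" by (rule sum_mono) (use B in \<open>auto simp: F_def\<close>)
    also have "\<dots> \<le> (ell2_norm \<psi>)\<^sup>2" by (rule ell2_sum_le[OF assms(1) B(1)])
    finally show False using k assms(2) by (simp add: field_simps)
  qed
  then obtain N where "F \<subseteq> {- int N..int N}" using finite_int_subset_interval by blast
  moreover have "n \<notin> {- int N..int N}" if "int N < \<bar>n\<bar>" for n using that by auto
  ultimately have "\<forall>n. int N < \<bar>n\<bar> \<longrightarrow> n \<notin> F" by blast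
  then show ?thesis unfolding F_def by (auto simp: not_le)
qed

section \<open>Jacobi recursions, their solutions and Green's identity\<close>

definition jac :: "(int \<Rightarrow> complex) \<Rightarrow> (int \<Rightarrow> complex) \<Rightarrow> int \<Rightarrow> complex" where
  "jac q \<psi> n = \<psi> (n + 1) + \<psi> (n - 1) + q n * \<psi> n"

text \<open>The recursion is symmetric under reflection, so the same function serves both half-lines
  in \<open>jac_solution\<close>.\<close>

fun jacrec :: "complex \<Rightarrow> complex \<Rightarrow> (nat \<Rightarrow> complex) \<Rightarrow> (nat \<Rightarrow> complex) \<Rightarrow> nat \<Rightarrow> complex" where
  "jacrec a b q g 0 = a"
| "jacrec a b q g (Suc 0) = b"
| "jacrec a b q g (Suc (Suc k)) = g (Suc k) - q (Suc k) * jacrec a b q g (Suc k) - jacrec a b q g k"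

lemma jac_solution: "\<exists>\<psi>. \<psi> s = a \<and> \<psi> (s + 1) = b \<and> (\<forall>n. jac q \<psi> n = g n)"
proof -
  define f where "f = jacrec a b (\<lambda>k. q (s + int k)) (\<lambda>k. g (s + int k))"
  define h where "h = jacrec a (g s - q s * a - b) (\<lambda>k. q (s - int k)) (\<lambda>k. g (s - int k))"
  define \<psi> where "\<psi> n = (if s \<le> n then f (nat (n - s)) else h (nat (s - n)))" for n
  have "jac q \<psi> n = g n" for n
  proof -
    consider "n = s" | k where "n = s + int (Suc k)" | k where "n = s - int (Suc k)"
    proof -
      have "n = s \<or> n = s + int (Suc (nat (n - s - 1))) \<or> n = s - int (Suc (nat (s - n - 1)))" by linarith
      then show ?thesis using that by blast
    qed
    then show ?thesis
    proof cases
      case 1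
      then show ?thesis by (simp add: jac_def \<psi>_def f_def h_def)
    next
      case (2 k)
      have "nat (n + 1 - s) = Suc (Suc k)" "nat (n - s) = Suc k" "nat (n - 1 - s) = k" using 2 by auto
      then show ?thesis using 2 by (simp add: jac_def \<psi>_def f_def)
    next
      case (3 k)
      have n: "nat (s - (n - 1)) = Suc (Suc k)" "nat (s - n) = Suc k" "nat (s - (n + 1)) = k" using 3 by auto
      have "\<psi> (n + 1) = h k" using 3 n(3) by (cases k) (auto simp: \<psi>_def h_def f_def)
      moreover have "\<psi> n = h (Suc k)" "\<psi> (n - 1) = h (Suc (Suc k))" using 3 n by (auto simp: \<psi>_def)
      ultimately show ?thesis using 3 by (simp add: jac_def h_def)
    qed
  qed
  moreover have "\<psi> s = a" "\<psi> (s + 1) = b" by (simp_all add: \<psi>_def f_def)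
  ultimately show ?thesis by blast
qed

lemma jac_zero_forward:
  assumes "\<And>n. s \<le> n \<Longrightarrow> jac q \<psi> (n + 1) = 0" "\<psi> s = 0" "\<psi> (s + 1) = 0" "s \<le> n"
  shows "\<psi> n = 0"
proof -
  have "\<psi> (s + int k) = 0 \<and> \<psi> (s + int k + 1) = 0" for k
  proof (induction k)
    case (Suc k)
    have "jac q \<psi> (s + int k + 1) = 0" by (rule assms(1)) simp
    then show ?case using Suc by (simp add: jac_def algebra_simps)
  qed (use assms in simp)
  from this[of "nat (n - s)"] assms(4) show ?thesis by simp
qed

lemma jac_zero_backward:
  assumes "\<And>n. n \<le> s \<Longrightarrow> jac q \<psi> n = 0" "\<psi> s = 0" "\<psi> (s + 1) = 0" "n \<le> s"
  shows "\<psi> n = 0"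
proof -
  have "\<psi> (s - int k) = 0 \<and> \<psi> (s - int k + 1) = 0" for k
  proof (induction k)
    case (Suc k)
    have "jac q \<psi> (s - int k) = 0" by (rule assms(1)) simp
    then show ?case using Suc by (simp add: jac_def algebra_simps)
  qed (use assms in simp)
  from this[of "nat (s - n)"] assms(4) show ?thesis by simp
qed

lemma jac_unique:
  assumes "\<And>n. jac q \<phi> n = jac q \<psi> n" "\<phi> s = \<psi> s" "\<phi> (s + 1) = \<psi> (s + 1)"
  shows "\<phi> n = \<psi> n"
proof -
  have "jac q (\<lambda>n. \<phi> n - \<psi> n) n = 0" for n using assms(1)[of n] by (simp add: jac_def algebra_simps)
  then have "(\<lambda>n. \<phi> n - \<psi> n) n = 0" for n
    using jac_zero_forward[of s q "\<lambda>n. \<phi> n - \<psi> n" n] jac_zero_backward[of s q "\<lambda>n. \<phi> n - \<psi> n" n] assms(2,3)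
    by (cases "s \<le> n") auto
  then show ?thesis by simp
qed

lemma jac_lincomb: "jac q (\<lambda>n. c * \<phi> n + \<psi> n) n = c * jac q \<phi> n + jac q \<psi> n"
  by (simp add: jac_def algebra_simps)

lemma int_interval_Suc: "a \<le> b + 1 \<Longrightarrow> {a..b + 1} = insert (b + 1) {a..b::int}" by auto

text \<open>The summand is a telescoping difference of Wronskians; the potential cancels because the
  pairing is bilinear and not sesquilinear, so \<open>q\<close> may be complex.\<close>

lemma jac_green:
  fixes a :: int
  shows "(\<Sum>n\<in>{a..a + int k}. h n * jac q \<zeta> n - \<zeta> n * jac q h n) =
    (h (a + int k) * \<zeta> (a + int k + 1) - h (a + int k + 1) * \<zeta> (a + int k)) - (h (a - 1) * \<zeta> a - h a * \<zeta> (a - 1))"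
proof (induction k)
  case 0
  show ?case by (simp add: jac_def algebra_simps)
next
  case (Suc k)
  have "{a..a + int (Suc k)} = insert (a + int k + 1) {a..a + int k}"
    using int_interval_Suc[of a "a + int k"] by (simp add: algebra_simps)
  then show ?case using Suc by (simp add: jac_def algebra_simps)
qed

lemma sum_shift_int: "(\<Sum>n\<in>{a..b::int}. f (n + s)) = (\<Sum>n\<in>{a + s..b + s}. f n)"
  by (rule sum.reindex_bij_witness[of _ "\<lambda>n. n - s" "\<lambda>n. n + s"]) auto

section \<open>The resolvent set of a Fibonacci Hamiltonian\<close>

abbreviation fq :: "real \<Rightarrow> real \<Rightarrow> complex \<Rightarrow> int \<Rightarrow> complex" where
  "fq V \<omega> z \<equiv> \<lambda>n. of_real (fib_potential V \<omega> n) - z"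

lemma fib_hamiltonian_jac: "fib_hamiltonian V \<omega> \<psi> n - z * \<psi> n = jac (fq V \<omega> z) \<psi> n"
  by (simp add: fib_hamiltonian_def jac_def algebra_simps)

text \<open>\<open>H - z\<close> is bounded below on finitely supported sequences. Restricting to
  finite boxes makes the condition transferable between phases; the box on the right is larger by
  one site at each end because the operator spreads supports that far.\<close>

definition bbelow :: "real \<Rightarrow> real \<Rightarrow> complex \<Rightarrow> real \<Rightarrow> bool" where
  "bbelow V \<omega> z c \<longleftrightarrow> (\<forall>a b \<psi>. (\<forall>n. n \<notin> {a..b} \<longrightarrow> \<psi> n = 0) \<longrightarrow>
     c * (\<Sum>n\<in>{a..b}. (cmod (\<psi> n))\<^sup>2) \<le> (\<Sum>n\<in>{a-1..b+1}. (cmod (jac (fq V \<omega> z) \<psi> n))\<^sup>2))"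

lemma bbelowD:
  assumes "bbelow V \<omega> z c" "\<And>n. n \<notin> {a..b} \<Longrightarrow> \<psi> n = 0"
  shows "c * (\<Sum>n\<in>{a..b}. (cmod (\<psi> n))\<^sup>2) \<le> (\<Sum>n\<in>{a-1..b+1}. (cmod (jac (fq V \<omega> z) \<psi> n))\<^sup>2)"
  using assms unfolding bbelow_def by blast

text \<open>A sequence supported in a box sees the potential there only, so it can be translated to
  a place where the other phase shows the same pattern.\<close>

lemma bbelow_transfer:
  assumes "bbelow V \<omega> z c" shows "bbelow V \<omega>' z c"
  unfolding bbelow_def
proof (intro allI impI)
  fix a b :: int and \<psi> :: "int \<Rightarrow> complex" assume \<psi>: "\<forall>n. n \<notin> {a..b} \<longrightarrow> \<psi> n = 0"
  define L where "L = nat (max \<bar>a\<bar> \<bar>b\<bar>)"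
  obtain s where s: "\<And>n. \<bar>n\<bar> \<le> int L \<Longrightarrow> occ \<omega> (n + s) = occ \<omega>' n"
    using occ_recurrence[of L \<omega> \<omega>'] by blast
  define \<phi> where "\<phi> n = \<psi> (n - s)" for n
  have j: "jac (fq V \<omega> z) \<phi> (n + s) = jac (fq V \<omega>' z) \<psi> n" for n
  proof (cases "n \<in> {a..b}")
    case True
    then have "\<bar>n\<bar> \<le> int L" unfolding L_def by auto
    then have "fq V \<omega> z (n + s) = fq V \<omega>' z n" using s by (simp add: fib_potential_occ)
    then show ?thesis by (simp add: jac_def \<phi>_def algebra_simps)
  qed (use \<psi> in \<open>auto simp: jac_def \<phi>_def algebra_simps\<close>)
  have "\<forall>n. n \<notin> {a+s..b+s} \<longrightarrow> \<phi> n = 0" using \<psi> by (auto simp: \<phi>_def)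
  then have "c * (\<Sum>n\<in>{a+s..b+s}. (cmod (\<phi> n))\<^sup>2) \<le>
      (\<Sum>n\<in>{a+s-1..b+s+1}. (cmod (jac (fq V \<omega> z) \<phi> n))\<^sup>2)"
    using assms unfolding bbelow_def by blast
  moreover have "(\<Sum>n\<in>{a+s..b+s}. (cmod (\<phi> n))\<^sup>2) = (\<Sum>n\<in>{a..b}. (cmod (\<psi> n))\<^sup>2)"
    unfolding sum_shift_int[symmetric] by (simp add: \<phi>_def)
  moreover have "(\<Sum>n\<in>{a+s-1..b+s+1}. (cmod (jac (fq V \<omega> z) \<phi> n))\<^sup>2) =
      (\<Sum>n\<in>{a-1..b+1}. (cmod (jac (fq V \<omega>' z) \<psi> n))\<^sup>2)"
    using sum_shift_int[of "\<lambda>n. (cmod (jac (fq V \<omega> z) \<phi> n))\<^sup>2" s "a-1" "b+1"]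
    by (simp add: j algebra_simps)
  ultimately show "c * (\<Sum>n\<in>{a..b}. (cmod (\<psi> n))\<^sup>2) \<le> (\<Sum>n\<in>{a-1..b+1}. (cmod (jac (fq V \<omega>' z) \<psi> n))\<^sup>2)"
    by simp
qed

lemma bbelow_of_resolvent:
  assumes "z \<in> resolvent_set (fib_hamiltonian V \<omega>)"
  shows "\<exists>c>0. bbelow V \<omega> z c"
proof -
  obtain S where S: "bounded_operator S"
    "\<And>\<psi>. \<psi> \<in> ell2 \<Longrightarrow> S (\<lambda>n. fib_hamiltonian V \<omega> \<psi> n - z * \<psi> n) = \<psi>"
    using assms unfolding resolvent_set_def by blast
  obtain C where C: "\<And>\<psi>. \<psi> \<in> ell2 \<Longrightarrow> ell2_norm (S \<psi>) \<le> C * ell2_norm \<psi>"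
    using S(1) unfolding bounded_operator_def by blast
  \<comment> \<open>Adding 1 keeps the constant positive when \<open>C\<close> is 0.\<close>
  have "bbelow V \<omega> z (1 / (C\<^sup>2 + 1))"
    unfolding bbelow_def
  proof (intro allI impI)
    fix a b :: int and \<psi> :: "int \<Rightarrow> complex" assume \<psi>: "\<forall>n. n \<notin> {a..b} \<longrightarrow> \<psi> n = 0"
    let ?g = "\<lambda>n. jac (fq V \<omega> z) \<psi> n"
    have g: "?g n = 0" if "n \<notin> {a-1..b+1}" for n using that \<psi> by (auto simp: jac_def)
    have "ell2_norm \<psi> \<le> C * ell2_norm ?g"
      using C[OF ell2_finite_support(1)[of "a-1" "b+1" ?g, OF g]] S(2)[OF ell2_finite_support(1)[of a b \<psi>]] \<psi>
      by (simp add: fib_hamiltonian_jac)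
    then have "(ell2_norm \<psi>)\<^sup>2 \<le> (C * ell2_norm ?g)\<^sup>2"
      by (intro power_mono) (auto simp: ell2_norm_nonneg)
    also have "\<dots> \<le> (C\<^sup>2 + 1) * (ell2_norm ?g)\<^sup>2" by (simp add: power_mult_distrib algebra_simps)
    finally show "1 / (C\<^sup>2 + 1) * (\<Sum>n\<in>{a..b}. (cmod (\<psi> n))\<^sup>2) \<le> (\<Sum>n\<in>{a-1..b+1}. (cmod (?g n))\<^sup>2)"
      using ell2_finite_support(2)[of "a-1" "b+1" ?g, OF g] ell2_finite_support(2)[of a b \<psi>] \<psi>
      by (simp add: divide_le_eq mult.commute add_pos_nonneg pos_divide_le_eq sum_power2_gt_zero_iff add_nonneg_pos)
  qed
  moreover have "0 < 1 / (C\<^sup>2 + 1)" by (simp add: add_nonneg_pos)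
  ultimately show ?thesis by blast
qed

text \<open>A square-summable solution, cut off at a large box, is an almost solution: applying the
  operator leaves terms only at the edges, and these are small. This contradicts the lower bound
  unless the solution vanishes.\<close>

lemma jac_injective:
  assumes bb: "bbelow V \<omega> z c" "0 < c" and \<psi>: "\<psi> \<in> ell2" "\<And>n. jac (fq V \<omega> z) \<psi> n = 0"
  shows "\<psi> n = 0"
proof (rule ccontr)
  assume "\<psi> n \<noteq> 0"
  then have pos: "0 < c * (cmod (\<psi> n))\<^sup>2" using bb(2) by simp
  \<comment> \<open>A quarter, because four boundary values of \<open>\<psi>\<close> survive the
    cut-off.\<close>
  obtain N0 where N0: "\<And>k. int N0 < \<bar>k\<bar> \<Longrightarrow> (cmod (\<psi> k))\<^sup>2 < c * (cmod (\<psi> n))\<^sup>2 / 4"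
    using ell2_small[OF \<psi>(1), of "c * (cmod (\<psi> n))\<^sup>2 / 4"] pos by auto
  define N where "N = max (int N0 + 1) (\<bar>n\<bar> + 1)"
  have N: "int N0 < N" "\<bar>n\<bar> < N" "0 < N" unfolding N_def by auto
  define \<phi> where "\<phi> k = (if k \<in> {-N..N} then \<psi> k else 0)" for k
  have "c * (\<Sum>k\<in>{-N..N}. (cmod (\<phi> k))\<^sup>2) \<le> (\<Sum>k\<in>{-N-1..N+1}. (cmod (jac (fq V \<omega> z) \<phi> k))\<^sup>2)"
    by (rule bbelowD[OF bb(1)]) (auto simp: \<phi>_def)
  also have "\<dots> = (\<Sum>k\<in>{-N-1, -N, N, N+1}. (cmod (jac (fq V \<omega> z) \<phi> k))\<^sup>2)"
  proof (rule sum.mono_neutral_right)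
    show "\<forall>i\<in>{-N-1..N+1} - {-N-1, -N, N, N+1}. (cmod (jac (fq V \<omega> z) \<phi> i))\<^sup>2 = 0"
    proof
      fix i assume i: "i \<in> {-N-1..N+1} - {-N-1, -N, N, N+1}"
      then have "jac (fq V \<omega> z) \<phi> i = jac (fq V \<omega> z) \<psi> i" by (auto simp: jac_def \<phi>_def)
      then show "(cmod (jac (fq V \<omega> z) \<phi> i))\<^sup>2 = 0" using \<psi>(2) by simp
    qed
  qed (use N in auto)
  also have "\<dots> = (cmod (\<psi> (-N)))\<^sup>2 + (cmod (\<psi> (-N-1)))\<^sup>2 + (cmod (\<psi> (N+1)))\<^sup>2 + (cmod (\<psi> N))\<^sup>2"
  proof -
    have "jac (fq V \<omega> z) \<phi> (-N-1) = \<psi> (-N)" "jac (fq V \<omega> z) \<phi> (N+1) = \<psi> N"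
      using N by (auto simp: jac_def \<phi>_def)
    moreover have "jac (fq V \<omega> z) \<phi> (-N) = - \<psi> (-N-1)" "jac (fq V \<omega> z) \<phi> N = - \<psi> (N+1)"
      using N \<psi>(2)[of "-N"] \<psi>(2)[of N] by (auto simp: jac_def \<phi>_def algebra_simps add_eq_0_iff)
    ultimately show ?thesis using N by simp
  qed
  also have "\<dots> < c * (cmod (\<psi> n))\<^sup>2"
    using N0[of "-N"] N0[of "-N-1"] N0[of "N+1"] N0[of N] N by auto
  also have "\<dots> = c * (cmod (\<phi> n))\<^sup>2" using N by (auto simp: \<phi>_def)
  also have "\<dots> \<le> c * (\<Sum>k\<in>{-N..N}. (cmod (\<phi> k))\<^sup>2)"
    using N bb(2) by (intro mult_left_mono member_le_sum) auto
  finally show False by simp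
qed


text \<open>The solution of minimal norm on a box is orthogonal to the homogeneous solutions, hence of the
  form \<open>cnj ((H - z) \<zeta>)\<close> with \<open>\<zeta>\<close> supported in the box; this gives the bound on its norm.\<close>

lemma jac_box_solution:
  fixes N :: nat
  assumes bb: "bbelow V \<omega> z c" "0 < c" and N: "1 \<le> N"
  shows "\<exists>\<psi>. (\<forall>n. jac (fq V \<omega> z) \<psi> n = g n) \<and>
    c * (\<Sum>n\<in>{- int N..int N}. (cmod (\<psi> n))\<^sup>2) \<le> (\<Sum>n\<in>{- int N..int N}. (cmod (g n))\<^sup>2)"
proof -
  let ?q = "fq V \<omega> z" and ?B = "{- int N..int N}"
  define ip where "ip f h = (\<Sum>n\<in>?B. cnj (f n) * h n)" for f h :: "int \<Rightarrow> complex"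
  have ip_right: "ip f (\<lambda>n. a n - t * b n) = ip f a - t * ip f b" for f a b t
    by (simp add: ip_def right_diff_distrib sum_subtractf sum_distrib_left mult.left_commute)
  have ip_left: "ip (\<lambda>n. a n + t * b n) h = ip a h + cnj t * ip b h" for a b h t
    by (simp add: ip_def distrib_right sum.distrib sum_distrib_left mult.assoc)
  have ip_self: "ip f f = of_real (\<Sum>n\<in>?B. (cmod (f n))\<^sup>2)" for f
    unfolding ip_def of_real_sum complex_norm_square by (rule sum.cong) (auto simp: mult.commute)
  have ip_ne: "ip f f \<noteq> 0" if "k \<in> ?B" "f k \<noteq> 0" for f k
  proof -
    have "0 < (cmod (f k))\<^sup>2" using that by simp
    also have "\<dots> \<le> (\<Sum>n\<in>?B. (cmod (f n))\<^sup>2)" using that by (intro member_le_sum) auto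
    finally show ?thesis unfolding ip_self by (metis less_irrefl of_real_eq_0_iff)
  qed
  have jac_diff: "jac ?q (\<lambda>n. a n - t * b n) n = jac ?q a n - t * jac ?q b n" for a b t n
    by (simp add: jac_def algebra_simps)
  obtain p where p: "\<And>n. jac ?q p n = g n" using jac_solution[of 0 0 0 ?q g] by auto
  obtain u where u: "u 0 = 1" "u 1 = 0" "\<And>n. jac ?q u n = 0"
    using jac_solution[of 0 1 0 ?q "\<lambda>_. 0"] by auto
  obtain v where v: "v 0 = 0" "v 1 = 1" "\<And>n. jac ?q v n = 0"
    using jac_solution[of 0 0 1 ?q "\<lambda>_. 0"] by auto
  have uu: "ip u u \<noteq> 0" by (rule ip_ne[of 0]) (use u in auto)
  define al where "al = ip u v / ip u u"
  define v' where "v' n = v n - al * u n" for n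
  have uv': "ip u v' = 0" unfolding v'_def[abs_def] ip_right al_def using uu by simp
  have vv': "ip v' v' \<noteq> 0" by (rule ip_ne[of 1]) (use u v N in \<open>auto simp: v'_def\<close>)
  define p1 where "p1 n = p n - (ip u p / ip u u) * u n" for n
  have up1: "ip u p1 = 0" unfolding p1_def[abs_def] ip_right using uu by simp
  define \<psi> where "\<psi> n = p1 n - (ip v' p1 / ip v' v') * v' n" for n
  have u\<psi>: "ip u \<psi> = 0" unfolding \<psi>_def[abs_def] ip_right using uv' up1 by simp
  have v'\<psi>: "ip v' \<psi> = 0" unfolding \<psi>_def[abs_def] ip_right using vv' by simp
  have "v = (\<lambda>n. v' n + al * u n)" by (simp add: v'_def)
  then have v\<psi>: "ip v \<psi> = 0" using ip_left[of v' al u \<psi>] u\<psi> v'\<psi> by simp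
  have j\<psi>: "jac ?q \<psi> n = g n" for n
    unfolding \<psi>_def[abs_def] p1_def[abs_def] v'_def[abs_def] jac_diff p u v by simp
  \<comment> \<open>\<open>\<zeta>\<close> has zero data at the left end of the box. Green's
    identity with the homogeneous solutions turns the orthogonality of \<open>\<psi>\<close> into
    zero data at the right end as well, the Wronskian of \<open>u\<close> and \<open>v\<close> being
    1.\<close>
  obtain \<zeta> where \<zeta>: "\<zeta> (- int N - 1) = 0" "\<zeta> (- int N) = 0"
    "\<And>n. jac ?q \<zeta> n = (if n \<in> ?B then cnj (\<psi> n) else 0)"
    using jac_solution[of "- int N - 1" 0 0 ?q "\<lambda>n. if n \<in> ?B then cnj (\<psi> n) else 0"] by auto
  have B: "{- int N..- int N + int (2 * N)} = ?B" "- int N + int (2 * N) = int N" by auto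
  have green: "(\<Sum>n\<in>?B. h n * jac ?q \<zeta> n - \<zeta> n * jac ?q h n) =
      h (int N) * \<zeta> (int N + 1) - h (int N + 1) * \<zeta> (int N)" for h
    using jac_green[where a = "- int N" and k = "2 * N" and h = h and q = ?q and \<zeta> = \<zeta>] \<zeta>(1,2)
    unfolding B by simp
  have hom: "h (int N) * \<zeta> (int N + 1) = h (int N + 1) * \<zeta> (int N)"
    if "\<And>n. jac ?q h n = 0" "ip h \<psi> = 0" for h
  proof -
    have "(\<Sum>n\<in>?B. h n * jac ?q \<zeta> n - \<zeta> n * jac ?q h n) = cnj (ip h \<psi>)"
      unfolding ip_def cnj_sum by (rule sum.cong) (auto simp: that(1) \<zeta>(3))
    then show ?thesis using green[of h] that(2) by simp
  qed
  have W: "u (int N) * v (int N + 1) - u (int N + 1) * v (int N) = 1"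
  proof -
    have "(\<Sum>n\<in>{1..1 + int (N - 1)}. u n * jac ?q v n - v n * jac ?q u n) = 0" using u v by simp
    then show ?thesis
      using jac_green[where a = 1 and k = "N - 1" and h = u and q = ?q and \<zeta> = v] u v N
      by (simp add: of_nat_diff)
  qed
  have hu: "u (int N) * \<zeta> (int N + 1) = u (int N + 1) * \<zeta> (int N)" by (rule hom[OF u(3) u\<psi>])
  have hv: "v (int N) * \<zeta> (int N + 1) = v (int N + 1) * \<zeta> (int N)" by (rule hom[OF v(3) v\<psi>])
  have "\<zeta> (int N) = \<zeta> (int N) * (u (int N) * v (int N + 1) - u (int N + 1) * v (int N))" using W by simp
  also have "\<dots> = u (int N) * (v (int N + 1) * \<zeta> (int N)) - v (int N) * (u (int N + 1) * \<zeta> (int N))"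
    by (simp add: algebra_simps)
  also have "\<dots> = 0" unfolding hu[symmetric] hv[symmetric] by simp
  finally have z0: "\<zeta> (int N) = 0" .
  have "\<zeta> (int N + 1) = \<zeta> (int N + 1) * (u (int N) * v (int N + 1) - u (int N + 1) * v (int N))" using W by simp
  also have "\<dots> = v (int N + 1) * (u (int N) * \<zeta> (int N + 1)) - u (int N + 1) * (v (int N) * \<zeta> (int N + 1))"
    by (simp add: algebra_simps)
  also have "\<dots> = 0" unfolding hu hv by simp
  finally have z1: "\<zeta> (int N + 1) = 0" .
  have supp: "\<zeta> n = 0" if "n \<notin> ?B" for n
  proof (cases "int N \<le> n")
    case True
    show ?thesis by (rule jac_zero_forward[of "int N" ?q \<zeta>]) (use \<zeta>(3) z0 z1 True in auto)
  next
    case False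
    then have "n \<le> - int N - 1" using that by auto
    show ?thesis
      by (rule jac_zero_backward[of "- int N - 1" ?q \<zeta>]) (use \<zeta> \<open>n \<le> - int N - 1\<close> in auto)
  qed
  define X where "X = (\<Sum>n\<in>?B. (cmod (\<psi> n))\<^sup>2)"
  define Z where "Z = (\<Sum>n\<in>?B. (cmod (\<zeta> n))\<^sup>2)"
  define G where "G = (\<Sum>n\<in>?B. (cmod (g n))\<^sup>2)"
  have "c * Z \<le> (\<Sum>n\<in>{- int N - 1..int N + 1}. (cmod (jac ?q \<zeta> n))\<^sup>2)"
    unfolding Z_def by (rule bbelowD[OF bb(1) supp])
  also have "\<dots> = (\<Sum>n\<in>?B. (cmod (jac ?q \<zeta> n))\<^sup>2)"
    by (rule sum.mono_neutral_right) (auto simp: \<zeta>(3))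
  also have "\<dots> = X" unfolding X_def by (rule sum.cong) (auto simp: \<zeta>(3))
  finally have cZ: "c * Z \<le> X" .
  \<comment> \<open>Without boundary terms Green's identity moves the operator from
    \<open>\<zeta>\<close> to \<open>\<psi>\<close>, so the squared norm of \<open>\<psi>\<close>
    becomes the pairing of \<open>\<zeta>\<close> with \<open>g\<close>.\<close>
  have "(\<Sum>n\<in>?B. \<psi> n * jac ?q \<zeta> n) = (\<Sum>n\<in>?B. \<zeta> n * g n)"
    using green[of \<psi>] z0 z1 unfolding j\<psi> sum_subtractf by simp
  moreover have "(\<Sum>n\<in>?B. \<psi> n * jac ?q \<zeta> n) = of_real X"
    unfolding ip_self[of \<psi>, folded X_def, symmetric] ip_def by (rule sum.cong) (auto simp: \<zeta>(3))
  ultimately have "of_real X = (\<Sum>n\<in>?B. \<zeta> n * g n)" by simp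
  then have "\<bar>X\<bar> = cmod (\<Sum>n\<in>?B. \<zeta> n * g n)" by (metis norm_of_real)
  also have "\<dots> \<le> (\<Sum>n\<in>?B. cmod (\<zeta> n) * cmod (g n))"
    by (rule order_trans[OF norm_sum]) (simp add: norm_mult)
  finally have "\<bar>X\<bar>\<^sup>2 \<le> (\<Sum>n\<in>?B. cmod (\<zeta> n) * cmod (g n))\<^sup>2" by (intro power_mono) auto
  also have "\<dots> \<le> Z * G" unfolding Z_def G_def by (rule Cauchy_Schwarz_ineq_sum)
  finally have X2: "X\<^sup>2 \<le> Z * G" by simp
  have X0: "0 \<le> X" "0 \<le> G" unfolding X_def G_def by (auto intro: sum_nonneg)
  have "c * X \<le> G"
  proof (cases "X = 0")
    case False
    then have "0 < X" using X0 by simp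
    have "c * X\<^sup>2 \<le> c * (Z * G)" using X2 bb(2) by simp
    also have "\<dots> \<le> X * G" using cZ X0 by (simp add: mult.assoc[symmetric] mult_right_mono)
    finally show ?thesis using \<open>0 < X\<close> by (simp add: power2_eq_square mult.left_commute)
  qed (use X0 in simp)
  then show ?thesis using j\<psi> unfolding X_def G_def by blast
qed

text \<open>The box solutions differ from one another by homogeneous solutions, hence are determined
  by their values at 0 and 1. Compactness in these two values alone gives convergence at every site
  along a subsequence, and the norm bounds survive.\<close>

lemma jac_surjective:
  assumes bb: "bbelow V \<omega> z c" "0 < c" and g: "g \<in> ell2"
  shows "\<exists>\<psi>\<in>ell2. (\<forall>n. jac (fq V \<omega> z) \<psi> n = g n) \<and> (ell2_norm \<psi>)\<^sup>2 \<le> (ell2_norm g)\<^sup>2 / c"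
proof -
  let ?q = "fq V \<omega> z"
  define K where "K = (ell2_norm g)\<^sup>2 / c"
  \<comment> \<open>\<open>Suc N\<close> puts the sites 0 and 1 inside every box.\<close>
  have "\<exists>\<psi>. (\<forall>n. jac ?q \<psi> n = g n) \<and> (\<Sum>n\<in>{- int (Suc N)..int (Suc N)}. (cmod (\<psi> n))\<^sup>2) \<le> K" for N
  proof -
    obtain \<psi> where \<psi>: "\<forall>n. jac ?q \<psi> n = g n"
      "c * (\<Sum>n\<in>{- int (Suc N)..int (Suc N)}. (cmod (\<psi> n))\<^sup>2) \<le> (\<Sum>n\<in>{- int (Suc N)..int (Suc N)}. (cmod (g n))\<^sup>2)"
      using jac_box_solution[OF bb, of "Suc N" g] by auto
    note \<psi>(2)
    also have "(\<Sum>n\<in>{- int (Suc N)..int (Suc N)}. (cmod (g n))\<^sup>2) \<le> (ell2_norm g)\<^sup>2"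
      by (rule ell2_sum_le[OF g]) simp
    finally show ?thesis using \<psi>(1) bb(2) unfolding K_def
      by (intro exI[of _ \<psi>]) (simp add: le_divide_eq mult.commute)
  qed
  then obtain \<Psi> where j: "\<And>N n. jac ?q (\<Psi> N) n = g n"
    and b: "\<And>N. (\<Sum>n\<in>{- int (Suc N)..int (Suc N)}. (cmod (\<Psi> N n))\<^sup>2) \<le> K" by metis
  have K0: "0 \<le> K" using bb(2) unfolding K_def by simp
  have pt: "cmod (\<Psi> N n) \<le> sqrt K" if "n = 0 \<or> n = 1" for N n
  proof (rule real_le_rsqrt)
    have "n \<in> {- int (Suc N)..int (Suc N)}" using that by auto
    then have "(cmod (\<Psi> N n))\<^sup>2 \<le> (\<Sum>n\<in>{- int (Suc N)..int (Suc N)}. (cmod (\<Psi> N n))\<^sup>2)"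
      by (intro member_le_sum) auto
    then show "(cmod (\<Psi> N n))\<^sup>2 \<le> K" using b[of N] by linarith
  qed
  have "bounded (range (\<lambda>N. (\<Psi> N 0, \<Psi> N 1)))"
  proof (rule boundedI)
    fix x assume "x \<in> range (\<lambda>N. (\<Psi> N 0, \<Psi> N 1))"
    then obtain N where "x = (\<Psi> N 0, \<Psi> N 1)" by blast
    then show "norm x \<le> sqrt K + sqrt K"
      using norm_Pair_le[of "\<Psi> N 0" "\<Psi> N 1"] pt[of 0 N] pt[of 1 N] by simp
  qed
  then obtain l r where r: "strict_mono (r :: nat \<Rightarrow> nat)" "((\<lambda>N. (\<Psi> N 0, \<Psi> N 1)) \<circ> r) \<longlonglongrightarrow> l"
    using bounded_imp_convergent_subsequence by blast
  have l: "(\<lambda>k. \<Psi> (r k) 0) \<longlonglongrightarrow> fst l" "(\<lambda>k. \<Psi> (r k) 1) \<longlonglongrightarrow> snd l"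
    using tendsto_fst[OF r(2)] tendsto_snd[OF r(2)] by (simp_all add: o_def)
  obtain p where p: "p 0 = 0" "p 1 = 0" "\<And>n. jac ?q p n = g n" using jac_solution[of 0 0 0 ?q g] by auto
  obtain u where u: "u 0 = 1" "u 1 = 0" "\<And>n. jac ?q u n = 0"
    using jac_solution[of 0 1 0 ?q "\<lambda>_. 0"] by auto
  obtain v where v: "v 0 = 0" "v 1 = 1" "\<And>n. jac ?q v n = 0"
    using jac_solution[of 0 0 1 ?q "\<lambda>_. 0"] by auto
  have rep: "\<Psi> N n = p n + \<Psi> N 0 * u n + \<Psi> N 1 * v n" for N n
  proof (rule jac_unique[of ?q _ _ 0])
    show "jac ?q (\<Psi> N) n = jac ?q (\<lambda>n. p n + \<Psi> N 0 * u n + \<Psi> N 1 * v n) n" for n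
    proof -
      have "jac ?q (\<lambda>n. p n + \<Psi> N 0 * u n + \<Psi> N 1 * v n) n =
          jac ?q p n + \<Psi> N 0 * jac ?q u n + \<Psi> N 1 * jac ?q v n" by (simp add: jac_def algebra_simps)
      then show ?thesis by (simp add: j p u v)
    qed
  qed (simp_all add: p u v)
  define \<psi> where "\<psi> n = p n + fst l * u n + snd l * v n" for n
  have conv: "(\<lambda>k. \<Psi> (r k) n) \<longlonglongrightarrow> \<psi> n" for n
  proof -
    have "(\<lambda>k. \<Psi> (r k) n) = (\<lambda>k. p n + \<Psi> (r k) 0 * u n + \<Psi> (r k) 1 * v n)"
      by (rule ext) (rule rep)
    then show ?thesis unfolding \<psi>_def by (simp only:) (intro tendsto_intros l)
  qed
  have j\<psi>: "jac ?q \<psi> n = g n" for n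
  proof -
    have "jac ?q \<psi> n = jac ?q p n + fst l * jac ?q u n + snd l * jac ?q v n"
      by (simp add: \<psi>_def[abs_def] jac_def algebra_simps)
    then show ?thesis by (simp add: p u v)
  qed
  have "(\<Sum>n\<in>{- int M..int M}. (cmod (\<psi> n))\<^sup>2) \<le> K" for M
  proof (rule tendsto_upperbound)
    show "(\<lambda>k. \<Sum>n\<in>{- int M..int M}. (cmod (\<Psi> (r k) n))\<^sup>2) \<longlonglongrightarrow> (\<Sum>n\<in>{- int M..int M}. (cmod (\<psi> n))\<^sup>2)"
      by (intro tendsto_sum tendsto_power tendsto_norm conv)
    show "\<forall>\<^sub>F k in sequentially. (\<Sum>n\<in>{- int M..int M}. (cmod (\<Psi> (r k) n))\<^sup>2) \<le> K"
    proof (rule eventually_sequentiallyI[of M])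
      fix k assume "M \<le> k"
      then have "M \<le> r k" using seq_suble[OF r(1), of k] by linarith
      then have "(\<Sum>n\<in>{- int M..int M}. (cmod (\<Psi> (r k) n))\<^sup>2) \<le>
          (\<Sum>n\<in>{- int (Suc (r k))..int (Suc (r k))}. (cmod (\<Psi> (r k) n))\<^sup>2)"
        by (intro sum_mono2) auto
      then show "(\<Sum>n\<in>{- int M..int M}. (cmod (\<Psi> (r k) n))\<^sup>2) \<le> K" using b[of "r k"] by linarith
    qed
  qed simp
  from ell2I_bound[OF this] j\<psi> show ?thesis unfolding K_def by blast
qed

lemma fib_hamiltonian_ell2:
  assumes "\<psi> \<in> ell2" shows "(\<lambda>n. fib_hamiltonian V \<omega> \<psi> n - z * \<psi> n) \<in> ell2"
proof -
  have "fib_hamiltonian V \<omega> \<psi> \<in> ell2"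
    using bounded_operator_fib_hamiltonian[of V \<omega>] assms unfolding bounded_operator_def by blast
  from ell2_lincomb[OF assms this, of "- z"] show ?thesis by simp
qed

lemma resolvent_of_bbelow:
  assumes bb: "bbelow V \<omega> z c" "0 < c"
  shows "z \<in> resolvent_set (fib_hamiltonian V \<omega>)"
proof -
  let ?q = "fq V \<omega> z"
  define S where "S g = (SOME \<psi>. \<psi> \<in> ell2 \<and> (\<forall>n. jac ?q \<psi> n = g n) \<and>
      (ell2_norm \<psi>)\<^sup>2 \<le> (ell2_norm g)\<^sup>2 / c)" for g
  have S: "S g \<in> ell2 \<and> (\<forall>n. jac ?q (S g) n = g n) \<and> (ell2_norm (S g))\<^sup>2 \<le> (ell2_norm g)\<^sup>2 / c"
    if "g \<in> ell2" for g
  proof -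
    have "\<exists>\<psi>. \<psi> \<in> ell2 \<and> (\<forall>n. jac ?q \<psi> n = g n) \<and> (ell2_norm \<psi>)\<^sup>2 \<le> (ell2_norm g)\<^sup>2 / c"
      using jac_surjective[OF bb that] by blast
    from someI_ex[OF this] show ?thesis unfolding S_def .
  qed
  have unique: "\<phi> = \<psi>" if "\<phi> \<in> ell2" "\<psi> \<in> ell2" "\<And>n. jac ?q \<phi> n = jac ?q \<psi> n" for \<phi> \<psi>
  proof
    fix n
    have "(\<lambda>n. (-1) * \<psi> n + \<phi> n) n = 0"
      by (rule jac_injective[OF bb ell2_lincomb[OF that(2,1)]]) (simp only: jac_lincomb that(3), simp)
    then show "\<phi> n = \<psi> n" by simp
  qed
  have "bounded_operator S"
    unfolding bounded_operator_def
  proof (intro conjI ballI allI exI)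
    show "S \<psi> \<in> ell2" if "\<psi> \<in> ell2" for \<psi> using S[OF that] by blast
    show "S (\<lambda>n. c * \<phi> n + \<psi> n) = (\<lambda>n. c * S \<phi> n + S \<psi> n)" if "\<phi> \<in> ell2" "\<psi> \<in> ell2" for \<phi> \<psi> c
    proof (rule unique)
      note s = S[OF that(1)] S[OF that(2)] S[OF ell2_lincomb[OF that], of c]
      show "S (\<lambda>n. c * \<phi> n + \<psi> n) \<in> ell2" "(\<lambda>n. c * S \<phi> n + S \<psi> n) \<in> ell2"
        using s ell2_lincomb by blast+
      show "jac ?q (S (\<lambda>n. c * \<phi> n + \<psi> n)) n = jac ?q (\<lambda>n. c * S \<phi> n + S \<psi> n) n" for n
        using s by (simp add: jac_lincomb)
    qed
    show "ell2_norm (S \<psi>) \<le> sqrt (1 / c) * ell2_norm \<psi>" if "\<psi> \<in> ell2" for \<psi>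
    proof -
      have "ell2_norm (S \<psi>) \<le> sqrt ((ell2_norm \<psi>)\<^sup>2 / c)"
        using S[OF that] by (intro real_le_rsqrt) blast
      then show ?thesis by (simp add: real_sqrt_divide ell2_norm_nonneg)
    qed
  qed
  moreover have "S (\<lambda>n. fib_hamiltonian V \<omega> \<psi> n - z * \<psi> n) = \<psi>" if "\<psi> \<in> ell2" for \<psi>
    by (rule unique) (use S[OF fib_hamiltonian_ell2[OF that]] that in \<open>auto simp: fib_hamiltonian_jac\<close>)
  moreover have "(\<lambda>n. fib_hamiltonian V \<omega> (S \<psi>) n - z * S \<psi> n) = \<psi>" if "\<psi> \<in> ell2" for \<psi>
    unfolding fib_hamiltonian_jac using S[OF that] by (simp add: fun_eq_iff)
  ultimately show ?thesis unfolding resolvent_set_def by blast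
qed

text \<open>Since \<open>bbelow\<close> passes between phases, so does the resolvent set. This both
  justifies the definite description and reduces membership in the spectrum to an estimate at one
  phase of choice.\<close>

lemma Sigma_V_iff: "z \<notin> Sigma_V V \<longleftrightarrow> (\<exists>c>0. bbelow V \<omega> z c)"
proof -
  have r: "z \<in> resolvent_set (fib_hamiltonian V \<omega>) \<longleftrightarrow> (\<exists>c>0. bbelow V \<omega> z c)" for z \<omega>
    using bbelow_of_resolvent resolvent_of_bbelow by blast
  have eq: "spectrum (fib_hamiltonian V \<omega>') = spectrum (fib_hamiltonian V \<omega>)" for \<omega>'
    unfolding spectrum_def set_eq_iff Compl_iff r using bbelow_transfer by blast
  have "Sigma_V V = spectrum (fib_hamiltonian V \<omega>)"
    unfolding Sigma_V_def by (rule the_equality) (use eq in auto)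
  then show ?thesis unfolding spectrum_def by (simp add: r)
qed

section \<open>Oscillation count of Dirichlet eigenvalues\<close>

lemma step_lift_range: "0 < step_lift e 0" "step_lift e (pi / 4) < pi" "pi < step_lift e (3 * pi / 4)" "step_lift e pi < 2 * pi"
proof -
  note m = strict_mono_less[OF strict_mono_shear_lift[of e]]
  have "shear_lift e 0 = 0" "shear_lift e pi = pi" "shear_lift e (2 * pi) = 2 * pi"
    using shear_lift_pi_int[of e 0] shear_lift_pi_int[of e 1] shear_lift_pi_int[of e 2] by (simp_all add: mult.commute)
  then show "0 < step_lift e 0" "step_lift e (pi / 4) < pi" "pi < step_lift e (3 * pi / 4)" "step_lift e pi < 2 * pi"
    using m[of 0 "pi/2"] m[of "pi/4 + pi/2" pi] m[of pi "3*pi/4 + pi/2"] m[of "pi + pi/2" "2*pi"]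
    unfolding step_lift_def by auto
qed

lemma sin_pos_imp_pos: "\<lbrakk>0 < sin x; - pi \<le> x\<rbrakk> \<Longrightarrow> 0 < x"
  using sin_ge_zero[of "- x"] by (cases "x \<le> 0") auto

text \<open>The diagonal direction (1, 1) is mapped to (e - 1, 1), which lies clockwise of it for
  \<open>e > 2\<close>.\<close>

lemma step_lift_high_energy:
  assumes "2 < e" shows "step_lift e (pi / 4) < pi / 4"
proof -
  define F where "F = step_lift e (pi / 4)"
  define c :: real where "c = sqrt 2 / 2"
  have c: "0 < c" by (simp add: c_def)
  have tr: "sin (pi / 4) = c" "cos (pi / 4) = c" by (simp_all add: c_def sin_45 cos_45)
  obtain r where r: "r > 0" "mapp (step_mat e) (dir (pi / 4)) = (r * cos F, r * sin F)"
    using liftsD(3)[OF lifts_step] unfolding F_def by blast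
  moreover have "mapp (step_mat e) (dir (pi / 4)) = (e * c - c, c)" by (simp add: step_mat_def tr)
  ultimately have rc: "r * cos F = e * c - c" "r * sin F = c" by (metis prod.inject)+
  have "r * sin (pi / 4 - F) = c * (r * cos F - r * sin F)" by (simp add: sin_diff tr algebra_simps)
  also have "\<dots> = c * c * (e - 2)" unfolding rc by (simp add: algebra_simps)
  also have "\<dots> > 0" using c assms by simp
  finally have "0 < sin (pi / 4 - F)" using r(1) by (simp add: zero_less_mult_iff)
  moreover have "- pi \<le> pi / 4 - F" using step_lift_range(2)[of e] pi_gt_zero unfolding F_def by linarith
  ultimately show ?thesis using sin_pos_imp_pos unfolding F_def by fastforce
qed

text \<open>The direction (-1, 1) is mapped to (- e - 1, -1); for \<open>e < -2\<close> this is more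
  than a half turn further on.\<close>

lemma step_lift_low_energy:
  assumes "e < -2" shows "3 * pi / 4 < step_lift e (3 * pi / 4) - pi"
proof -
  define F where "F = step_lift e (3 * pi / 4)"
  define c :: real where "c = sqrt 2 / 2"
  have c: "0 < c" by (simp add: c_def)
  have tr: "sin (pi / 4) = c" "cos (pi / 4) = c" by (simp_all add: c_def sin_45 cos_45)
  have e3: "3 * pi / 4 = pi - pi / 4" by simp
  have tr3: "sin (3 * pi / 4) = c" "cos (3 * pi / 4) = - c" unfolding e3 sin_diff cos_diff tr by simp_all
  obtain r where r: "r > 0" "mapp (step_mat e) (dir (3 * pi / 4)) = (r * cos F, r * sin F)"
    using liftsD(3)[OF lifts_step] unfolding F_def by blast
  moreover have "mapp (step_mat e) (dir (3 * pi / 4)) = (- e * c - c, - c)" by (simp add: step_mat_def tr3)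
  ultimately have rc: "r * cos F = - e * c - c" "r * sin F = - c" by (metis prod.inject)+
  have "F - (7 * pi / 4) = F + pi / 4 - 2 * pi" by simp
  then have "sin (F - 7 * pi / 4) = sin (F + pi / 4)" by (metis sin_diff cos_two_pi sin_two_pi mult_1_right mult_zero_right diff_zero)
  then have "r * sin (F - 7 * pi / 4) = c * (r * sin F + r * cos F)" by (simp add: sin_add tr algebra_simps)
  also have "\<dots> = c * c * (- e - 2)" unfolding rc by (simp add: algebra_simps)
  also have "\<dots> > 0" using c assms by simp
  finally have "0 < sin (F - 7 * pi / 4)" using r(1) by (simp add: zero_less_mult_iff)
  moreover have "- pi \<le> F - 7 * pi / 4" using step_lift_range(3)[of e] pi_gt_zero unfolding F_def by linarith
  ultimately show ?thesis using sin_pos_imp_pos unfolding F_def by fastforce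
qed

text \<open>The end points suffice: since lifts increase, the whole interval of directions from
  \<open>e\<close> to \<open>f\<close> is then mapped into its interior.\<close>

definition trap :: "int \<Rightarrow> int \<Rightarrow> real \<Rightarrow> real \<Rightarrow> real \<Rightarrow> real \<Rightarrow> bool list \<Rightarrow> bool" where
  "trap m l V E e f w \<longleftrightarrow> e < clift m l V E w e \<and> clift m l V E w f < f"

lemma trap_append:
  assumes "trap m l V E e f u" "trap m l V E e f v" shows "trap m l V E e f (u @ v)"
proof -
  note s = strict_mono_less[OF strict_mono_clift[of m l V E v]]
  have "clift m l V E v e < clift m l V E (u @ v) e" "clift m l V E (u @ v) f < clift m l V E v f"
    unfolding clift_append using assms(1) s unfolding trap_def by auto
  then show ?thesis using assms(2) unfolding trap_def by auto
qed

lemma trap_word: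
  assumes "\<And>b. trap m l V E e f [b]" "w \<noteq> []" shows "trap m l V E e f w"
  using assms(2)
proof (induction w)
  case (Cons b w)
  then show ?case using assms(1)[of b] trap_append[of m l V E e f "[b]" w] by (cases "w = []") auto
qed simp

text \<open>Above the spectrum a single cone is trapped with rotation 0 per site, and below it, in
  the next lemma, with a full half turn per site. These two regimes delimit the eigenvalue angles
  and supply the end points of the connectedness argument.\<close>

lemma trap_high_energy:
  assumes "2 + V < E" "0 \<le> V" "w \<noteq> []" shows "trap 0 0 V E 0 (pi / 4) w"
  by (rule trap_word[OF _ assms(3)])
    (use assms step_lift_range(1) step_lift_high_energy in \<open>auto simp: trap_def clift_def wlab_def\<close>)

lemma trap_low_energy:
  assumes "E < -2" "0 \<le> V" "w \<noteq> []" shows "trap 0 1 V E (3 * pi / 4) pi w"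
proof (rule trap_word[OF _ assms(3)])
  fix b
  have "E - (if b then V else 0) < -2" using assms by auto
  then show "trap 0 1 V E (3 * pi / 4) pi [b]"
    using step_lift_range(4)[of "E - (if b then V else 0)"] step_lift_low_energy[of "E - (if b then V else 0)"]
    by (simp only: trap_def clift_def wlab_def wlift.simps) simp
qed

lemma wlift_high_energy:
  assumes "2 + V < E" "0 \<le> V" shows "0 \<le> wlift V E w 0" "wlift V E w 0 < pi / 2"
proof -
  have "0 \<le> wlift V E w 0 \<and> wlift V E w 0 < pi / 2"
  proof (cases "w = []")
    case False
    have "wlift V E w 0 < wlift V E w (pi / 4)"
      using strict_mono_less[OF strict_mono_wlift[of V E w], of 0 "pi / 4"] by simp
    then show ?thesis using trap_high_energy[OF assms False] by (simp add: trap_def clift_def wlab_def)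
  qed simp
  then show "0 \<le> wlift V E w 0" "wlift V E w 0 < pi / 2" by auto
qed

lemma wlift_low_energy:
  assumes "E < -2" "0 \<le> V"
  shows "wlift V E w 0 \<le> pi * length w" "w \<noteq> [] \<Longrightarrow> pi * (real (length w) - 1/2) < wlift V E w 0"
proof -
  have s: "wlift V E w pi = wlift V E w 0 + pi" using liftsD(2)[OF lifts_wlift, of V E w 0] by simp
  have m: "wlift V E w (3 * pi / 4) < wlift V E w pi"
    using strict_mono_less[OF strict_mono_wlift[of V E w], of "3 * pi / 4" pi] by simp
  show "wlift V E w 0 \<le> pi * length w"
    by (cases "w = []") (use s trap_low_energy[OF assms, of w] in \<open>auto simp: trap_def clift_def wlab_def\<close>)
  show "pi * (real (length w) - 1/2) < wlift V E w 0" if "w \<noteq> []"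
    using s m trap_low_energy[OF assms that] by (simp add: trap_def clift_def wlab_def algebra_simps)
qed

lemma wlift_zero_bounds:
  assumes "0 \<le> V" shows "0 \<le> wlift V E w 0" "wlift V E w 0 \<le> pi * length w"
proof -
  have "wlift V (max E (3 + V)) w 0 \<le> wlift V E w 0" "wlift V E w 0 \<le> wlift V (min E (-3)) w 0"
    by (rule wlift_antimono; simp)+
  moreover have "2 + V < max E (3 + V)" "min E (-3) < -2" by linarith+
  ultimately show "0 \<le> wlift V E w 0" "wlift V E w 0 \<le> pi * length w"
    using wlift_high_energy(1)[of V "max E (3 + V)" w] wlift_low_energy(1)[of "min E (-3)" V w] assms by auto
qed

text \<open>The Dirichlet solution with values 0 and 1 at sites 0 and 1 has the pair of its values
  at \<open>n + 1\<close> and \<open>n\<close> equal to the image of (1, 0). A vanishing cosine says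
  that it also vanishes at \<open>n + 1\<close>.\<close>

lemma dirichlet_eigenvalue:
  assumes n: "0 < n" and c: "cos (wlift V x (window \<omega> 1 n) 0) = 0"
  shows "eigenvalue (dirichlet_restriction V \<omega> 1 (int n)) (complex_of_real x)"
proof -
  define vec2 where "vec2 k = mapp (wmat V x (window \<omega> 1 k)) (1, 0)" for k
  define u where "u k = snd (vec2 k)" for k
  have step: "vec2 (Suc k) = ((x - fib_potential V \<omega> (1 + int k)) * fst (vec2 k) - snd (vec2 k), fst (vec2 k))" for k
  proof -
    have "window \<omega> 1 (Suc k) = window \<omega> 1 k @ [occ \<omega> (1 + int k)]"
      using window_add[of \<omega> 1 k 1] by (simp add: window_def)
    then show ?thesis unfolding vec2_def
      by (cases "mapp (wmat V x (window \<omega> 1 k)) (1, 0)")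
        (simp add: wmat_append mapp_mmul step_mat_def fib_potential_occ)
  qed
  have u0: "u 0 = 0" and u1: "u 1 = 1" using step[of 0] by (simp_all add: u_def vec2_def)
  have fu: "fst (vec2 k) = u (Suc k)" for k using step[of k] by (simp add: u_def)
  have rec: "u (k + 2) + u k + fib_potential V \<omega> (1 + int k) * u (k + 1) = x * u (k + 1)" for k
  proof -
    have "u (Suc (Suc k)) = (x - fib_potential V \<omega> (1 + int k)) * u (Suc k) - u k"
      using arg_cong[OF step[of k], of fst] fu[of k] fu[of "Suc k"] by (simp add: u_def)
    then show ?thesis by (simp add: algebra_simps)
  qed
  have un: "u (Suc n) = 0"
  proof -
    obtain r where "mapp (wmat V x (window \<omega> 1 n)) (dir 0) =
        (r * cos (wlift V x (window \<omega> 1 n) 0), r * sin (wlift V x (window \<omega> 1 n) 0))"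
      using liftsD(3)[OF lifts_wlift] by blast
    then show ?thesis using c fu[of n] by (simp add: vec2_def)
  qed
  let ?A = "dirichlet_restriction V \<omega> 1 (int n)"
  define v where "v = vec n (\<lambda>i. complex_of_real (u (Suc i)))"
  have dim: "dim_row ?A = n" "dim_col ?A = n" by (simp_all add: dirichlet_restriction_def)
  have "v \<noteq> 0\<^sub>v n"
  proof
    assume "v = 0\<^sub>v n"
    then have "v $ 0 = 0" using n by simp
    then show False using n u1 by (simp add: v_def)
  qed
  moreover have "?A *\<^sub>v v = complex_of_real x \<cdot>\<^sub>v v"
  proof (rule eq_vecI)
    fix i assume "i < dim_vec (complex_of_real x \<cdot>\<^sub>v v)"
    then have i: "i < n" by (simp add: v_def)
    have ent: "?A $$ (i, j) = (if j = Suc i then 1 else 0) + (if Suc j = i then 1 else 0) +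
        (if j = i then of_real (fib_potential V \<omega> (1 + int i)) else 0)" if "j < n" for j
      using i that by (auto simp: dirichlet_restriction_def fib_hamiltonian_def indicator_def)
    have "(?A *\<^sub>v v) $ i = (\<Sum>j<n. ?A $$ (i, j) * of_real (u (Suc j)))"
      using i by (simp add: dim scalar_prod_def v_def lessThan_atLeast0)
    also have "\<dots> = (\<Sum>j<n. (if j = Suc i then of_real (u (Suc j)) else 0) + (if Suc j = i then of_real (u (Suc j)) else 0) +
        (if j = i then of_real (fib_potential V \<omega> (1 + int i)) * of_real (u (Suc j)) else 0))"
      by (rule sum.cong) (auto simp: ent)
    also have "\<dots> = of_real (u (Suc (Suc i))) + of_real (u i) +
        of_real (fib_potential V \<omega> (1 + int i)) * of_real (u (Suc i))"
    proof -
      have a: "(\<Sum>j<n. if j = Suc i then of_real (u (Suc j)) else 0) = (of_real (u (Suc (Suc i))) :: complex)"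
        using i un by (cases "Suc i = n") (auto simp: sum.delta)
      have b: "(\<Sum>j<n. if Suc j = i then of_real (u (Suc j)) else 0) = (of_real (u i) :: complex)"
        using i u0 by (cases i) (auto simp: sum.delta)
      show ?thesis unfolding sum.distrib a b using i by (simp add: sum.delta)
    qed
    also have "\<dots> = of_real (u (i + 2) + u i + fib_potential V \<omega> (1 + int i) * u (i + 1))" by simp
    also have "\<dots> = (complex_of_real x \<cdot>\<^sub>v v) $ i" unfolding rec using i by (simp add: v_def)
    finally show "(?A *\<^sub>v v) $ i = (complex_of_real x \<cdot>\<^sub>v v) $ i" .
  qed (simp add: dim v_def)
  ultimately show ?thesis
    unfolding eigenvalue_def eigenvector_def dim by (intro exI[of _ v]) (simp add: v_def)
qed

text \<open>The angle \<open>T\<close> decreases strictly in the energy from above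
  \<open>pi * (n - 1/2)\<close> to below \<open>pi / 2\<close>, so it meets each of the
  \<open>n\<close> values \<open>pi / 2 + pi * j\<close> once. These are \<open>n\<close>
  eigenvalues; the degree of the characteristic polynomial leaves room for no others and forces them
  to be simple. Counting those below \<open>E\<close> rounds \<open>T E / pi\<close>.\<close>

lemma eigenvalue_count_bound:
  assumes n: "0 < n" and V: "0 \<le> V"
  shows "\<bar>real (eigenvalue_count E \<omega> V 1 (int n)) - (real n - wlift V E (window \<omega> 1 n) 0 / pi)\<bar> \<le> 1"
proof -
  let ?A = "dirichlet_restriction V \<omega> 1 (int n)" and ?p = "char_poly (dirichlet_restriction V \<omega> 1 (int n))"
  define T where "T x = wlift V x (window \<omega> 1 n) 0" for x
  have A: "?A \<in> carrier_mat n n" by (simp add: dirichlet_restriction_def)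
  have deg: "degree ?p = n" "?p \<noteq> 0" using degree_monic_char_poly[OF A] by auto
  have ne: "window \<omega> 1 n \<noteq> []" using n length_window[of \<omega> 1 n] by (metis length_0_conv less_irrefl)
  have anti: "T x' < T x" if "x < x'" for x x' unfolding T_def by (rule wlift_zero_less[OF that ne])
  have "\<exists>x. T x = pi / 2 + pi * real j" if "j < n" for j
  proof -
    have "real j \<le> real n - 1" using that by linarith
    then have "pi * real j \<le> pi * (real n - 1)" by (intro mult_left_mono) auto
    moreover have "0 \<le> pi * real j" by simp
    moreover have "T (3 + V) < pi / 2" "pi * (real n - 1/2) < T (-3)"
      using wlift_high_energy(2)[of V "3 + V" "window \<omega> 1 n"] wlift_low_energy(2)[of "-3" V "window \<omega> 1 n"] V ne
      by (auto simp: T_def)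
    ultimately have "T (3 + V) \<le> pi / 2 + pi * real j" "pi / 2 + pi * real j \<le> T (-3)"
      by (simp_all only: right_diff_distrib)
    moreover have "continuous_on {-3..3 + V} T"
      unfolding T_def by (rule continuous_on_subset[OF continuous_wlift_energy]) auto
    ultimately show ?thesis using IVT2'[of T "3 + V" _ "-3"] V by auto
  qed
  then have "\<forall>j. \<exists>x. j < n \<longrightarrow> T x = pi / 2 + pi * real j" by blast
  from choice[OF this] obtain X where X: "\<And>j. j < n \<Longrightarrow> T (X j) = pi / 2 + pi * real j" by blast
  have inj: "inj_on X {..<n}"
  proof (rule inj_onI)
    fix i j assume ij: "i \<in> {..<n}" "j \<in> {..<n}" "X i = X j"
    have "pi / 2 + pi * real i = T (X i)" using X[of i] ij(1) by simp
    also have "\<dots> = T (X j)" by (simp only: ij(3))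
    also have "\<dots> = pi / 2 + pi * real j" using X[of j] ij(2) by simp
    finally show "i = j" by simp
  qed
  define R where "R = {x. eigenvalue ?A (complex_of_real x)}"
  have root: "eigenvalue ?A k \<longleftrightarrow> poly ?p k = 0" for k by (rule eigenvalue_root_char_poly[OF A])
  have "finite (complex_of_real -` {k. poly ?p k = 0})"
    by (rule finite_vimageI[OF poly_roots_finite[OF deg(2)]]) (simp add: inj_on_def)
  then have finR: "finite R" unfolding R_def root vimage_def by simp
  have XR: "X ` {..<n} \<subseteq> R"
  proof
    fix x assume "x \<in> X ` {..<n}"
    then obtain j where j: "j < n" "x = X j" by auto
    have "cos (wlift V x (window \<omega> 1 n) 0) = cos (pi / 2 + pi * of_int (int j))"
      using X[OF j(1)] j(2) by (simp add: T_def)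
    also have "\<dots> = 0" by (simp add: cos_add mult.commute[of pi])
    finally show "x \<in> R" unfolding R_def using dirichlet_eigenvalue[OF n] by simp
  qed
  have ord: "1 \<le> order (complex_of_real x) ?p" if "x \<in> R" for x
    using that deg(2) root[of "complex_of_real x"] by (simp add: R_def order_root Suc_le_eq)
  have tot: "(\<Sum>x\<in>R. order (complex_of_real x) ?p) \<le> n"
  proof -
    have "(\<Sum>x\<in>R. order (complex_of_real x) ?p) = (\<Sum>k\<in>complex_of_real ` R. order k ?p)"
      by (subst sum.reindex) (auto simp: inj_on_def)
    also have "\<dots> \<le> (\<Sum>k | poly ?p k = 0. order k ?p)"
      by (rule sum_mono2) (use deg(2) root in \<open>auto simp: R_def poly_roots_finite\<close>)
    also have "\<dots> \<le> n" using sum_order_le_degree[OF deg(2)] deg(1) by simp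
    finally show ?thesis .
  qed
  have cX: "card (X ` {..<n}) = n" using card_image[OF inj] by simp
  have "card R \<le> (\<Sum>x\<in>R. order (complex_of_real x) ?p)" using sum_mono[of R "\<lambda>_. 1", OF ord] by simp
  then have cR: "card R \<le> n" using tot by simp
  then have RX: "R = X ` {..<n}" using card_seteq[OF finR XR] cX by simp
  have one: "order (complex_of_real x) ?p = 1" if x: "x \<in> R" for x
  proof (rule ccontr)
    assume "order (complex_of_real x) ?p \<noteq> 1"
    then have "1 < order (complex_of_real x) ?p" using ord[OF x] by simp
    then have "(\<Sum>x\<in>R. 1) < (\<Sum>x\<in>R. order (complex_of_real x) ?p)"
      using ord x by (intro sum_strict_mono_ex1[OF finR]) auto
    then show False using tot RX cX by simp
  qed
  have "eigenvalue_count E \<omega> V 1 (int n) = (\<Sum>x\<in>{x \<in> R. x \<le> E}. order (complex_of_real x) ?p)"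
    unfolding eigenvalue_count_def Let_def R_def by (rule sum.cong) auto
  also have "\<dots> = card {x \<in> R. x \<le> E}" by (simp add: one)
  also have "{x \<in> R. x \<le> E} = X ` {j. j < n \<and> X j \<le> E}" unfolding RX by auto
  also have "card \<dots> = card {j. j < n \<and> X j \<le> E}"
    by (rule card_image) (rule inj_on_subset[OF inj], auto)
  finally have cnt: "eigenvalue_count E \<omega> V 1 (int n) = card {j. j < n \<and> X j \<le> E}" .
  \<comment> \<open>In this scale the eigenvalue \<open>X j\<close> sits at \<open>j\<close>, and
    the order is reversed.\<close>
  define y where "y = T E / pi - 1 / 2"
  have le: "X j \<le> E \<longleftrightarrow> y \<le> real j" if "j < n" for j
  proof -
    have "X j \<le> E \<longleftrightarrow> T E \<le> T (X j)"
      using anti[of "X j" E] anti[of E "X j"] by (cases "X j" E rule: linorder_cases) auto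
    then show ?thesis unfolding X[OF that] y_def by (simp add: field_simps)
  qed
  have y: "- 1 / 2 \<le> y" "y \<le> real n - 1 / 2"
    using wlift_zero_bounds[OF V, of E "window \<omega> 1 n"] unfolding y_def T_def by (simp_all add: field_simps)
  define k where "k = nat \<lceil>y\<rceil>"
  have k: "y \<le> real k" "real k < y + 1" "k \<le> n"
    using y unfolding k_def by linarith+
  have "y \<le> real j \<longleftrightarrow> k \<le> j" for j using k unfolding k_def by (simp add: nat_le_iff ceiling_le_iff)
  then have "{j. j < n \<and> X j \<le> E} = {k..<n}" using le by auto
  then have "real (eigenvalue_count E \<omega> V 1 (int n)) = real n - real k" using cnt k(3) by simp
  then show ?thesis using k unfolding y_def T_def by linarith
qed

text \<open>The definite description is resolved by showing one common limit for every phase; the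
  oscillation count costs an error of at most 1 out of \<open>n\<close>.\<close>

lemma ids_eqI:
  assumes V: "0 \<le> V"
    and lim: "\<And>\<omega>. (\<lambda>n. wlift V E (window \<omega> 1 n) 0 / (pi * real n)) \<longlonglongrightarrow> \<theta>"
  shows "ids E V = 1 - \<theta>"
proof -
  have L: "(\<lambda>n. real (eigenvalue_count E \<omega> V 1 (int n)) / real n) \<longlonglongrightarrow> 1 - \<theta>" for \<omega>
  proof -
    have "(\<lambda>n. real (eigenvalue_count E \<omega> V 1 (int n)) / real n - (1 - wlift V E (window \<omega> 1 n) 0 / (pi * real n))) \<longlonglongrightarrow> 0"
    proof (rule tendsto_rabs_zero_cancel, rule tendsto_sandwich[OF _ _ tendsto_const lim_1_over_n])
      show "\<forall>\<^sub>F n in sequentially. \<bar>real (eigenvalue_count E \<omega> V 1 (int n)) / real n - (1 - wlift V E (window \<omega> 1 n) 0 / (pi * real n))\<bar> \<le> 1 / real n"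
      proof (rule eventually_sequentiallyI[of 1])
        fix n :: nat assume n: "1 \<le> n"
        have "real (eigenvalue_count E \<omega> V 1 (int n)) / real n - (1 - wlift V E (window \<omega> 1 n) 0 / (pi * real n)) =
          (real (eigenvalue_count E \<omega> V 1 (int n)) - (real n - wlift V E (window \<omega> 1 n) 0 / pi)) / real n"
          using n by (simp add: field_simps)
        then show "\<bar>real (eigenvalue_count E \<omega> V 1 (int n)) / real n - (1 - wlift V E (window \<omega> 1 n) 0 / (pi * real n))\<bar> \<le> 1 / real n"
          using eigenvalue_count_bound[of n V E \<omega>] n V by (simp only: abs_divide) (simp add: divide_right_mono)
      qed
    qed simp
    moreover have "(\<lambda>n. 1 - wlift V E (window \<omega> 1 n) 0 / (pi * real n)) \<longlonglongrightarrow> 1 - \<theta>"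
      by (intro tendsto_intros lim)
    ultimately show ?thesis using tendsto_add by fastforce
  qed
  show ?thesis unfolding ids_def by (rule the_equality) (use L LIMSEQ_unique in blast)+
qed

text \<open>After its first visit to \<open>[0, alpha ^ (2 * i))\<close> the window splits into even
  and odd words of level \<open>i\<close>. Each turns by at most \<open>2 * pi\<close>, and there
  are at most \<open>n\<close> divided by the shorter length of them.\<close>

lemma clift_window_bound:
  assumes b: "\<And>k \<phi>. k0 \<le> k \<Longrightarrow> \<bar>flift m l V E k \<phi> - \<phi>\<bar> \<le> 2 * pi" and i: "k0 \<le> 2 * i"
  shows "\<exists>K. \<forall>n \<phi>. \<bar>clift m l V E (window \<omega> 1 n) \<phi> - \<phi>\<bar> \<le> K + 2 * pi * n / length (fibw (2 * i))"
proof -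
  let ?A = "fibw (2*i)" and ?B = "fibw (2*i+1)"
  define c where "c = pi * (2 + \<bar>m\<bar> + \<bar>l\<bar>)"
  have c0: "0 \<le> c" unfolding c_def by simp
  have cb: "\<bar>clift m l V E w \<phi> - \<phi>\<bar> \<le> c * length w" for w \<phi>
    unfolding c_def by (rule clift_bound)
  define a where "a = real (length ?A)"
  have a1: "0 < a" unfolding a_def using length_fibw_pos by simp
  \<comment> \<open>Covers the tail, on which a complete block may no longer fit.\<close>
  define K1 where "K1 = c * (length ?A + length ?B)"
  have blocks: "\<bar>clift m l V E (window \<omega> s n) \<phi> - \<phi>\<bar> \<le> K1 + 2 * pi * n / a"
    if "pos \<omega> s < alpha ^ (2*i)" for s n \<phi>
    using that
  proof (induction n arbitrary: s \<phi> rule: less_induct)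
    case (less n)
    show ?case
    proof (cases "n < length ?A + length ?B")
      case True
      have "c * real n \<le> K1" unfolding K1_def using True c0 by (intro mult_left_mono) auto
      then show ?thesis using cb[of "window \<omega> s n" \<phi>] a1 by (simp add: add_increasing2)
    next
      case False
      have big: "length ?A \<le> length ?B"
        by (cases i) auto
      define W where "W = (if pos \<omega> s < alpha ^ (2*i+2) then ?A else ?B)"
      have W: "window \<omega> s (length W) = W" "pos \<omega> (s + int (length W)) < alpha ^ (2*i)"
        "\<And>\<phi>. \<bar>clift m l V E W \<phi> - \<phi>\<bar> \<le> 2 * pi" "length W \<le> n" "a \<le> length W" "0 < length W"
        using itinerary[where \<omega> = \<omega> and n = s and i = i] less.prems b[of "2*i"] b[of "2*i+1"] i False big length_fibw_pos
          alpha_power_Suc2[of "2*i"] alpha_power_pos[of "2*i+2"]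
        by (auto simp: W_def a_def simp del: power_Suc alpha_power_pos)
      let ?n = "n - length W"
      have "window \<omega> s n = W @ window \<omega> (s + int (length W)) ?n"
        using window_add[of \<omega> s "length W" ?n] W(1,4) by simp
      then have "clift m l V E (window \<omega> s n) \<phi> = clift m l V E (window \<omega> (s + int (length W)) ?n) (clift m l V E W \<phi>)"
        by (simp add: clift_append)
      moreover have "\<bar>clift m l V E (window \<omega> (s + int (length W)) ?n) (clift m l V E W \<phi>) - clift m l V E W \<phi>\<bar>
          \<le> K1 + 2 * pi * ?n / a"
        by (rule less.IH[OF _ W(2)]) (use W(4,6) in linarith)
      moreover have "2 * pi * real ?n / a + 2 * pi \<le> 2 * pi * real n / a"
      proof -
        have "real ?n + a \<le> real n" using W(4,5) by (simp add: of_nat_diff)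
        then have "2 * pi * (real ?n + a) / a \<le> 2 * pi * real n / a"
          using a1 by (intro divide_right_mono mult_left_mono) auto
        then show ?thesis using a1 by (simp add: field_simps)
      qed
      ultimately show ?thesis using W(3)[of \<phi>] by linarith
    qed
  qed
  obtain s where s: "1 \<le> s" "pos \<omega> s < alpha ^ (2*i)" using return_forward by blast
  define p where "p = nat (s - 1)"
  have p: "s = 1 + int p" using s unfolding p_def by simp
  have "\<bar>clift m l V E (window \<omega> 1 n) \<phi> - \<phi>\<bar> \<le> (c * p + K1) + 2 * pi * n / a" for n \<phi>
  proof (cases "n \<le> p")
    case True
    then have "c * real n \<le> c * real p" using c0 by (intro mult_left_mono) auto
    moreover have "0 \<le> K1" "0 \<le> 2 * pi * n / a" unfolding K1_def using c0 a1 by auto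
    ultimately show ?thesis using cb[of "window \<omega> 1 n" \<phi>] by simp
  next
    case False
    have "window \<omega> 1 n = window \<omega> 1 p @ window \<omega> s (n - p)"
      using window_add[of \<omega> 1 p "n - p"] False p by simp
    then have e: "clift m l V E (window \<omega> 1 n) \<phi> = clift m l V E (window \<omega> s (n - p)) (clift m l V E (window \<omega> 1 p) \<phi>)"
      by (simp add: clift_append)
    have "2 * pi * real (n - p) / a \<le> 2 * pi * real n / a" using a1 by (intro divide_right_mono mult_left_mono) auto
    then show ?thesis
      using blocks[OF s(2), of "n - p" "clift m l V E (window \<omega> 1 p) \<phi>"] cb[of "window \<omega> 1 p" \<phi>] e
      by simp
  qed
  then show ?thesis unfolding a_def by blast
qed

text \<open>Relative to the label, a window of length \<open>n\<close> turns by a constant plus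
  \<open>2 * pi * n\<close> over the block length. Blocks being arbitrarily long, the turn per site
  is exactly \<open>pi\<close> times the prescribed rotation number.\<close>

lemma ids_label:
  assumes V: "0 \<le> V"
    and b: "\<And>k \<phi>. k0 \<le> k \<Longrightarrow> \<bar>flift m l V E k \<phi> - \<phi>\<bar> \<le> 2 * pi"
  shows "ids E V = 1 - (of_int m * alpha + of_int l)"
proof (rule ids_eqI[OF V])
  fix \<omega>
  define \<theta> where "\<theta> = of_int m * alpha + (of_int l :: real)"
  define T where "T n = wlift V E (window \<omega> 1 n) 0" for n
  show "(\<lambda>n. wlift V E (window \<omega> 1 n) 0 / (pi * real n)) \<longlonglongrightarrow> of_int m * alpha + of_int l"
    unfolding T_def[symmetric] \<theta>_def[symmetric]
  proof (rule LIMSEQ_I)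
    fix \<epsilon> :: real assume e: "0 < \<epsilon>"
    \<comment> \<open>With blocks longer than \<open>4 / \<epsilon>\<close> the contribution
      \<open>2 / a\<close> of the blocks to the mean stays below half of
      \<open>\<epsilon>\<close>.\<close>
    obtain j :: nat where j: "4 / \<epsilon> < real j" using reals_Archimedean2 by blast
    define i where "i = k0 + j"
    define a where "a = real (length (fibw (2 * i)))"
    have "real j \<le> a" using length_fibw_ge[of "2 * i"] unfolding a_def i_def by simp
    then have a: "4 / \<epsilon> < a" using j by simp
    have a0: "0 < a" using a e by (meson less_trans divide_pos_pos zero_less_numeral)
    have "\<exists>K. \<forall>n \<phi>. \<bar>clift m l V E (window \<omega> 1 n) \<phi> - \<phi>\<bar> \<le> K + 2 * pi * n / a"
      unfolding a_def by (rule clift_window_bound[of k0]) (use b in \<open>auto simp: i_def\<close>)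
    then obtain K where K: "\<And>n \<phi>. \<bar>clift m l V E (window \<omega> 1 n) \<phi> - \<phi>\<bar> \<le> K + 2 * pi * n / a"
      by blast
    have est: "\<bar>T n - pi * n * \<theta>\<bar> \<le> (K + pi * \<bar>m\<bar>) + 2 * pi * n / a" for n
    proof -
      let ?w = "window \<omega> 1 n"
      have "of_int (wlab m l ?w) - n * \<theta> = of_int m * (real (occn ?w) - n * alpha)"
        unfolding wlab_def \<theta>_def by (simp add: algebra_simps)
      then have "\<bar>of_int (wlab m l ?w) - n * \<theta>\<bar> \<le> \<bar>real_of_int m\<bar> * 1"
        unfolding abs_mult[symmetric] using occn_window_bound[of \<omega> 1 n] by (simp only: abs_mult) (intro mult_left_mono, auto)
      then have "pi * \<bar>of_int (wlab m l ?w) - n * \<theta>\<bar> \<le> pi * \<bar>m\<bar>" by (intro mult_left_mono) auto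
      then have "\<bar>pi * of_int (wlab m l ?w) - pi * n * \<theta>\<bar> \<le> pi * \<bar>m\<bar>"
        by (simp add: abs_mult right_diff_distrib[symmetric] mult.assoc)
      moreover have "T n = clift m l V E ?w 0 + pi * of_int (wlab m l ?w)"
        unfolding T_def clift_def by simp
      ultimately show ?thesis using K[of n 0] by linarith
    qed
    define C where "C = (\<bar>K\<bar> + pi * \<bar>m\<bar>) / pi"
    obtain N :: nat where N: "2 * C / \<epsilon> < real N" using reals_Archimedean2 by blast
    show "\<exists>no. \<forall>n\<ge>no. norm (T n / (pi * real n) - \<theta>) < \<epsilon>"
    proof (intro exI[of _ "Suc N"] allI impI)
      fix n assume n: "Suc N \<le> n"
      then have n0: "0 < real n" "2 * C / \<epsilon> < real n" using N by auto
      have "T n / (pi * real n) - \<theta> = (T n - pi * n * \<theta>) / (pi * n)" using n0 by (simp add: field_simps)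
      then have "\<bar>T n / (pi * real n) - \<theta>\<bar> \<le> ((\<bar>K\<bar> + pi * \<bar>m\<bar>) + 2 * pi * n / a) / (pi * n)"
        using est[of n] n0 by (simp only: abs_divide) (simp add: divide_right_mono)
      also have "\<dots> = C / n + 2 / a" using n0 a0 unfolding C_def by (simp add: field_simps)
      also have "\<dots> < \<epsilon> / 2 + \<epsilon> / 2"
      proof (rule add_strict_mono)
        show "C / n < \<epsilon> / 2" using n0 e by (simp add: field_simps)
        show "2 / a < \<epsilon> / 2" using a a0 e by (simp add: field_simps)
      qed
      finally show "norm (T n / (pi * real n) - \<theta>) < \<epsilon>" by simp
    qed
  qed
qed

section \<open>Invariant cones open spectral gaps\<close>

text \<open>Between consecutive translates of \<open>x\<close> by \<open>pi\<close> an increasing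
  equivariant map can change its displacement by at most \<open>pi\<close>.\<close>

lemma lifts_displacement:
  assumes L: "lifts M F" "strict_mono F" and x: "\<bar>F x - x\<bar> \<le> pi"
  shows "\<bar>F \<phi> - \<phi>\<bar> \<le> 2 * pi"
proof -
  define n where "n = \<lfloor>(\<phi> - x) / pi\<rfloor>"
  have "of_int n \<le> (\<phi> - x) / pi" "(\<phi> - x) / pi < of_int n + 1" unfolding n_def by linarith+
  then have n: "x + pi * of_int n \<le> \<phi>" "\<phi> \<le> x + pi * of_int (n + 1)" by (simp_all add: field_simps)
  have "F (x + pi * of_int n) \<le> F \<phi>" "F \<phi> \<le> F (x + pi * of_int (n + 1))"
    using n by (simp_all only: strict_mono_less_eq[OF L(2)])
  then have "F x + pi * of_int n \<le> F \<phi>" "F \<phi> \<le> F x + pi * of_int n + pi"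
    unfolding lifts_shift[OF L(1)] by (simp_all add: algebra_simps)
  moreover have "x + pi * of_int n \<le> \<phi>" "\<phi> \<le> x + pi * of_int n + pi" using n by (simp_all add: algebra_simps)
  ultimately show ?thesis using x by linarith
qed

lemma trap_flift:
  assumes "trap m l V E e f (fibw k)" "trap m l V E e f (fibw (Suc k))" "k \<le> j"
  shows "trap m l V E e f (fibw j)"
proof -
  have "trap m l V E e f (fibw (k + n)) \<and> trap m l V E e f (fibw (Suc (k + n)))" for n
  proof (induction n)
    case (Suc n)
    then show ?case by (auto intro: trap_append)
  qed (use assms in simp)
  from this[of "j - k"] assms(3) show ?thesis by simp
qed

lemma trap_displacement:
  assumes "trap m l V E e f w" "e < f" "f < e + pi"
  shows "\<bar>clift m l V E w \<phi> - \<phi>\<bar> \<le> 2 * pi"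
proof (rule lifts_displacement[OF lifts_clift strict_mono_clift])
  have "clift m l V E w e < clift m l V E w f"
    using assms(2) by (simp add: strict_mono_less[OF strict_mono_clift])
  then show "\<bar>clift m l V E w e - e\<bar> \<le> pi" using assms unfolding trap_def by auto
qed

text \<open>Determinant over trace bounds the smaller eigenvalue from below. The identity used is
  Cayley-Hamilton for the symmetric matrix of the form, paired with the vector.\<close>

lemma quadratic_form_bound:
  fixes P Q R x y :: real
  assumes "0 < P" "0 < R"
  shows "(P * R - Q\<^sup>2) / (P + R) * (x\<^sup>2 + y\<^sup>2) \<le> P * x\<^sup>2 + 2 * Q * x * y + R * y\<^sup>2"
proof -
  have "0 \<le> (P * x + Q * y)\<^sup>2 + (Q * x + R * y)\<^sup>2" by simp
  also have "\<dots> = (P + R) * (P * x\<^sup>2 + 2 * Q * x * y + R * y\<^sup>2) - (P * R - Q\<^sup>2) * (x\<^sup>2 + y\<^sup>2)"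
    by (simp add: power2_eq_square algebra_simps)
  finally have "(P * R - Q\<^sup>2) * (x\<^sup>2 + y\<^sup>2) \<le> (P + R) * (P * x\<^sup>2 + 2 * Q * x * y + R * y\<^sup>2)" by simp
  then have "(P * R - Q\<^sup>2) * (x\<^sup>2 + y\<^sup>2) / (P + R) \<le> P * x\<^sup>2 + 2 * Q * x * y + R * y\<^sup>2"
    using assms by (simp add: divide_le_eq mult.commute)
  then show ?thesis by simp
qed

text \<open>The quadratic form vanishing on the boundary of the cone between \<open>e\<close> and \<open>f\<close>. It increases
  strictly along every matrix mapping the cone into its interior, so it is a Lyapunov function for the
  whole cocycle.\<close>

definition coneq :: "real \<Rightarrow> real \<Rightarrow> real \<times> real \<Rightarrow> real" where
  "coneq e f v = wedge v (dir f) * wedge (dir e) v"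

lemma sum_squares_lincomb:
  fixes X Y a b c d :: real
  shows "(X * a + Y * c)\<^sup>2 + (X * b + Y * d)\<^sup>2 =
    X\<^sup>2 * (a\<^sup>2 + b\<^sup>2) + Y\<^sup>2 * (c\<^sup>2 + d\<^sup>2) + 2 * (X * Y) * (a * c + b * d)"
  by (simp add: power2_eq_square algebra_simps)

text \<open>In the coordinates \<open>wedge v (dir f)\<close> and \<open>wedge (dir e) v\<close>,
  which are those with respect to \<open>dir e\<close> and \<open>dir f\<close> up to the factor
  \<open>k\<close>, \<open>coneq\<close> is the product of the coordinates. The matrix has positive
  entries there since it maps the cone inside itself.\<close>

lemma coneq_increase:
  assumes tr: "trap m l V E e f w" and ef: "e < f" "f < e + pi"
  shows "\<exists>\<delta>>0. \<forall>v. coneq e f v + \<delta> * (norm v)\<^sup>2 \<le> coneq e f (mapp (wmat V E w) v)"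
proof -
  let ?C = "clift m l V E w" and ?N = "cmat m l V E w"
  have s: "?C e < ?C f" using ef by (simp add: strict_mono_less[OF strict_mono_clift])
  then have b: "e < ?C e" "?C e < ?C f" "?C f < f" using tr unfolding trap_def by auto
  obtain r where r: "r > 0" "mapp ?N (dir e) = (r * cos (?C e), r * sin (?C e))"
    using liftsD(3)[OF lifts_clift] by blast
  obtain t where t: "t > 0" "mapp ?N (dir f) = (t * cos (?C f), t * sin (?C f))"
    using liftsD(3)[OF lifts_clift] by blast
  define \<alpha> \<beta> \<gamma> \<eta> k where "\<alpha> = r * sin (f - ?C e)" and "\<beta> = t * sin (f - ?C f)"
    and "\<gamma> = r * sin (?C e - e)" and "\<eta> = t * sin (?C f - e)" and "k = sin (f - e)"
  have pos: "0 < \<alpha>" "0 < \<beta>" "0 < \<gamma>" "0 < \<eta>" "0 < k"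
    unfolding \<alpha>_def \<beta>_def \<gamma>_def \<eta>_def k_def using r(1) t(1) b ef by (auto intro!: mult_pos_pos sin_gt_zero)
  have rt: "mapp ?N (dir e) = (r * cos (?C e), r * sin (?C e))" "mapp ?N (dir f) = (t * cos (?C f), t * sin (?C f))"
    using r t by auto
  obtain a b' c d where N: "?N = (a, b', c, d)" by (cases ?N)
  have det: "a * d - b' * c = 1" using mdet_cmat[of m l V E w] unfolding N by simp
  have eqs: "a * cos e + b' * sin e = r * cos (?C e)" "c * cos e + d * sin e = r * sin (?C e)"
    "a * cos f + b' * sin f = t * cos (?C f)" "c * cos f + d * sin f = t * sin (?C f)"
    using rt unfolding N by auto
  have g: "\<alpha> = (a * cos e + b' * sin e) * sin f - (c * cos e + d * sin e) * cos f"
    "\<gamma> = cos e * (c * cos e + d * sin e) - sin e * (a * cos e + b' * sin e)"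
    "\<beta> = (a * cos f + b' * sin f) * sin f - (c * cos f + d * sin f) * cos f"
    "\<eta> = cos e * (c * cos f + d * sin f) - sin e * (a * cos f + b' * sin f)"
    "k = cos e * sin f - sin e * cos f"
    unfolding \<alpha>_def \<beta>_def \<gamma>_def \<eta>_def k_def eqs by (simp_all add: sin_diff algebra_simps)
  have det2: "\<alpha> * \<eta> - \<beta> * \<gamma> = k\<^sup>2"
  proof -
    have "\<alpha> * \<eta> - \<beta> * \<gamma> = (a * d - b' * c) * k\<^sup>2" unfolding g by (simp add: power2_eq_square algebra_simps)
    then show ?thesis using det by simp
  qed
  have coord: "k * wedge (mapp ?N v) (dir f) = \<alpha> * wedge v (dir f) + \<beta> * wedge (dir e) v"
    "k * wedge (dir e) (mapp ?N v) = \<gamma> * wedge v (dir f) + \<eta> * wedge (dir e) v" for v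
    unfolding g N by (cases v; simp add: algebra_simps)+
  have len: "k\<^sup>2 * (norm v)\<^sup>2 \<le> 2 * ((wedge v (dir f))\<^sup>2 + (wedge (dir e) v)\<^sup>2)" for v
  proof -
    obtain x y where v: "v = (x, y)" by (cases v)
    define X Y where "X = wedge v (dir f)" and "Y = wedge (dir e) v"
    have k: "k * x = X * cos e + Y * cos f" "k * y = X * sin e + Y * sin f"
      unfolding X_def Y_def g(5) v by (simp_all add: algebra_simps)
    have "k\<^sup>2 * (norm v)\<^sup>2 = (k * x)\<^sup>2 + (k * y)\<^sup>2"
      unfolding v norm_Pair by (simp add: power_mult_distrib distrib_left)
    also have "\<dots> = X\<^sup>2 * ((cos e)\<^sup>2 + (sin e)\<^sup>2) + Y\<^sup>2 * ((cos f)\<^sup>2 + (sin f)\<^sup>2) + 2 * (X * Y) * (cos e * cos f + sin e * sin f)"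
      unfolding k by (rule sum_squares_lincomb)
    also have "\<dots> = X\<^sup>2 + Y\<^sup>2 + 2 * (X * Y) * cos (e - f)" by (simp add: cos_diff)
    also have "2 * (X * Y) * cos (e - f) \<le> \<bar>2 * (X * Y)\<bar> * 1"
    proof -
      have "2 * (X * Y) * cos (e - f) \<le> \<bar>2 * (X * Y)\<bar> * \<bar>cos (e - f)\<bar>"
        unfolding abs_mult[symmetric] by (rule abs_ge_self)
      also have "\<dots> \<le> \<bar>2 * (X * Y)\<bar> * 1"
        using abs_cos_le_one by (rule mult_left_mono) simp
      finally show ?thesis .
    qed
    also have "\<bar>2 * (X * Y)\<bar> * 1 \<le> X\<^sup>2 + Y\<^sup>2"
      using sum_squares_bound[of "\<bar>X\<bar>" "\<bar>Y\<bar>"] by (simp add: abs_mult)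
    finally show ?thesis unfolding X_def Y_def by simp
  qed
  \<comment> \<open>Coefficients of the gain, scaled by \<open>k\<^sup>2\<close>: the new product of
    coordinates minus the old one. The gain is positive definite because
    \<open>P * R - Q\<^sup>2\<close> equals \<open>\<beta> * \<gamma> * k\<^sup>2\<close>.\<close>
  define P Q R where "P = \<alpha> * \<gamma>" and "Q = \<beta> * \<gamma>" and "R = \<beta> * \<eta>"
  have PQR: "0 < P" "0 < R" "0 < P * R - Q\<^sup>2"
  proof -
    have "P * R - Q\<^sup>2 = \<beta> * \<gamma> * (\<alpha> * \<eta> - \<beta> * \<gamma>)"
      unfolding P_def Q_def R_def by (simp add: power2_eq_square algebra_simps)
    then show "0 < P * R - Q\<^sup>2" unfolding det2 using pos by simp
  qed (use pos in \<open>simp_all add: P_def R_def\<close>)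
  define \<kappa> where "\<kappa> = (P * R - Q\<^sup>2) / (P + R)"
  have \<kappa>: "0 < \<kappa>" unfolding \<kappa>_def using PQR by simp
  have inc: "coneq e f v + \<kappa> / 2 * (norm v)\<^sup>2 \<le> coneq e f (mapp ?N v)" for v
  proof -
    define X Y where "X = wedge v (dir f)" and "Y = wedge (dir e) v"
    have "k\<^sup>2 * coneq e f (mapp ?N v) = (k * wedge (mapp ?N v) (dir f)) * (k * wedge (dir e) (mapp ?N v))"
      unfolding coneq_def by (simp add: power2_eq_square)
    also have "\<dots> = (\<alpha> * X + \<beta> * Y) * (\<gamma> * X + \<eta> * Y)" unfolding coord X_def Y_def by simp
    also have "\<dots> = (\<alpha> * \<eta> - \<beta> * \<gamma>) * (X * Y) + (P * X\<^sup>2 + 2 * Q * X * Y + R * Y\<^sup>2)"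
      unfolding P_def Q_def R_def by (simp add: power2_eq_square algebra_simps)
    also have "\<dots> = k\<^sup>2 * coneq e f v + (P * X\<^sup>2 + 2 * Q * X * Y + R * Y\<^sup>2)"
      unfolding det2 coneq_def X_def Y_def by simp
    finally have 1: "k\<^sup>2 * coneq e f (mapp ?N v) = k\<^sup>2 * coneq e f v + (P * X\<^sup>2 + 2 * Q * X * Y + R * Y\<^sup>2)" .
    have "k\<^sup>2 * (\<kappa> / 2 * (norm v)\<^sup>2) = \<kappa> / 2 * (k\<^sup>2 * (norm v)\<^sup>2)" by simp
    also have "\<dots> \<le> \<kappa> / 2 * (2 * (X\<^sup>2 + Y\<^sup>2))"
      using len[of v] \<kappa> unfolding X_def Y_def by (intro mult_left_mono) auto
    also have "\<dots> = \<kappa> * (X\<^sup>2 + Y\<^sup>2)" by simp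
    also have "\<dots> \<le> P * X\<^sup>2 + 2 * Q * X * Y + R * Y\<^sup>2"
      unfolding \<kappa>_def by (rule quadratic_form_bound[OF PQR(1,2)])
    finally have "k\<^sup>2 * (coneq e f v + \<kappa> / 2 * (norm v)\<^sup>2) \<le> k\<^sup>2 * coneq e f (mapp ?N v)"
      unfolding 1 by (simp add: distrib_left)
    then show ?thesis using pos(5) by (simp add: mult_le_cancel_left)
  qed
  \<comment> \<open>\<open>coneq\<close> is quadratic, so the sign by which \<open>cmat\<close> may
    differ from \<open>wmat\<close> cancels.\<close>
  have "coneq e f (mapp ?N v) = coneq e f (mapp (wmat V E w) v)" for v
    unfolding cmat_def msgn_def coneq_def by (cases "wmat V E w"; cases v) (auto simp: algebra_simps)
  then show ?thesis using inc \<kappa> by (intro exI[of _ "\<kappa> / 2"]) auto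
qed

lemma lagrange_identity2:
  fixes x y c s :: real
  shows "(x * s - y * c)\<^sup>2 + (x * c + y * s)\<^sup>2 = (x\<^sup>2 + y\<^sup>2) * (c\<^sup>2 + s\<^sup>2)"
  by (simp add: power2_eq_square algebra_simps)

lemma abs_wedge_dir: "\<bar>wedge v (dir \<phi>)\<bar> \<le> norm v" "\<bar>wedge (dir \<phi>) v\<bar> \<le> norm v"
proof -
  obtain x y where v: "v = (x, y)" by (cases v)
  have "(wedge v (dir \<phi>))\<^sup>2 + (x * cos \<phi> + y * sin \<phi>)\<^sup>2 = (x\<^sup>2 + y\<^sup>2) * ((cos \<phi>)\<^sup>2 + (sin \<phi>)\<^sup>2)"
    unfolding v wedge.simps by (rule lagrange_identity2)
  also have "\<dots> = (norm v)\<^sup>2" unfolding v norm_Pair by simp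
  finally have "(wedge v (dir \<phi>))\<^sup>2 \<le> (norm v)\<^sup>2"
    using zero_le_power2[of "x * cos \<phi> + y * sin \<phi>"] by linarith
  then show 1: "\<bar>wedge v (dir \<phi>)\<bar> \<le> norm v" using abs_le_square_iff[of "wedge v (dir \<phi>)" "norm v"] by simp
  have "wedge (dir \<phi>) v = - wedge v (dir \<phi>)" unfolding v by simp
  then show "\<bar>wedge (dir \<phi>) v\<bar> \<le> norm v" using 1 by simp
qed

lemma coneq_perturb: "coneq e f v - 2 * norm v * norm r - (norm r)\<^sup>2 \<le> coneq e f (v + r)"
proof -
  have "coneq e f (v + r) = coneq e f v + wedge v (dir f) * wedge (dir e) r +
      wedge r (dir f) * wedge (dir e) v + wedge r (dir f) * wedge (dir e) r"
    unfolding coneq_def by (cases v; cases r) (simp add: algebra_simps)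
  moreover have a: "\<bar>wedge a (dir f) * wedge (dir e) b\<bar> \<le> norm a * norm b" for a b
    unfolding abs_mult by (intro mult_mono abs_wedge_dir) auto
  have "- (norm v * norm r) \<le> wedge v (dir f) * wedge (dir e) r"
    "- (norm v * norm r) \<le> wedge r (dir f) * wedge (dir e) v"
    "- (norm r)\<^sup>2 \<le> wedge r (dir f) * wedge (dir e) r"
    using a[of v r] a[of r v] a[of r r] unfolding power2_eq_square mult.commute[of "norm r" "norm v"] by linarith+
  ultimately show ?thesis by simp
qed

lemma norm_step_mat: "norm (mapp (step_mat e) v) \<le> (\<bar>e\<bar> + 2) * norm v"
proof -
  obtain x y where v: "v = (x, y)" by (cases v)
  have xy: "\<bar>x\<bar> \<le> norm v" "\<bar>y\<bar> \<le> norm v" unfolding v using norm_fst_le[of x y] norm_snd_le[of y x] by auto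
  have "norm (mapp (step_mat e) v) \<le> \<bar>e * x - y\<bar> + \<bar>x\<bar>"
    unfolding v step_mat_def using norm_Pair_le[of "e * x - y" x] by simp
  also have "\<dots> \<le> \<bar>e\<bar> * \<bar>x\<bar> + \<bar>y\<bar> + \<bar>x\<bar>"
    using abs_triangle_ineq4[of "e * x" y] by (simp add: abs_mult)
  also have "\<dots> \<le> \<bar>e\<bar> * norm v + norm v + norm v" using xy by (intro add_mono mult_left_mono) auto
  finally show ?thesis by (simp add: algebra_simps)
qed

section \<open>Real solutions with a source term along a block\<close>

definition rjac :: "real \<Rightarrow> real \<Rightarrow> real \<Rightarrow> (int \<Rightarrow> real) \<Rightarrow> int \<Rightarrow> real" where
  "rjac V \<omega> E \<psi> n = \<psi> (n + 1) + \<psi> (n - 1) + (fib_potential V \<omega> n - E) * \<psi> n"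

abbreviation site :: "(int \<Rightarrow> real) \<Rightarrow> int \<Rightarrow> real \<times> real" where "site \<psi> n \<equiv> (\<psi> n, \<psi> (n - 1))"

lemma site_step:
  "site \<psi> (n + 1) = mapp (step_mat (E - (if occ \<omega> n then V else 0))) (site \<psi> n) + (rjac V \<omega> E \<psi> n, 0)"
  by (simp add: step_mat_def rjac_def fib_potential_occ algebra_simps)

lemma mapp_add: "mapp M (v + w) = mapp M v + mapp M w"
  by (cases M; cases v; cases w) (simp add: algebra_simps)

context
  fixes V E \<kappa> :: real
  assumes \<kappa>: "\<kappa> = \<bar>E\<bar> + \<bar>V\<bar> + 2"
begin

lemma norm_step_mat_kappa: "norm (mapp (step_mat (E - (if b then V else 0))) v) \<le> \<kappa> * norm v"
proof -
  have "\<bar>E - (if b then V else 0)\<bar> + 2 \<le> \<kappa>" using \<kappa> by auto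
  then have "(\<bar>E - (if b then V else 0)\<bar> + 2) * norm v \<le> \<kappa> * norm v" by (intro mult_right_mono) auto
  then show ?thesis using norm_step_mat[of "E - (if b then V else 0)" v] by linarith
qed

lemma kappa_ge: "1 \<le> \<kappa>" using \<kappa> by simp

lemma norm_wmat: "norm (mapp (wmat V E w) v) \<le> \<kappa> ^ length w * norm v"
proof (induction w arbitrary: v)
  case (Cons b w)
  let ?s = "mapp (step_mat (E - (if b then V else 0))) v"
  have "norm (mapp (wmat V E (b # w)) v) \<le> \<kappa> ^ length w * norm ?s"
    using Cons[of ?s] by (simp only: wmat.simps mapp_mmul)
  also have "\<dots> \<le> \<kappa> ^ length w * (\<kappa> * norm v)"
    using kappa_ge by (intro mult_left_mono norm_step_mat_kappa) auto
  finally show ?case by (simp add: mult_ac)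
next
  case Nil
  then show ?case by (cases v) simp
qed

text \<open>Variation of constants: each source travels to the end of the block through at most
  \<open>L\<close> steps, each of norm at most \<open>\<kappa>\<close>.\<close>

lemma site_window:
  "norm (site \<psi> (n + int L) - mapp (wmat V E (window \<omega> n L)) (site \<psi> n)) \<le>
    \<kappa> ^ L * (\<Sum>j<L. \<bar>rjac V \<omega> E \<psi> (n + int j)\<bar>)"
proof (induction L arbitrary: n)
  case (Suc L)
  let ?g = "rjac V \<omega> E \<psi>" and ?M = "wmat V E (window \<omega> (n + 1) L)"
  let ?T = "step_mat (E - (if occ \<omega> n then V else 0))"
  have i: "n + int (Suc L) = (n + 1) + int L" by simp
  have m: "mapp (wmat V E (window \<omega> n (Suc L))) (site \<psi> n) = mapp ?M (site \<psi> (n + 1)) - mapp ?M (?g n, 0)"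
    unfolding window_Suc wmat.simps mapp_mmul site_step[of \<psi> n E \<omega> V] mapp_add by simp
  have "norm (site \<psi> (n + int (Suc L)) - mapp (wmat V E (window \<omega> n (Suc L))) (site \<psi> n)) =
      norm ((site \<psi> ((n + 1) + int L) - mapp ?M (site \<psi> (n + 1))) + mapp ?M (?g n, 0))"
    unfolding m i by (simp add: algebra_simps)
  also have "\<dots> \<le> norm (site \<psi> ((n + 1) + int L) - mapp ?M (site \<psi> (n + 1))) + norm (mapp ?M (?g n, 0))"
    by (rule norm_triangle_ineq)
  also have "\<dots> \<le> \<kappa> ^ L * (\<Sum>j<L. \<bar>?g ((n + 1) + int j)\<bar>) + \<kappa> ^ L * \<bar>?g n\<bar>"
    using Suc.IH[of "n + 1"] norm_wmat[of "window \<omega> (n + 1) L" "(?g n, 0)"] by (intro add_mono) auto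
  also have "\<dots> = \<kappa> ^ L * (\<Sum>j<Suc L. \<bar>?g (n + int j)\<bar>)"
    by (subst sum.lessThan_Suc_shift) (simp add: algebra_simps)
  also have "\<dots> \<le> \<kappa> ^ Suc L * (\<Sum>j<Suc L. \<bar>?g (n + int j)\<bar>)"
    using kappa_ge by (intro mult_right_mono power_increasing sum_nonneg) auto
  finally show ?case .
qed simp

lemma site_bound:
  assumes "j < L"
  shows "\<bar>\<psi> (n + int j)\<bar> \<le> \<kappa> ^ L * (norm (site \<psi> n) + (\<Sum>j<L. \<bar>rjac V \<omega> E \<psi> (n + int j)\<bar>))"
proof -
  let ?S = "\<lambda>j. \<Sum>j<j. \<bar>rjac V \<omega> E \<psi> (n + int j)\<bar>"
  have "\<bar>\<psi> (n + int j)\<bar> \<le> norm (site \<psi> (n + int j))"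
    using norm_fst_le[of "\<psi> (n + int j)" "\<psi> (n + int j - 1)"] by simp
  also have "\<dots> \<le> norm (site \<psi> (n + int j) - mapp (wmat V E (window \<omega> n j)) (site \<psi> n)) +
      norm (mapp (wmat V E (window \<omega> n j)) (site \<psi> n))"
    by (metis diff_add_cancel norm_triangle_ineq)
  also have "\<dots> \<le> \<kappa> ^ j * ?S j + \<kappa> ^ j * norm (site \<psi> n)"
    using site_window[of \<psi> n j \<omega>] norm_wmat[of "window \<omega> n j" "site \<psi> n"] by (intro add_mono) auto
  also have "\<dots> = \<kappa> ^ j * (norm (site \<psi> n) + ?S j)" by (simp add: algebra_simps)
  also have "\<dots> \<le> \<kappa> ^ L * (norm (site \<psi> n) + ?S L)"
    using kappa_ge assms by (intro mult_mono power_increasing add_left_mono sum_mono2 add_nonneg_nonneg sum_nonneg) auto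
  finally show ?thesis .
qed

end

text \<open>Up to its sources a sequence follows the transfer matrix of the block, so it inherits
  the increase of \<open>coneq\<close>. The increase controls the sequence on the block, and the
  sources are paid for by the constant \<open>C\<close>.\<close>

lemma block_inequality:
  assumes tr: "trap m l V E e f w" and ef: "e < f" "f < e + pi" and w: "w \<noteq> []"
  shows "\<exists>c>0. \<exists>C\<ge>0. \<forall>\<omega> n \<psi>. window \<omega> n (length w) = w \<longrightarrow>
    coneq e f (site \<psi> n) + c * (\<Sum>j<length w. (\<psi> (n + int j))\<^sup>2) \<le>
    coneq e f (site \<psi> (n + int (length w))) + C * (\<Sum>j<length w. (rjac V \<omega> E \<psi> (n + int j))\<^sup>2)"
proof -
  define \<kappa> where "\<kappa> = \<bar>E\<bar> + \<bar>V\<bar> + 2"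
  define L where "L = length w"
  define K where "K = \<kappa> ^ L"
  have K: "1 \<le> K" unfolding K_def \<kappa>_def by (intro one_le_power) auto
  have L: "1 \<le> L" using w unfolding L_def by (simp add: Suc_le_eq)
  obtain \<delta> where \<delta>: "\<delta> > 0" "\<And>v. coneq e f v + \<delta> * (norm v)\<^sup>2 \<le> coneq e f (mapp (wmat V E w) v)"
    using coneq_increase[OF tr ef] by blast
  \<comment> \<open>By \<open>pt\<close> the sum of squares over the block is at most
    \<open>2 * L * K\<^sup>2 * (u\<^sup>2 + S\<^sup>2)\<close>, so this \<open>c\<close> spends half
    of the gain \<open>\<delta> * u\<^sup>2\<close>; the other half absorbs the mixed term in
    \<open>cross\<close>.\<close>
  define c where "c = \<delta> / (4 * L * K\<^sup>2)"
  define C where "C = ((2 * K\<^sup>2 / \<delta> + 1) * K\<^sup>2 + \<delta> / 2) * L"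
  have c0: "0 < c" "0 \<le> C" unfolding c_def C_def using \<delta>(1) K L by auto
  have "coneq e f (site \<psi> n) + c * (\<Sum>j<L. (\<psi> (n + int j))\<^sup>2) \<le>
    coneq e f (site \<psi> (n + int L)) + C * (\<Sum>j<L. (rjac V \<omega> E \<psi> (n + int j))\<^sup>2)"
    if win: "window \<omega> n L = w" for \<omega> n \<psi>
  proof -
    let ?M = "wmat V E w"
    define u where "u = norm (site \<psi> n)"
    define S where "S = (\<Sum>j<L. \<bar>rjac V \<omega> E \<psi> (n + int j)\<bar>)"
    define G where "G = (\<Sum>j<L. (rjac V \<omega> E \<psi> (n + int j))\<^sup>2)"
    have S0: "0 \<le> S" "0 \<le> u" unfolding S_def u_def by (auto intro: sum_nonneg)
    have SG: "S\<^sup>2 \<le> L * G"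
      using Cauchy_Schwarz_ineq_sum[of "\<lambda>_. 1" "\<lambda>j. \<bar>rjac V \<omega> E \<psi> (n + int j)\<bar>" "{..<L}"]
      unfolding S_def G_def by simp
    define r where "r = site \<psi> (n + int L) - mapp ?M (site \<psi> n)"
    have r: "norm r \<le> K * S"
      unfolding r_def K_def S_def using site_window[OF \<kappa>_def, of \<psi> n L \<omega>] win by simp
    have Mu: "norm (mapp ?M (site \<psi> n)) \<le> K * u"
      unfolding K_def u_def L_def by (rule norm_wmat[OF \<kappa>_def])
    have cross: "2 * norm (mapp ?M (site \<psi> n)) * norm r \<le> \<delta> / 2 * u\<^sup>2 + 2 * K\<^sup>2 / \<delta> * (K * S)\<^sup>2"
    proof -
      have "norm (mapp ?M (site \<psi> n)) * norm r \<le> (K * u) * (K * S)"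
        using Mu r K S0 by (intro mult_mono) auto
      moreover have "2 * ((K * u) * (K * S)) \<le> \<delta> / 2 * u\<^sup>2 + 2 * K\<^sup>2 / \<delta> * (K * S)\<^sup>2"
      proof -
        have "0 \<le> (\<delta> * u - 2 * K * (K * S))\<^sup>2 / (2 * \<delta>)" using \<delta>(1) by simp
        also have "\<dots> = \<delta> / 2 * u\<^sup>2 + 2 * K\<^sup>2 / \<delta> * (K * S)\<^sup>2 - 2 * ((K * u) * (K * S))"
          using \<delta>(1) by (simp add: power2_eq_square field_simps)
        finally show ?thesis by simp
      qed
      ultimately show ?thesis by linarith
    qed
    have r2: "(norm r)\<^sup>2 \<le> (K * S)\<^sup>2" using r by (intro power_mono) auto
    have "coneq e f (mapp ?M (site \<psi> n)) - 2 * norm (mapp ?M (site \<psi> n)) * norm r - (norm r)\<^sup>2 \<le>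
        coneq e f (site \<psi> (n + int L))"
      using coneq_perturb[of e f "mapp ?M (site \<psi> n)" r] unfolding r_def by simp
    then have 1: "coneq e f (site \<psi> n) + \<delta> / 2 * u\<^sup>2 \<le>
        coneq e f (site \<psi> (n + int L)) + (2 * K\<^sup>2 / \<delta> * (K * S)\<^sup>2 + (K * S)\<^sup>2)"
      using \<delta>(2)[of "site \<psi> n"] cross r2 unfolding u_def by linarith
    have pt: "(\<psi> (n + int j))\<^sup>2 \<le> 2 * K\<^sup>2 * (u\<^sup>2 + S\<^sup>2)" if "j < L" for j
    proof -
      have "\<bar>\<psi> (n + int j)\<bar> \<le> K * (u + S)"
        using site_bound[OF \<kappa>_def that, of \<psi> n \<omega>] unfolding K_def u_def S_def .
      then have "(\<psi> (n + int j))\<^sup>2 \<le> (K * (u + S))\<^sup>2" using power_mono[of "\<bar>\<psi> (n + int j)\<bar>" _ 2] by fastforce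
      also have "\<dots> \<le> 2 * K\<^sup>2 * (u\<^sup>2 + S\<^sup>2)"
      proof -
        have "0 \<le> K\<^sup>2 * (u - S)\<^sup>2" by simp
        also have "\<dots> = 2 * K\<^sup>2 * (u\<^sup>2 + S\<^sup>2) - (K * (u + S))\<^sup>2"
          by (simp add: power2_eq_square algebra_simps)
        finally show ?thesis by simp
      qed
      finally show ?thesis .
    qed
    have "(\<Sum>j<L. (\<psi> (n + int j))\<^sup>2) \<le> (\<Sum>j<L. 2 * K\<^sup>2 * (u\<^sup>2 + S\<^sup>2))" by (rule sum_mono) (use pt in auto)
    also have "\<dots> = 2 * L * K\<^sup>2 * (u\<^sup>2 + S\<^sup>2)" by simp
    finally have "c * (\<Sum>j<L. (\<psi> (n + int j))\<^sup>2) \<le> c * (2 * L * K\<^sup>2 * (u\<^sup>2 + S\<^sup>2))"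
      using c0 by (intro mult_left_mono) auto
    also have "\<dots> = \<delta> / 2 * (u\<^sup>2 + S\<^sup>2)" unfolding c_def using L K by (simp add: field_simps)
    finally have 2: "c * (\<Sum>j<L. (\<psi> (n + int j))\<^sup>2) \<le> \<delta> / 2 * u\<^sup>2 + \<delta> / 2 * S\<^sup>2" by (simp add: algebra_simps)
    have "2 * K\<^sup>2 / \<delta> * (K * S)\<^sup>2 + (K * S)\<^sup>2 + \<delta> / 2 * S\<^sup>2 = ((2 * K\<^sup>2 / \<delta> + 1) * K\<^sup>2 + \<delta> / 2) * S\<^sup>2"
      by (simp add: power_mult_distrib algebra_simps)
    also have "\<dots> \<le> ((2 * K\<^sup>2 / \<delta> + 1) * K\<^sup>2 + \<delta> / 2) * (L * G)"
      using SG \<delta>(1) by (intro mult_left_mono) auto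
    also have "\<dots> = C * G" unfolding C_def by simp
    finally show ?thesis using 1 2 unfolding G_def by linarith
  qed
  then show ?thesis using c0 unfolding L_def by blast
qed

lemma sum_split_block:
  fixes h :: "int \<Rightarrow> real"
  assumes "\<And>k. T < k \<Longrightarrow> h k = 0"
  shows "(\<Sum>k\<in>{n..T}. h k) = (\<Sum>j<L. h (n + int j)) + (\<Sum>k\<in>{n + int L..T}. h k)"
proof (induction L)
  case (Suc L)
  have "(\<Sum>k\<in>{n + int L..T}. h k) = h (n + int L) + (\<Sum>k\<in>{n + int (Suc L)..T}. h k)"
  proof (cases "n + int L \<le> T")
    case True
    then have "{n + int L..T} = insert (n + int L) {n + int (Suc L)..T}" by auto
    then show ?thesis by simp
  qed (use assms in auto)
  then show ?case using Suc by simp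
qed simp

text \<open>Summed over consecutive blocks, the block inequalities telescope. Outside the support
  \<open>coneq\<close> is 0 at both ends, which leaves the sum of squares bounded by that of the
  sources.\<close>

lemma trap_bbelow:
  assumes tr: "trap m l V E e f (fibw (2 * i))" "trap m l V E e f (fibw (2 * i + 1))" and ef: "e < f" "f < e + pi"
  shows "\<exists>c>0. bbelow V \<omega> (complex_of_real E) c"
proof -
  let ?A = "fibw (2*i)" and ?B = "fibw (2*i+1)"
  have ne: "?A \<noteq> []" "?B \<noteq> []" using length_fibw_pos by blast+
  obtain c1 C1 where 1: "c1 > 0" "C1 \<ge> 0" "\<And>n \<psi>. window \<omega> n (length ?A) = ?A \<Longrightarrow>
    coneq e f (site \<psi> n) + c1 * (\<Sum>j<length ?A. (\<psi> (n + int j))\<^sup>2) \<le>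
    coneq e f (site \<psi> (n + int (length ?A))) + C1 * (\<Sum>j<length ?A. (rjac V \<omega> E \<psi> (n + int j))\<^sup>2)"
    using block_inequality[OF tr(1) ef ne(1)] by blast
  obtain c2 C2 where 2: "c2 > 0" "C2 \<ge> 0" "\<And>n \<psi>. window \<omega> n (length ?B) = ?B \<Longrightarrow>
    coneq e f (site \<psi> n) + c2 * (\<Sum>j<length ?B. (\<psi> (n + int j))\<^sup>2) \<le>
    coneq e f (site \<psi> (n + int (length ?B))) + C2 * (\<Sum>j<length ?B. (rjac V \<omega> E \<psi> (n + int j))\<^sup>2)"
    using block_inequality[OF tr(2) ef ne(2)] by blast
  \<comment> \<open>Adding 1 makes \<open>C\<close> positive, as the final constant
    \<open>c / C\<close> requires.\<close>
  define c C where "c = min c1 c2" and "C = max C1 C2 + 1"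
  have cC: "0 < c" "0 < C" "c \<le> c1" "c \<le> c2" "C1 \<le> C" "C2 \<le> C" unfolding c_def C_def using 1 2 by auto
  have block: "\<exists>L>0. pos \<omega> (n + int L) < alpha ^ (2*i) \<and> (\<forall>\<psi>.
      coneq e f (site \<psi> n) + c * (\<Sum>j<L. (\<psi> (n + int j))\<^sup>2) \<le>
      coneq e f (site \<psi> (n + int L)) + C * (\<Sum>j<L. (rjac V \<omega> E \<psi> (n + int j))\<^sup>2))"
    if n: "pos \<omega> n < alpha ^ (2*i)" for n
  proof (cases "pos \<omega> n < alpha ^ (2*i+2)")
    case True
    have it: "window \<omega> n (length ?A) = ?A" "pos \<omega> (n + int (length ?A)) = pos \<omega> n + alpha ^ (2*i+1)"
      using itinerary(1)[OF True] by auto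
    have "pos \<omega> (n + int (length ?A)) < alpha ^ (2*i)"
      unfolding it(2) using True alpha_power_Suc2[of "2*i"] by simp
    moreover have "coneq e f (site \<psi> n) + c * (\<Sum>j<length ?A. (\<psi> (n + int j))\<^sup>2) \<le>
      coneq e f (site \<psi> (n + int (length ?A))) + C * (\<Sum>j<length ?A. (rjac V \<omega> E \<psi> (n + int j))\<^sup>2)" for \<psi>
      using 1(3)[OF it(1), of \<psi>] mult_right_mono[OF cC(3), of "\<Sum>j<length ?A. (\<psi> (n + int j))\<^sup>2"]
        mult_right_mono[OF cC(5), of "\<Sum>j<length ?A. (rjac V \<omega> E \<psi> (n + int j))\<^sup>2"]
      by (simp add: sum_nonneg)
    ultimately show ?thesis using length_fibw_pos by blast
  next
    case False
    then have ge: "alpha ^ (2*i+2) \<le> pos \<omega> n" by simp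
    have it: "window \<omega> n (length ?B) = ?B" "pos \<omega> (n + int (length ?B)) = pos \<omega> n - alpha ^ (2*i+2)"
      using itinerary(2)[OF ge n] by auto
    have "pos \<omega> (n + int (length ?B)) < alpha ^ (2*i)"
      unfolding it(2) using n alpha_power_pos[of "2*i+2"] by linarith
    moreover have "coneq e f (site \<psi> n) + c * (\<Sum>j<length ?B. (\<psi> (n + int j))\<^sup>2) \<le>
      coneq e f (site \<psi> (n + int (length ?B))) + C * (\<Sum>j<length ?B. (rjac V \<omega> E \<psi> (n + int j))\<^sup>2)" for \<psi>
      using 2(3)[OF it(1), of \<psi>] mult_right_mono[OF cC(4), of "\<Sum>j<length ?B. (\<psi> (n + int j))\<^sup>2"]
        mult_right_mono[OF cC(6), of "\<Sum>j<length ?B. (rjac V \<omega> E \<psi> (n + int j))\<^sup>2"]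
      by (simp add: sum_nonneg)
    ultimately show ?thesis using length_fibw_pos by blast
  qed
  have real_bound: "c * (\<Sum>n\<in>{a..b}. (\<psi> n)\<^sup>2) \<le> C * (\<Sum>n\<in>{a-1..b+1}. (rjac V \<omega> E \<psi> n)\<^sup>2)"
    if supp: "\<And>n. n \<notin> {a..b} \<Longrightarrow> \<psi> n = 0" for a b \<psi>
  proof -
    let ?g = "rjac V \<omega> E \<psi>"
    have g0: "?g n = 0" if "n \<notin> {a-1..b+1}" for n using that by (auto simp: rjac_def supp)
    have chain: "coneq e f (site \<psi> n) + c * (\<Sum>k\<in>{n..b+1}. (\<psi> k)\<^sup>2) \<le> C * (\<Sum>k\<in>{n..b+1}. (?g k)\<^sup>2)"
      if "pos \<omega> n < alpha ^ (2*i)" for n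
      using that
    proof (induction "nat (b + 2 - n)" arbitrary: n rule: less_induct)
      case less
      show ?case
      proof (cases "b + 2 \<le> n")
        case True
        then have "\<psi> n = 0" "\<psi> (n - 1) = 0" "{n..b+1} = {}" by (auto simp: supp)
        then show ?thesis by (simp add: coneq_def)
      next
        case False
        obtain L where L: "L > 0" "pos \<omega> (n + int L) < alpha ^ (2*i)"
          "coneq e f (site \<psi> n) + c * (\<Sum>j<L. (\<psi> (n + int j))\<^sup>2) \<le>
           coneq e f (site \<psi> (n + int L)) + C * (\<Sum>j<L. (?g (n + int j))\<^sup>2)"
          using block[OF less.prems] by blast
        have "nat (b + 2 - (n + int L)) < nat (b + 2 - n)" using L(1) False by linarith
        then have ih: "coneq e f (site \<psi> (n + int L)) + c * (\<Sum>k\<in>{n + int L..b+1}. (\<psi> k)\<^sup>2) \<le>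
            C * (\<Sum>k\<in>{n + int L..b+1}. (?g k)\<^sup>2)" by (rule less.hyps[OF _ L(2)])
        have s: "(\<Sum>k\<in>{n..b+1}. (\<psi> k)\<^sup>2) = (\<Sum>j<L. (\<psi> (n + int j))\<^sup>2) + (\<Sum>k\<in>{n + int L..b+1}. (\<psi> k)\<^sup>2)"
          "(\<Sum>k\<in>{n..b+1}. (?g k)\<^sup>2) = (\<Sum>j<L. (?g (n + int j))\<^sup>2) + (\<Sum>k\<in>{n + int L..b+1}. (?g k)\<^sup>2)"
          by (rule sum_split_block; simp add: supp g0)+
        show ?thesis unfolding s distrib_left using L(3) ih by linarith
      qed
    qed
    \<comment> \<open>Starting no later than \<open>a - 1\<close> makes the first site vanish and
      still includes the leftmost source.\<close>
    obtain n where n: "n \<le> a - 1" "pos \<omega> n < alpha ^ (2*i)" using return_backward by blast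
    have "\<psi> n = 0" "\<psi> (n - 1) = 0" using n(1) by (auto simp: supp)
    then have "c * (\<Sum>k\<in>{n..b+1}. (\<psi> k)\<^sup>2) \<le> C * (\<Sum>k\<in>{n..b+1}. (?g k)\<^sup>2)"
      using chain[OF n(2)] by (simp add: coneq_def)
    moreover have "(\<Sum>k\<in>{n..b+1}. (\<psi> k)\<^sup>2) = (\<Sum>k\<in>{a..b}. (\<psi> k)\<^sup>2)"
      by (rule sum.mono_neutral_right) (use n(1) supp in auto)
    moreover have "(\<Sum>k\<in>{n..b+1}. (?g k)\<^sup>2) = (\<Sum>k\<in>{a-1..b+1}. (?g k)\<^sup>2)"
      by (rule sum.mono_neutral_right) (use n(1) g0 in auto)
    ultimately show ?thesis by simp
  qed
  have "bbelow V \<omega> (complex_of_real E) (c / C)"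
    unfolding bbelow_def
  proof (intro allI impI)
    fix a b :: int and \<psi> :: "int \<Rightarrow> complex" assume supp: "\<forall>n. n \<notin> {a..b} \<longrightarrow> \<psi> n = 0"
    let ?j = "jac (fq V \<omega> (complex_of_real E)) \<psi>"
    have parts: "Re (?j n) = rjac V \<omega> E (\<lambda>n. Re (\<psi> n)) n" "Im (?j n) = rjac V \<omega> E (\<lambda>n. Im (\<psi> n)) n" for n
      by (simp_all add: jac_def rjac_def)
    have "c * (\<Sum>n\<in>{a..b}. (Re (\<psi> n))\<^sup>2) + c * (\<Sum>n\<in>{a..b}. (Im (\<psi> n))\<^sup>2) \<le>
       C * (\<Sum>n\<in>{a-1..b+1}. (Re (?j n))\<^sup>2) + C * (\<Sum>n\<in>{a-1..b+1}. (Im (?j n))\<^sup>2)"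
      unfolding parts by (intro add_mono real_bound) (use supp in auto)
    then have "c * (\<Sum>n\<in>{a..b}. (cmod (\<psi> n))\<^sup>2) \<le> C * (\<Sum>n\<in>{a-1..b+1}. (cmod (?j n))\<^sup>2)"
      unfolding cmod_power2 sum.distrib distrib_left .
    then show "c / C * (\<Sum>n\<in>{a..b}. (cmod (\<psi> n))\<^sup>2) \<le> (\<Sum>n\<in>{a-1..b+1}. (cmod (?j n))\<^sup>2)"
      using cC(2) by (simp add: divide_le_eq mult.commute)
  qed
  then show ?thesis using cC by (intro exI[of _ "c / C"]) simp
qed

lemma trap_gap:
  assumes V: "0 \<le> V" and tr: "trap m l V E e f (fibw k)" "trap m l V E e f (fibw (Suc k))"
    and ef: "e < f" "f < e + pi"
  shows "complex_of_real E \<notin> Sigma_V V" "ids E V = 1 - (of_int m * alpha + of_int l)"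
proof -
  have all: "trap m l V E e f (fibw j)" if "k \<le> j" for j by (rule trap_flift[OF tr that])
  show "complex_of_real E \<notin> Sigma_V V"
    unfolding Sigma_V_iff[where \<omega> = 0] by (rule trap_bbelow[of m l V E e f k]) (use all ef in auto)
  show "ids E V = 1 - (of_int m * alpha + of_int l)"
    by (rule ids_label[OF V, of k]) (use trap_displacement[OF all ef] in auto)
qed

section \<open>Gap labelling\<close>

text \<open>A Green's function is square summable and solves the homogeneous equation to the right
  of its source, so it continues to a decaying solution unless it vanishes there. Two neighbouring
  sources cannot both fail in this way.\<close>

lemma jac_decaying_right:
  assumes p: "p \<in> ell2" "\<And>n. jac q p n = (if n = 0 then 1 else 0)"
    and r: "r \<in> ell2" "\<And>n. jac q r n = (if n = 1 then 1 else 0)"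
  shows "\<exists>u. (\<forall>n. jac q u n = 0) \<and> (\<exists>n. u n \<noteq> 0) \<and> (\<forall>\<epsilon>>0. \<exists>N. \<forall>n>int N. cmod (u n) < \<epsilon>)"
proof -
  have ext: ?thesis if f: "f \<in> ell2" "\<And>n. s < n \<Longrightarrow> jac q f n = 0" "f s \<noteq> 0 \<or> f (s + 1) \<noteq> 0" for f s
  proof -
    obtain u where u: "u s = f s" "u (s + 1) = f (s + 1)" "\<And>n. jac q u n = 0"
      using jac_solution[of s "f s" "f (s + 1)" q "\<lambda>_. 0"] by auto
    have eq: "u n = f n" if "s \<le> n" for n
    proof -
      have "jac q (\<lambda>n. (-1) * f n + u n) (n + 1) = 0" if "s \<le> n" for n
        unfolding jac_lincomb using u(3) f(2)[of "n + 1"] that by simp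
      then have "(\<lambda>n. (-1) * f n + u n) n = 0"
        by (rule jac_zero_forward[of s]) (use u that in auto)
      then show ?thesis by simp
    qed
    have "\<exists>N. \<forall>n>int N. cmod (u n) < \<epsilon>" if "0 < \<epsilon>" for \<epsilon>
    proof -
      obtain N where N: "\<And>n. int N < \<bar>n\<bar> \<Longrightarrow> (cmod (f n))\<^sup>2 < \<epsilon>\<^sup>2"
        using ell2_small[OF f(1), of "\<epsilon>\<^sup>2"] \<open>0 < \<epsilon>\<close> by auto
      have "cmod (u n) < \<epsilon>" if "int (N + nat \<bar>s\<bar>) < n" for n
      proof -
        have "(cmod (f n))\<^sup>2 < \<epsilon>\<^sup>2" "u n = f n" using that by (intro N eq; simp)+
        then show ?thesis using \<open>0 < \<epsilon>\<close> by (simp add: power_less_imp_less_base)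
      qed
      then show ?thesis by blast
    qed
    moreover have "\<exists>n. u n \<noteq> 0" using f(3) u(1,2) by metis
    ultimately show ?thesis using u(3) by blast
  qed
  show ?thesis
  proof (cases "(p 0 \<noteq> 0 \<or> p (0 + 1) \<noteq> 0) \<or> (r 1 \<noteq> 0 \<or> r (1 + 1) \<noteq> 0)")
    case True
    then show ?thesis
    proof
      assume "p 0 \<noteq> 0 \<or> p (0 + 1) \<noteq> 0"
      then show ?thesis by (rule ext[OF p(1), rotated]) (simp add: p(2))
    next
      assume "r 1 \<noteq> 0 \<or> r (1 + 1) \<noteq> 0"
      then show ?thesis by (rule ext[OF r(1), rotated]) (simp add: r(2))
    qed
  next
    case False
    \<comment> \<open>If both vanish to the right, their Wronskian has modulus 1 at the origin. To
      the left it is constant, yet it tends to 0 because both sequences are square summable.\<close>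
    then have z: "p 0 = 0" "p 1 = 0" "r 1 = 0" "r 2 = 0" by auto
    have p1: "p (-1) = 1" using p(2)[of 0] z by (simp add: jac_def)
    have r0: "r 0 = 1" using r(2)[of 1] z by (simp add: jac_def)
    obtain N where N: "\<And>n. int N < \<bar>n\<bar> \<Longrightarrow> (cmod (p n))\<^sup>2 < (1/2)\<^sup>2"
      using ell2_small[OF p(1), of "(1/2)\<^sup>2"] by auto
    obtain M where M: "\<And>n. int M < \<bar>n\<bar> \<Longrightarrow> (cmod (r n))\<^sup>2 < (1/2)\<^sup>2"
      using ell2_small[OF r(1), of "(1/2)\<^sup>2"] by auto
    define k where "k = N + M"
    define a where "a = - int k - 1"
    have small: "cmod (p n) < 1/2" "cmod (r n) < 1/2" if "n \<le> a" for n
      using N[of n] M[of n] that power2_less_imp_less[of _ "1/2 :: real"] unfolding a_def k_def by force+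
    have "(\<Sum>n\<in>{a..a + int k}. r n * jac q p n - p n * jac q r n) = 0"
      by (rule sum.neutral) (auto simp: p(2) r(2) a_def)
    moreover have "a + int k = -1" unfolding a_def by simp
    ultimately have "1 = - (r (a - 1) * p a - r a * p (a - 1))"
      using jac_green[where a = a and k = k and h = r and q = q and \<zeta> = p] p1 r0 z by (simp add: algebra_simps)
    then have "1 = cmod (r (a - 1) * p a - r a * p (a - 1))" by (metis norm_minus_cancel norm_one)
    also have "\<dots> \<le> cmod (r (a - 1)) * cmod (p a) + cmod (r a) * cmod (p (a - 1))"
      by (rule order_trans[OF norm_triangle_ineq4]) (simp add: norm_mult)
    also have "\<dots> < 1/2 * 1 + 1/2 * 1"
      using small[of a] small[of "a - 1"]
      by (intro add_strict_mono mult_strict_mono) (auto intro: less_trans)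
    finally show ?thesis by simp
  qed
qed

text \<open>For real \<open>E\<close> the real and imaginary parts of a solution are solutions, and
  one of them is nontrivial. The left half-line is reflected to the right one, which turns sources
  at 0 and -1 into sources at 0 and 1.\<close>

lemma real_decaying:
  assumes E: "complex_of_real E \<notin> Sigma_V V"
  shows "\<exists>\<psi>. (\<forall>n. rjac V \<omega> E \<psi> n = 0) \<and> site \<psi> 0 \<noteq> (0, 0) \<and> (\<forall>\<epsilon>>0. \<exists>N. \<forall>n>int N. \<bar>\<psi> n\<bar> < \<epsilon>)"
    and "\<exists>\<psi>. (\<forall>n. rjac V \<omega> E \<psi> n = 0) \<and> site \<psi> 0 \<noteq> (0, 0) \<and> (\<forall>\<epsilon>>0. \<exists>N. \<forall>n < - int N. \<bar>\<psi> n\<bar> < \<epsilon>)"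
proof -
  let ?q = "fq V \<omega> (complex_of_real E)"
  obtain c where c: "c > 0" "bbelow V \<omega> (complex_of_real E) c" using E Sigma_V_iff by blast
  have green: "\<exists>p. p \<in> ell2 \<and> (\<forall>n. jac ?q p n = (if n = s then 1 else 0))" for s
  proof -
    have "(\<lambda>n. if n = s then 1 else 0) \<in> ell2" by (rule ell2_finite_support[of s s]) auto
    from jac_surjective[OF c(2,1) this] show ?thesis by blast
  qed
  have split: "\<exists>\<psi>. (\<forall>n. rjac V \<omega> E \<psi> n = 0) \<and> site \<psi> 0 \<noteq> (0, 0) \<and> (\<forall>\<epsilon>>0. \<exists>N. \<forall>n. Q N n \<longrightarrow> \<bar>\<psi> n\<bar> < \<epsilon>)"
    if u: "\<And>n. jac ?q u n = 0" "u k \<noteq> 0" "\<And>\<epsilon>. \<epsilon> > 0 \<Longrightarrow> \<exists>N. \<forall>n. Q N n \<longrightarrow> cmod (u n) < \<epsilon>"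
    for u k and Q :: "nat \<Rightarrow> int \<Rightarrow> bool"
  proof -
    have "u 0 \<noteq> 0 \<or> u (-1) \<noteq> 0"
    proof (rule ccontr)
      assume "\<not> (u 0 \<noteq> 0 \<or> u (-1) \<noteq> 0)"
      moreover have "jac ?q (\<lambda>_. 0) n = 0" for n by (simp add: jac_def)
      ultimately have "u k = (\<lambda>_. 0) k"
        using jac_unique[of ?q u "\<lambda>_. 0" "-1" k] u(1) by simp
      then show False using u(2) by simp
    qed
    then have "site (\<lambda>n. Re (u n)) 0 \<noteq> (0, 0) \<or> site (\<lambda>n. Im (u n)) 0 \<noteq> (0, 0)"
      by (auto simp: complex_eq_iff)
    moreover have "rjac V \<omega> E (\<lambda>n. Re (u n)) n = 0" "rjac V \<omega> E (\<lambda>n. Im (u n)) n = 0" for n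
      using arg_cong[OF u(1)[of n], of Re] arg_cong[OF u(1)[of n], of Im] by (simp_all add: jac_def rjac_def)
    moreover have "\<forall>\<epsilon>>0. \<exists>N. \<forall>n. Q N n \<longrightarrow> \<bar>Re (u n)\<bar> < \<epsilon>" "\<forall>\<epsilon>>0. \<exists>N. \<forall>n. Q N n \<longrightarrow> \<bar>Im (u n)\<bar> < \<epsilon>"
      using u(3) abs_Re_le_cmod abs_Im_le_cmod by (meson le_less_trans)+
    ultimately show ?thesis by blast
  qed
  obtain p where p: "p \<in> ell2" "\<And>n. jac ?q p n = (if n = 0 then 1 else 0)" using green[of 0] by blast
  obtain r where r: "r \<in> ell2" "\<And>n. jac ?q r n = (if n = 1 then 1 else 0)" using green[of 1] by blast
  obtain t where t: "t \<in> ell2" "\<And>n. jac ?q t n = (if n = -1 then 1 else 0)" using green[of "-1"] by blast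
  obtain u where u: "\<And>n. jac ?q u n = 0" "\<exists>n. u n \<noteq> 0" "\<And>\<epsilon>. \<epsilon> > 0 \<Longrightarrow> \<exists>N. \<forall>n>int N. cmod (u n) < \<epsilon>"
    using jac_decaying_right[OF p r] by blast
  show "\<exists>\<psi>. (\<forall>n. rjac V \<omega> E \<psi> n = 0) \<and> site \<psi> 0 \<noteq> (0, 0) \<and> (\<forall>\<epsilon>>0. \<exists>N. \<forall>n>int N. \<bar>\<psi> n\<bar> < \<epsilon>)"
    using u(2) split[of u _ "\<lambda>N n. int N < n"] u(1,3) by blast
  have refl: "jac (\<lambda>n. ?q (- n)) (\<lambda>n. f (- n)) n = jac ?q f (- n)" for f n
  proof -
    have "- (n + 1) = - n - 1" "- (n - 1) = - n + 1" by simp_all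
    then show ?thesis unfolding jac_def by (simp only: add.commute[of "f (- n - 1)"])
  qed
  have ell2_refl: "(\<lambda>n. f (- n)) \<in> ell2" if "f \<in> ell2" for f
    using summable_on_reindex_bij_betw[OF bij_uminus, of "\<lambda>n. (cmod (f n))\<^sup>2"] that
    by (simp add: ell2_def)
  have "\<exists>u. (\<forall>n. jac (\<lambda>n. ?q (- n)) u n = 0) \<and> (\<exists>n. u n \<noteq> 0) \<and> (\<forall>\<epsilon>>0. \<exists>N. \<forall>n>int N. cmod (u n) < \<epsilon>)"
    by (rule jac_decaying_right[of "\<lambda>n. p (- n)" _ "\<lambda>n. t (- n)"])
      (simp_all only: refl p t ell2_refl, auto)
  then obtain v where v: "\<And>n. jac (\<lambda>n. ?q (- n)) v n = 0" "\<exists>n. v n \<noteq> 0" "\<And>\<epsilon>. \<epsilon> > 0 \<Longrightarrow> \<exists>N. \<forall>n>int N. cmod (v n) < \<epsilon>"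
    by blast
  define w where "w n = v (- n)" for n
  have "jac ?q w n = 0" for n using refl[of w "- n"] v(1)[of "- n"] by (simp add: w_def)
  moreover obtain k where "w k \<noteq> 0" using v(2) unfolding w_def by (metis minus_minus)
  moreover have "\<exists>N. \<forall>n < - int N. cmod (w n) < \<epsilon>" if eps: "\<epsilon> > 0" for \<epsilon>
  proof -
    obtain N where N: "\<And>n. int N < n \<Longrightarrow> cmod (v n) < \<epsilon>" using v(3)[OF eps] by blast
    have "cmod (w n) < \<epsilon>" if "n < - int N" for n unfolding w_def by (rule N) (use that in simp)
    then show ?thesis by blast
  qed
  ultimately show "\<exists>\<psi>. (\<forall>n. rjac V \<omega> E \<psi> n = 0) \<and> site \<psi> 0 \<noteq> (0, 0) \<and> (\<forall>\<epsilon>>0. \<exists>N. \<forall>n < - int N. \<bar>\<psi> n\<bar> < \<epsilon>)"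
    using split[of w k "\<lambda>N n. n < - int N"] by blast
qed

section \<open>Gordon's argument: traces at energies outside the spectrum\<close>

lemma site_window_exact:
  assumes "\<And>n. rjac V \<omega> E \<psi> n = 0"
  shows "site \<psi> (n + int L) = mapp (wmat V E (window \<omega> n L)) (site \<psi> n)"
  using site_window[OF refl, of \<psi> n L V E \<omega>] by (simp add: assms)

lemma cayley_hamilton:
  assumes "mdet M = 1"
  shows "v = mtr M *\<^sub>R mapp M v - mapp M (mapp M v)" "mapp M (mapp M v) = mtr M *\<^sub>R mapp M v - v"
proof -
  obtain a b c d where M: "M = (a, b, c, d)" by (cases M)
  obtain x y where v: "v = (x, y)" by (cases v)
  have "a * d = 1 + b * c" using assms M by simp
  then have "x * (a * d) = x + x * (b * c)" "y * (a * d) = y + y * (b * c)" by (simp_all add: algebra_simps)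
  then show "mapp M (mapp M v) = mtr M *\<^sub>R mapp M v - v"
    unfolding M v by (simp add: algebra_simps)
  then show "v = mtr M *\<^sub>R mapp M v - mapp M (mapp M v)" by simp
qed

lemma eigen_trace:
  assumes d: "mdet M = 1" and ev: "mapp M v = \<mu> *\<^sub>R v" and v: "v \<noteq> 0"
  shows "mtr M * \<mu> = 1 + \<mu> * \<mu>"
proof -
  have sc: "mapp M (\<mu> *\<^sub>R v) = \<mu> *\<^sub>R mapp M v"
    by (cases M; cases v) (simp add: algebra_simps)
  have "v = (mtr M * \<mu> - \<mu> * \<mu>) *\<^sub>R v"
    using cayley_hamilton(1)[OF d, of v] unfolding ev sc scaleR_scaleR scaleR_diff_left .
  then have "(mtr M * \<mu> - \<mu> * \<mu> - 1) *\<^sub>R v = 0"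
    by (simp only: scaleR_diff_left) simp
  then show ?thesis using v unfolding scaleR_eq_0_iff by linarith
qed

lemma dir_nonzero: "dir \<phi> \<noteq> 0"
proof -
  have "norm (dir \<phi>) = 1" unfolding norm_Pair by simp
  then show ?thesis by (metis norm_zero zero_neq_one)
qed

lemma norm_site_small:
  assumes "\<bar>\<psi> n\<bar> < \<epsilon>" "\<bar>\<psi> (n - 1)\<bar> < \<epsilon>" shows "norm (site \<psi> n) < 2 * \<epsilon>"
  using assms norm_Pair_le[of "\<psi> n" "\<psi> (n - 1)"] by simp

text \<open>Gordon's two-block argument: along a repeated block with bounded trace no solution decays.
  Seen from the phase \<open>0\<close>, the even Fibonacci words are repeated on the right of the origin and
  the odd ones on its left.\<close>

lemma gordon_even:
  assumes E: "complex_of_real E \<notin> Sigma_V V"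
  shows "\<exists>i0. \<forall>i\<ge>i0. 2 < \<bar>mtr (wmat V E (fibw (2 * i)))\<bar>"
proof -
  obtain \<psi> where \<psi>: "\<And>n. rjac V 0 E \<psi> n = 0" "site \<psi> 0 \<noteq> (0, 0)" "\<And>\<epsilon>. \<epsilon> > 0 \<Longrightarrow> \<exists>N. \<forall>n>int N. \<bar>\<psi> n\<bar> < \<epsilon>"
    using real_decaying(1)[OF E, of 0] by blast
  have pos: "0 < norm (site \<psi> 0)" using \<psi>(2) by (simp add: zero_prod_def)
  \<comment> \<open>A sixth: the initial norm is at most two plus one later site norms, each below
    twice the bound on the entries.\<close>
  obtain N where N: "\<And>n. int N < n \<Longrightarrow> \<bar>\<psi> n\<bar> < norm (site \<psi> 0) / 6"
    using \<psi>(3)[of "norm (site \<psi> 0) / 6"] pos by auto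
  have "2 < \<bar>mtr (wmat V E (fibw (2 * Suc i)))\<bar>" if i: "N + 2 \<le> i" for i
  proof (rule ccontr)
    let ?A = "fibw (2 * Suc i)"
    let ?M = "wmat V E ?A"
    assume "\<not> 2 < \<bar>mtr ?M\<bar>"
    then have t: "\<bar>mtr ?M\<bar> \<le> 2" by simp
    have p0: "pos 0 0 = 0" by (simp add: pos_def)
    have a: "alpha ^ (2 * i) = alpha ^ (2*i+1) + alpha ^ (2*i+2)" "alpha ^ (2*i+3) < alpha ^ (2*i+2)"
      "alpha ^ (2*i+2) < alpha ^ (2*i+1)" "0 < alpha ^ (2*i+3)"
      using alpha_power_Suc2[of "2*i"] alpha_power_Suc_less[of "2*i+2"] alpha_power_Suc_less[of "2*i+1"]
        alpha_power_pos[of "2*i+3"] by (simp_all add: eval_nat_numeral)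
    have "window 0 0 (length ?A) = ?A \<and> pos 0 (0 + int (length ?A)) = pos 0 0 + alpha ^ (2 * Suc i + 1)"
      by (rule itinerary(1)) (simp add: p0 alpha_bounds)
    then have w1: "window 0 0 (length ?A) = ?A" and p1: "pos 0 (int (length ?A)) = alpha ^ (2*i+3)"
      using p0 by (simp_all add: eval_nat_numeral)
    \<comment> \<open>The second copy is invisible at level \<open>Suc i\<close>, where the position
      \<open>alpha ^ (2 * i + 3)\<close> belongs to the odd word. One level lower it is read as an
      even word followed by an odd one.\<close>
    have s1: "window 0 (int (length ?A)) (length (fibw (2*i))) = fibw (2*i) \<and>
        pos 0 (int (length ?A) + int (length (fibw (2*i)))) = pos 0 (int (length ?A)) + alpha ^ (2*i+1)"
      by (rule itinerary(1)) (use p1 a in linarith)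
    have s2: "window 0 (int (length ?A) + int (length (fibw (2*i)))) (length (fibw (2*i+1))) = fibw (2*i+1) \<and>
        pos 0 (int (length ?A) + int (length (fibw (2*i))) + int (length (fibw (2*i+1)))) =
        pos 0 (int (length ?A) + int (length (fibw (2*i)))) - alpha ^ (2*i+2)"
      by (rule itinerary(2)) (use p1 s1 a in linarith)+
    have "?A = fibw (2*i) @ fibw (2*i+1)" by simp
    then have w2: "window 0 (int (length ?A)) (length ?A) = ?A"
      using s1 s2 by (simp only: length_append window_add)
    let ?L = "length ?A"
    have L: "N + 2 \<le> ?L" 
      by (rule order_trans[OF _ length_fibw_ge[of "2 * Suc i"]]) (use i in simp)
    have 1: "site \<psi> (int ?L) = mapp ?M (site \<psi> 0)" using site_window_exact[OF \<psi>(1), of 0 ?L] w1 by simp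
    have 2: "site \<psi> (int ?L + int ?L) = mapp ?M (site \<psi> (int ?L))"
      using site_window_exact[OF \<psi>(1), of "int ?L" ?L] w2 by simp
    have "site \<psi> 0 = mtr ?M *\<^sub>R site \<psi> (int ?L) - site \<psi> (int ?L + int ?L)"
      unfolding 2 unfolding 1 by (rule cayley_hamilton(1)) simp
    then have "norm (site \<psi> 0) \<le> \<bar>mtr ?M\<bar> * norm (site \<psi> (int ?L)) + norm (site \<psi> (int ?L + int ?L))"
      by (metis norm_scaleR norm_triangle_ineq4)
    also have "\<dots> \<le> 2 * norm (site \<psi> (int ?L)) + norm (site \<psi> (int ?L + int ?L))"
      using t by (intro add_right_mono mult_right_mono) auto
    also have "\<dots> < 2 * (2 * (norm (site \<psi> 0) / 6)) + 2 * (norm (site \<psi> 0) / 6)"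
      using L by (intro add_strict_mono mult_strict_left_mono norm_site_small N) auto
    finally show False by simp
  qed
  then have "\<forall>i\<ge>N + 3. 2 < \<bar>mtr (wmat V E (fibw (2 * i)))\<bar>"
    by (metis Suc_le_D Suc_le_mono add_Suc_right numeral_3_eq_3 numeral_2_eq_2)
  then show ?thesis by blast
qed

lemma gordon_odd:
  assumes E: "complex_of_real E \<notin> Sigma_V V"
  shows "\<exists>i0. \<forall>i\<ge>i0. 2 < \<bar>mtr (wmat V E (fibw (2 * i + 1)))\<bar>"
proof -
  obtain \<psi> where \<psi>: "\<And>n. rjac V 0 E \<psi> n = 0" "site \<psi> 0 \<noteq> (0, 0)" "\<And>\<epsilon>. \<epsilon> > 0 \<Longrightarrow> \<exists>N. \<forall>n < - int N. \<bar>\<psi> n\<bar> < \<epsilon>"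
    using real_decaying(2)[OF E, of 0] by blast
  have pos: "0 < norm (site \<psi> 0)" using \<psi>(2) by (simp add: zero_prod_def)
  obtain N where N: "\<And>n. n < - int N \<Longrightarrow> \<bar>\<psi> n\<bar> < norm (site \<psi> 0) / 6"
    using \<psi>(3)[of "norm (site \<psi> 0) / 6"] pos by auto
  have "2 < \<bar>mtr (wmat V E (fibw (2 * i + 1)))\<bar>" if i: "N + 2 \<le> i" for i
  proof (rule ccontr)
    let ?B = "fibw (2 * i + 1)"
    let ?M = "wmat V E ?B" and ?L = "length ?B" and ?a = "alpha ^ (2*i+2)"
    assume "\<not> 2 < \<bar>mtr ?M\<bar>"
    then have t: "\<bar>mtr ?M\<bar> \<le> 2" by simp
    have a: "2 * ?a < alpha ^ (2*i)" "alpha ^ (2*i) \<le> 1" "0 < ?a"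
      using alpha_power_Suc2[of "2*i"] alpha_power_Suc_less[of "2*i+1"] power_le_one[of alpha "2*i"] alpha_bounds
        alpha_power_pos[of "2*i+2"] by (simp_all add: eval_nat_numeral)
    have a1: "0 \<le> ?a" "?a < 1" "0 \<le> 2 * ?a" "2 * ?a < 1" using a by linarith+
    have rot: "real ?L * alpha = occn ?B - ?a" using fibw_rotation[of i] by blast
    \<comment> \<open>Going back over one and two odd words leads to the positions \<open>?a\<close>
      and \<open>2 * ?a\<close>, both in the interval from which \<open>itinerary\<close> reads the
      odd word.\<close>
    have p1: "pos 0 (- int ?L) = ?a"
      by (rule pos_unique[where k = "- int (occn ?B)"]) (use a1 rot in \<open>simp_all del: power_Suc add_2_eq_Suc'\<close>)
    have p2: "pos 0 (- int ?L - int ?L) = 2 * ?a"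
      by (rule pos_unique[where k = "- 2 * int (occn ?B)"]) (use a1 rot in \<open>simp_all del: power_Suc add_2_eq_Suc' add: algebra_simps\<close>)
    have "window 0 (- int ?L) ?L = ?B \<and> pos 0 (- int ?L + int ?L) = pos 0 (- int ?L) - ?a"
      by (rule itinerary(2)) (use p1 a in linarith)+
    then have w1: "window 0 (- int ?L) ?L = ?B" by blast
    have "window 0 (- int ?L - int ?L) ?L = ?B \<and> pos 0 (- int ?L - int ?L + int ?L) = pos 0 (- int ?L - int ?L) - ?a"
      by (rule itinerary(2)) (use p2 a in linarith)+
    then have w2: "window 0 (- int ?L - int ?L) ?L = ?B" by blast
    have L: "N + 2 \<le> ?L" using length_fibw_ge[of "2 * i + 1"] i by linarith
    have 1: "site \<psi> 0 = mapp ?M (site \<psi> (- int ?L))"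
      using site_window_exact[OF \<psi>(1), of "- int ?L" ?L] w1 by simp
    have 2: "site \<psi> (- int ?L) = mapp ?M (site \<psi> (- int ?L - int ?L))"
      using site_window_exact[OF \<psi>(1), of "- int ?L - int ?L" ?L] w2 by simp
    have "site \<psi> 0 = mtr ?M *\<^sub>R site \<psi> (- int ?L) - site \<psi> (- int ?L - int ?L)"
      unfolding 1 unfolding 2 by (rule cayley_hamilton(2)) simp
    then have "norm (site \<psi> 0) \<le> \<bar>mtr ?M\<bar> * norm (site \<psi> (- int ?L)) + norm (site \<psi> (- int ?L - int ?L))"
      by (metis norm_scaleR norm_triangle_ineq4)
    also have "\<dots> \<le> 2 * norm (site \<psi> (- int ?L)) + norm (site \<psi> (- int ?L - int ?L))"
      using t by (intro add_right_mono mult_right_mono) auto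
    also have "\<dots> < 2 * (2 * (norm (site \<psi> 0) / 6)) + 2 * (norm (site \<psi> 0) / 6)"
      using L by (intro add_strict_mono mult_strict_left_mono norm_site_small N) auto
    finally show False by simp
  qed
  then show ?thesis by blast
qed

lemma traces_escape:
  assumes "complex_of_real E \<notin> Sigma_V V"
  shows "\<exists>k0. \<forall>k\<ge>k0. 2 < \<bar>mtr (wmat V E (fibw k))\<bar>"
proof -
  obtain i0 i1 where i: "\<And>i. i0 \<le> i \<Longrightarrow> 2 < \<bar>mtr (wmat V E (fibw (2 * i)))\<bar>"
    "\<And>i. i1 \<le> i \<Longrightarrow> 2 < \<bar>mtr (wmat V E (fibw (2 * i + 1)))\<bar>"
    using gordon_even[OF assms] gordon_odd[OF assms] by blast
  have "2 < \<bar>mtr (wmat V E (fibw k))\<bar>" if "2 * (i0 + i1) + 1 \<le> k" for k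
  proof (cases "even k")
    case True
    then obtain j where "k = 2 * j" by (elim evenE)
    then show ?thesis using i(1)[of j] that by auto
  next
    case False
    then obtain j where "k = 2 * j + 1" by (elim oddE)
    then show ?thesis using i(2)[of j] that by auto
  qed
  then show ?thesis by blast
qed

text \<open>A trace beyond 2 in modulus gives a real eigenvector, so some direction turns by an
  integer number of half turns. This number is even exactly for positive eigenvalues, whose sign is
  that of the trace.\<close>

lemma hyperbolic_fixed_direction:
  assumes L: "lifts M F" and d: "mdet M = 1" and t: "2 < \<bar>mtr M\<bar>"
  shows "\<exists>\<phi> p. F \<phi> = \<phi> + pi * of_int p \<and> (even p \<longleftrightarrow> 0 < mtr M)"
proof -
  obtain a b c d' where M: "M = (a, b, c, d')" by (cases M)
  have det: "a * d' - b * c = 1" using d M by simp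
  have "\<exists>x y. (x, y) \<noteq> (0, 0) \<and> wedge (x, y) (mapp M (x, y)) = 0"
  proof (cases "c = 0")
    case True
    then show ?thesis unfolding M by (intro exI[of _ 1] exI[of _ 0]) simp
  next
    case False
    \<comment> \<open>Slopes of eigenvectors are roots of a quadratic with discriminant
      \<open>(mtr M)\<^sup>2 - 4\<close>.\<close>
    define D where "D = (d' - a)\<^sup>2 + 4 * b * c"
    have "D = (mtr M)\<^sup>2 - 4" using det unfolding D_def M by (simp add: power2_eq_square algebra_simps)
    moreover have "2\<^sup>2 < \<bar>mtr M\<bar>\<^sup>2" by (rule power_strict_mono) (use t in auto)
    ultimately have D: "0 < D" by simp
    define x where "x = (a - d' + sqrt D) / (2 * c)"
    have "(2 * c * x - (a - d'))\<^sup>2 = D" unfolding x_def using False D by simp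
    then have "4 * c * (c * x\<^sup>2 + (d' - a) * x - b) = 0" unfolding D_def by (simp add: power2_eq_square algebra_simps)
    then have "c * x\<^sup>2 + (d' - a) * x - b = 0" using False by simp
    then have "wedge (x, 1) (mapp M (x, 1)) = 0" unfolding M by (simp add: power2_eq_square algebra_simps)
    then show ?thesis by (intro exI[of _ x] exI[of _ 1]) simp
  qed
  then obtain x y where xy: "(x, y) \<noteq> (0, 0)" "wedge (x, y) (mapp M (x, y)) = 0" by blast
  obtain \<rho> \<phi> where pol: "x = \<rho> * cos \<phi>" "y = \<rho> * sin \<phi>" using polar_Ex by blast
  then have \<rho>: "\<rho> \<noteq> 0" using xy(1) by auto
  have "wedge (x, y) (mapp M (x, y)) = \<rho>\<^sup>2 * wedge (dir \<phi>) (mapp M (dir \<phi>))"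
    unfolding M pol by (simp add: power2_eq_square algebra_simps)
  then have w0: "wedge (dir \<phi>) (mapp M (dir \<phi>)) = 0" using xy(2) \<rho> by simp
  obtain r where r: "r > 0" "mapp M (dir \<phi>) = (r * cos (F \<phi>), r * sin (F \<phi>))"
    using liftsD(3)[OF L] by blast
  have "r * sin (F \<phi> - \<phi>) = 0" using w0 unfolding r(2) by (simp add: sin_diff algebra_simps)
  then have "sin (F \<phi> - \<phi>) = 0" using r(1) by simp
  then obtain p where "F \<phi> - \<phi> = of_int p * pi" using sin_zero_iff_int2 by blast
  then have p: "F \<phi> = \<phi> + pi * of_int p" by (simp add: algebra_simps)
  define \<mu> where "\<mu> = (if even p then r else - r)"
  have ev: "mapp M (dir \<phi>) = \<mu> *\<^sub>R dir \<phi>"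
    unfolding r(2) p \<mu>_def using cos_sin_diff_pi_int[of \<phi> "- p"] by simp
  have "mtr M * \<mu> = 1 + \<mu> * \<mu>" by (rule eigen_trace[OF d ev dir_nonzero])
  then have "0 < mtr M * \<mu>" by (simp add: add_pos_nonneg)
  then have "even p \<longleftrightarrow> 0 < mtr M" using r(1) unfolding \<mu>_def by (auto simp: zero_less_mult_iff split: if_splits)
  then show ?thesis using p by blast
qed

lemma fixed_displacement:
  assumes L: "lifts M F" "strict_mono F" and x: "F x = x + pi * of_int p"
  shows "\<bar>F \<phi> - \<phi> - pi * of_int p\<bar> < pi"
proof -
  define n where "n = \<lfloor>(\<phi> - x) / pi\<rfloor>"
  have "of_int n \<le> (\<phi> - x) / pi" "(\<phi> - x) / pi < of_int n + 1" unfolding n_def by linarith+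
  then have n: "x + pi * of_int n \<le> \<phi>" "\<phi> < x + pi * of_int (n + 1)" by (simp_all add: field_simps)
  have "F (x + pi * of_int n) \<le> F \<phi>" "F \<phi> < F (x + pi * of_int (n + 1))"
    using n by (simp_all only: strict_mono_less_eq[OF L(2)] strict_mono_less[OF L(2)])
  then have "F x + pi * of_int n \<le> F \<phi>" "F \<phi> < F x + pi * of_int n + pi"
    unfolding lifts_shift[OF L(1)] by (simp_all add: algebra_simps)
  moreover have "x + pi * of_int n \<le> \<phi>" "\<phi> < x + pi * of_int n + pi" using n by (simp_all add: algebra_simps)
  ultimately show ?thesis using x by (simp add: abs_less_iff)
qed

text \<open>At the fixed direction of \<open>F\<close> the first factor is exact, so only the errors
  of \<open>G\<close> and of the composition remain, each smaller than \<open>pi\<close>.\<close>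

lemma rotation_add:
  assumes F: "lifts M F" "strict_mono F" "F x = x + pi * of_int p"
    and G: "lifts N G" "strict_mono G" "G y = y + pi * of_int q"
    and H: "lifts K H" "strict_mono H" "H z = z + pi * of_int s" and comp: "\<And>\<phi>. H \<phi> = G (F \<phi>)"
  shows "\<bar>s - (p + q)\<bar> < 2"
proof -
  have "H x = G x + pi * of_int p" unfolding comp F(3) by (rule lifts_shift[OF G(1)])
  then have "\<bar>pi * (of_int s - of_int (p + q))\<bar> < pi * 2"
    using fixed_displacement[OF G, of x] fixed_displacement[OF H, of x] by (simp add: algebra_simps abs_less_iff)
  then have "\<bar>of_int s - of_int (p + q)\<bar> < (2::real)" by (simp add: abs_mult)
  then show ?thesis by linarith
qed

text \<open>The induction runs the Fibonacci recursion backwards: values \<open>p\<close>,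
  \<open>q\<close> at consecutive words come from \<open>q - p\<close>, \<open>p\<close> one step
  earlier. Integer solvability reflects that lengths and occupation numbers of consecutive words
  have determinant 1 or -1.\<close>

lemma label_basis: "\<exists>m l. wlab m l (fibw k) = p \<and> wlab m l (fibw (Suc k)) = q"
proof (induction k arbitrary: p q)
  case 0
  show ?case by (rule exI[of _ "q - p"], rule exI[of _ p]) (simp add: wlab_def)
next
  case (Suc k)
  obtain m l where ml: "wlab m l (fibw k) = q - p" "wlab m l (fibw (Suc k)) = p" using Suc by blast
  then have "wlab m l (fibw (Suc (Suc k))) = q" by (simp add: wlab_append)
  then show ?case using ml by blast
qed

lemma occn_fibw_bound: "\<bar>real (occn (fibw k)) - length (fibw k) * alpha\<bar> \<le> 1"
proof -
  have *: "0 < alpha ^ n" "alpha ^ n \<le> 1" for n using alpha_bounds power_le_one[of alpha n] by auto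
  show ?thesis
  proof (cases "even k")
    case True
    then obtain i where "k = 2 * i" by (elim evenE)
    then show ?thesis using fibw_rotation[of i] *[of "2*i+1"] by auto
  next
    case False
    then obtain i where "k = 2 * i + 1" by (elim oddE)
    then show ?thesis using fibw_rotation[of i] *[of "2*i+2"] by auto
  qed
qed

lemma wlab_fibw_bound:
  "\<bar>of_int (wlab m l (fibw k)) - length (fibw k) * (of_int m * alpha + of_int l)\<bar> \<le> \<bar>real_of_int m\<bar>"
proof -
  have "of_int (wlab m l (fibw k)) - length (fibw k) * (of_int m * alpha + of_int l) =
      of_int m * (real (occn (fibw k)) - length (fibw k) * alpha)"
    unfolding wlab_def by (simp add: algebra_simps)
  then have "\<bar>of_int (wlab m l (fibw k)) - length (fibw k) * (of_int m * alpha + of_int l)\<bar> =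
      \<bar>real_of_int m\<bar> * \<bar>real (occn (fibw k)) - length (fibw k) * alpha\<bar>" by (simp only: abs_mult)
  also have "\<dots> \<le> \<bar>real_of_int m\<bar> * 1" by (rule mult_left_mono[OF occn_fibw_bound]) simp
  finally show ?thesis by simp
qed

lemma gap_label:
  assumes V: "0 \<le> V" "V \<le> 1" and E: "complex_of_real E \<notin> Sigma_V V"
  shows "\<exists>m l. ids E V = 1 - (of_int m * alpha + of_int l) \<and> 0 \<le> ids E V \<and> ids E V \<le> 1"
proof -
  let ?M = "\<lambda>k. wmat V E (fibw k)" and ?F = "\<lambda>k. wlift V E (fibw k)"
  obtain k0 where k0: "\<And>k. k0 \<le> k \<Longrightarrow> 2 < \<bar>mtr (?M k)\<bar>" using traces_escape[OF E] by blast
  have "\<forall>k. \<exists>\<phi> p. k0 \<le> k \<longrightarrow> ?F k \<phi> = \<phi> + pi * of_int p \<and> (even p \<longleftrightarrow> 0 < mtr (?M k))"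
    using hyperbolic_fixed_direction[OF lifts_wlift mdet_wmat k0] by blast
  then obtain \<Phi> P where P: "\<And>k. k0 \<le> k \<Longrightarrow> ?F k (\<Phi> k) = \<Phi> k + pi * of_int (P k)"
    "\<And>k. k0 \<le> k \<Longrightarrow> even (P k) \<longleftrightarrow> 0 < mtr (?M k)"
    by metis
  have rec: "P (Suc (Suc k)) = P (Suc k) + P k" if k: "k0 \<le> k" for k
  proof -
    have fm: "mtr (fmat 0 0 V E j) = mtr (?M j)" for j by (simp add: cmat_def wlab_def msgn_def)
    define x y z where "x = mtr (?M k)" and "y = mtr (?M (Suc k))" and "z = mtr (?M (Suc (Suc k)))"
    have fr: "x\<^sup>2 + y\<^sup>2 + z\<^sup>2 - x * y * z = 4 + V\<^sup>2"
      using fricke[of 0 0 V E k] unfolding fm x_def y_def z_def by (simp only: Suc_eq_plus1 add.assoc one_add_one)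
    have big: "2 < \<bar>x\<bar>" "2 < \<bar>y\<bar>" "2 < \<bar>z\<bar>" unfolding x_def y_def z_def
      using k0[of k] k0[of "Suc k"] k0[of "Suc (Suc k)"] k by (simp_all del: fibw.simps)
    have sq: "4 < x\<^sup>2" "4 < y\<^sup>2" "4 < z\<^sup>2"
      using big power_strict_mono[of 2 "\<bar>x\<bar>" 2] power_strict_mono[of 2 "\<bar>y\<bar>" 2] power_strict_mono[of 2 "\<bar>z\<bar>" 2] by auto
    have "V\<^sup>2 \<le> 1" using V by (simp add: power_le_one)
    \<comment> \<open>Three squares above 4 exceed the invariant, so the product of the traces is
      positive and the parities of the rotation numbers add up. An even integer of modulus less than
      2 is 0.\<close>
    then have "0 < x * y * z" using fr sq by linarith
    then have sgn: "(0 < x \<longleftrightarrow> 0 < y) \<longleftrightarrow> 0 < z" using big by (auto simp: zero_less_mult_iff mult_less_0_iff)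
    have "even (P (Suc (Suc k)) - (P (Suc k) + P k))"
      using sgn P(2)[of k] P(2)[of "Suc k"] P(2)[of "Suc (Suc k)"] k unfolding x_def y_def z_def by auto
    moreover have "\<bar>P (Suc (Suc k)) - (P (Suc k) + P k)\<bar> < 2"
    proof (cases "even k")
      case True
      have "\<bar>P (Suc (Suc k)) - (P k + P (Suc k))\<bar> < 2"
        by (rule rotation_add[OF lifts_wlift strict_mono_wlift P(1) lifts_wlift strict_mono_wlift P(1)
              lifts_wlift strict_mono_wlift P(1)]) (use k True in \<open>auto simp: wlift_append\<close>)
      then show ?thesis by (simp add: add.commute)
    next
      case False
      show ?thesis
        by (rule rotation_add[OF lifts_wlift strict_mono_wlift P(1) lifts_wlift strict_mono_wlift P(1)
              lifts_wlift strict_mono_wlift P(1)]) (use k False in \<open>auto simp: wlift_append\<close>)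
    qed
    ultimately show ?thesis by presburger
  qed
  obtain m l where ml: "wlab m l (fibw k0) = P k0" "wlab m l (fibw (Suc k0)) = P (Suc k0)"
    using label_basis by blast
  have "wlab m l (fibw (k0 + j)) = P (k0 + j) \<and> wlab m l (fibw (Suc (k0 + j))) = P (Suc (k0 + j))" for j
  proof (induction j)
    case (Suc j)
    then show ?case using rec[of "k0 + j"] by (simp add: wlab_append)
  qed (use ml in simp)
  then have lab: "wlab m l (fibw k) = P k" if "k0 \<le> k" for k using that by (metis le_add_diff_inverse)
  have "ids E V = 1 - (of_int m * alpha + of_int l)"
  proof (rule ids_label[OF V(1), of k0])
    fix k \<phi> assume k: "k0 \<le> k"
    have "flift m l V E k (\<Phi> k) = \<Phi> k" unfolding clift_def lab[OF k] P(1)[OF k] by simp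
    then show "\<bar>flift m l V E k \<phi> - \<phi>\<bar> \<le> 2 * pi"
      by (intro lifts_displacement[OF lifts_clift strict_mono_clift, of _ _ _ _ _ "\<Phi> k"]) simp
  qed
  \<comment> \<open>Words turn the direction 0 by an angle between 0 and \<open>pi\<close> times
    their length; dividing by the growing length removes the bounded errors. The range is what later
    identifies the value with a fractional part.\<close>
  moreover have "0 \<le> \<theta>" "\<theta> \<le> 1" if \<theta>: "\<theta> = of_int m * alpha + of_int l" for \<theta> :: real
  proof -
    have b: "- (1 + \<bar>real_of_int m\<bar>) \<le> length (fibw k) * \<theta>" "length (fibw k) * (\<theta> - 1) \<le> 1 + \<bar>real_of_int m\<bar>"
      if k: "k0 \<le> k" for k
    proof -
      have "pi * (-1) < pi * of_int (P k)" "pi * of_int (P k) < pi * (length (fibw k) + 1)"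
        using fixed_displacement[OF lifts_wlift strict_mono_wlift P(1)[OF k], of 0]
          wlift_zero_bounds[OF V(1), of E "fibw k"] by (simp_all add: abs_less_iff algebra_simps)
      then have "-1 < real_of_int (P k)" "of_int (P k) < real (length (fibw k)) + 1"
        by (simp_all only: mult_less_cancel_left_pos[OF pi_gt_zero])
      then show "- (1 + \<bar>real_of_int m\<bar>) \<le> length (fibw k) * \<theta>" "length (fibw k) * (\<theta> - 1) \<le> 1 + \<bar>real_of_int m\<bar>"
        using wlab_fibw_bound[of m l k] unfolding lab[OF k] \<theta>[symmetric] by (simp_all add: abs_le_iff algebra_simps)
    qed
    have big: "\<exists>k\<ge>k0. C < length (fibw k) * \<epsilon>" if "0 < \<epsilon>" for C \<epsilon> :: real
    proof -
      obtain j :: nat where "C / \<epsilon> < real j" using reals_Archimedean2 by blast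
      also have "real j \<le> length (fibw (k0 + j))" using length_fibw_ge[of "k0 + j"] by simp
      finally show ?thesis using that by (intro exI[of _ "k0 + j"]) (simp add: field_simps)
    qed
    show "0 \<le> \<theta>"
    proof (rule ccontr)
      assume "\<not> 0 \<le> \<theta>"
      then obtain k where "k0 \<le> k" "1 + \<bar>real_of_int m\<bar> < length (fibw k) * (- \<theta>)" using big[of "- \<theta>"] by auto
      then show False using b(1)[of k] by simp
    qed
    show "\<theta> \<le> 1"
    proof (rule ccontr)
      assume "\<not> \<theta> \<le> 1"
      then obtain k where "k0 \<le> k" "1 + \<bar>real_of_int m\<bar> < length (fibw k) * (\<theta> - 1)" using big[of "\<theta> - 1"] by auto
      then show False using b(2)[of k] by simp
    qed
  qed
  ultimately show ?thesis by (intro exI[of _ m] exI[of _ l]) simp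
qed

section \<open>All gaps open\<close>

lemma psd_form:
  fixes c m n :: real
  assumes "\<And>x y. 0 \<le> c * x\<^sup>2 + m * x * y + n * y\<^sup>2"
  shows "0 \<le> c" "0 \<le> n" "m\<^sup>2 \<le> 4 * c * n"
proof -
  show c: "0 \<le> c" and "0 \<le> n" using assms[of 1 0] assms[of 0 1] by auto
  show "m\<^sup>2 \<le> 4 * c * n"
  proof (cases "c = 0")
    case True
    have "m = 0"
    proof (rule ccontr)
      assume "m \<noteq> 0"
      then have "m * (- (n + 1) / m) * 1 + n * 1\<^sup>2 = -1" by simp
      then show False using assms[of "- (n + 1) / m" 1] True by simp
    qed
    then show ?thesis using True by simp
  next
    case False
    have "c * (- m)\<^sup>2 + m * (- m) * (2 * c) + n * (2 * c)\<^sup>2 = c * (4 * c * n - m\<^sup>2)"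
      by (simp add: power2_eq_square algebra_simps)
    then have "0 \<le> c * (4 * c * n - m\<^sup>2)" using assms[of "- m" "2 * c"] by simp
    then show ?thesis using False c by (simp add: zero_le_mult_iff)
  qed
qed

lemma lifts_form_sign:
  assumes L: "lifts M F" and s: "\<And>\<phi>. 0 \<le> \<sigma> * sin (F \<phi> - \<phi>)"
  shows "0 \<le> \<sigma> * wedge v (mapp M v)"
proof -
  obtain x y where v: "v = (x, y)" by (cases v)
  obtain \<rho> \<phi> where pol: "x = \<rho> * cos \<phi>" "y = \<rho> * sin \<phi>" using polar_Ex by blast
  obtain r where r: "r > 0" "mapp M (dir \<phi>) = (r * cos (F \<phi>), r * sin (F \<phi>))"
    using liftsD(3)[OF L] by blast
  have "wedge v (mapp M v) = \<rho>\<^sup>2 * wedge (dir \<phi>) (mapp M (dir \<phi>))"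
    unfolding v pol by (cases M) (simp add: power2_eq_square algebra_simps)
  also have "\<dots> = (\<rho>\<^sup>2 * r) * sin (F \<phi> - \<phi>)" unfolding r(2) by (simp add: sin_diff algebra_simps)
  finally have "\<sigma> * wedge v (mapp M v) = (\<rho>\<^sup>2 * r) * (\<sigma> * sin (F \<phi> - \<phi>))" by simp
  also have "0 \<le> \<dots>" using r(1) by (intro mult_nonneg_nonneg[OF _ s]) simp
  finally show ?thesis .
qed

text \<open>\<open>msemi \<sigma> M\<close>: the quadratic form \<open>v \<and> M v\<close>, whose discriminant is \<open>(tr M)\<^sup>2 - 4\<close>, has sign \<open>\<sigma>\<close>.\<close>

definition msemi :: "real \<Rightarrow> mat2 \<Rightarrow> bool" where
  "msemi \<sigma> M \<longleftrightarrow> (\<forall>v. 0 \<le> \<sigma> * wedge v (mapp M v))"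

lemma msemi_entries:
  assumes "msemi \<sigma> (a, b, c, d)"
  shows "0 \<le> \<sigma> * c" "\<sigma> * b \<le> 0" "(\<sigma> * (d - a))\<^sup>2 \<le> - 4 * (\<sigma> * c) * (\<sigma> * b)"
proof -
  have "0 \<le> (\<sigma> * c) * x\<^sup>2 + (\<sigma> * (d - a)) * x * y + (- (\<sigma> * b)) * y\<^sup>2" for x y
    using assms[unfolded msemi_def, rule_format, of "(x, y)"] by (simp add: power2_eq_square algebra_simps)
  from psd_form[OF this] show "0 \<le> \<sigma> * c" "\<sigma> * b \<le> 0" "(\<sigma> * (d - a))\<^sup>2 \<le> - 4 * (\<sigma> * c) * (\<sigma> * b)"
    by simp_all
qed

lemma msemi_trace:
  assumes "msemi \<sigma> M" "mdet M = 1" "\<sigma>\<^sup>2 = 1"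
  shows "\<bar>mtr M\<bar> \<le> 2"
proof -
  obtain a b c d where M: "M = (a, b, c, d)" by (cases M)
  have "\<sigma>\<^sup>2 * (d - a)\<^sup>2 \<le> - 4 * (\<sigma>\<^sup>2 * (c * b))"
    using msemi_entries(3)[OF assms(1)[unfolded M]] by (simp add: power2_eq_square algebra_simps)
  then have "(d - a)\<^sup>2 \<le> - 4 * (c * b)" unfolding assms(3) by simp
  moreover have "(mtr M)\<^sup>2 = (d - a)\<^sup>2 + 4 * (a * d - b * c) + 4 * (c * b)"
    unfolding M by (simp add: power2_eq_square algebra_simps)
  moreover have "a * d - b * c = 1" using assms(2) unfolding M by simp
  ultimately have "(mtr M)\<^sup>2 \<le> 2\<^sup>2" by simp
  then show ?thesis using abs_le_square_iff[of "mtr M" 2] by simp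
qed

text \<open>The two sides differ by twice the trace of the product of the traceless parts. This
  pairing is Lorentzian, forms of the two signs fill the two halves of its light cone, and vectors
  from opposite halves pair with a fixed sign: a reversed Cauchy-Schwarz inequality.\<close>

lemma msemi_opposite:
  assumes "msemi 1 X" "msemi (-1) Y"
  shows "mtr X * mtr Y \<le> 2 * mtr (mmul X Y)"
proof -
  obtain a b c d where X: "X = (a, b, c, d)" by (cases X)
  obtain p q r s where Y: "Y = (p, q, r, s)" by (cases Y)
  have x: "0 \<le> c" "b \<le> 0" "(d - a)\<^sup>2 \<le> - 4 * c * b"
    using msemi_entries[OF assms(1)[unfolded X]] by simp_all
  have y: "r \<le> 0" "0 \<le> q" "(s - p)\<^sup>2 \<le> - 4 * r * q"
    using msemi_entries[OF assms(2)[unfolded Y]] by (simp_all add: power2_commute)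
  have br: "0 \<le> b * r" "0 \<le> c * q" using x y by (simp_all add: mult_nonpos_nonpos)
  have "((d - a) * (s - p))\<^sup>2 \<le> (- 4 * c * b) * (- 4 * r * q)"
    unfolding power_mult_distrib by (rule mult_mono[OF x(3) y(3) order_trans[OF zero_le_power2 x(3)]]) simp
  also have "\<dots> = 16 * (b * r) * (c * q)" by simp
  also have "\<dots> \<le> (2 * (b * r + c * q))\<^sup>2"
    using zero_le_power2[of "b * r - c * q"] by (simp add: power2_eq_square algebra_simps)
  finally have "\<bar>(d - a) * (s - p)\<bar> \<le> 2 * (b * r + c * q)"
    using br abs_le_square_iff[of "(d - a) * (s - p)" "2 * (b * r + c * q)"] by simp
  moreover have "2 * mtr (mmul X Y) - mtr X * mtr Y = (d - a) * (s - p) + 2 * (b * r + c * q)"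
    unfolding X Y by (simp add: algebra_simps)
  ultimately show ?thesis by linarith
qed

text \<open>An exact half turn is an eigenvector with eigenvalue \<open>- r\<close>, and by
  determinant 1 the trace is \<open>- (r + 1 / r)\<close>.\<close>

lemma half_turn_trace:
  assumes L: "lifts M F" and d: "mdet M = 1" and F: "F \<phi> = \<phi> + pi \<or> F \<phi> = \<phi> - pi"
  shows "mtr M \<le> -2"
proof -
  obtain r where r: "r > 0" "mapp M (dir \<phi>) = (r * cos (F \<phi>), r * sin (F \<phi>))"
    using liftsD(3)[OF L] by blast
  have "mapp M (dir \<phi>) = (- r) *\<^sub>R dir \<phi>" using F unfolding r(2) by (auto simp: cos_diff sin_diff)
  from eigen_trace[OF d this dir_nonzero] have "- (mtr M * r) = 1 + r * r" by simp
  moreover have "2 * r \<le> 1 + r * r" using zero_le_power2[of "r - 1"] by (simp add: power2_eq_square algebra_simps)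
  ultimately have "mtr M * r \<le> (-2) * r" by simp
  then show ?thesis using r(1) by (simp only: mult_le_cancel_right_pos)
qed

section \<open>Trace sequences excluded by the Fricke invariant\<close>

lemma trace_cube_impossible:
  fixes t :: "nat \<Rightarrow> real"
  assumes rec: "\<And>k. t (k + 3) = t (k + 2) * t (k + 1) - t k"
    and fr: "\<And>k. (t k)\<^sup>2 + (t (k + 1))\<^sup>2 + (t (k + 2))\<^sup>2 - t k * t (k + 1) * t (k + 2) = 4 + V\<^sup>2"
    and b: "\<And>k. \<bar>t k\<bar> \<le> 2" and up: "\<And>k. t k \<le> t (k + 3)" and V: "0 < V"
  shows False
proof -
  have "\<exists>L. (\<lambda>j. t (3 * j + i)) \<longlonglongrightarrow> L" for i
  proof -
    have "incseq (\<lambda>j. t (3 * j + i))"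
    proof (rule incseq_SucI)
      fix n
      have e: "3 * Suc n + i = (3 * n + i) + 3" by simp
      show "t (3 * n + i) \<le> t (3 * Suc n + i)" unfolding e by (rule up)
    qed
    moreover have "\<bar>t (3 * j + i)\<bar> \<le> 2" for j by (rule b)
    ultimately show ?thesis using incseq_convergent[of "\<lambda>j. t (3 * j + i)" 2] by (metis abs_le_D1)
  qed
  then obtain L where L: "\<And>i. (\<lambda>j. t (3 * j + i)) \<longlonglongrightarrow> L i" by metis
  have per: "L (i + 3) = L i" for i
  proof -
    have "(\<lambda>j. t (3 * Suc j + i)) \<longlonglongrightarrow> L i" by (rule LIMSEQ_Suc[OF L])
    moreover have "3 * Suc j + i = 3 * j + (i + 3)" for j by simp
    ultimately have "(\<lambda>j. t (3 * j + (i + 3))) \<longlonglongrightarrow> L i" by (simp only:)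
    then show ?thesis using L[of "i + 3"] LIMSEQ_unique by blast
  qed
  have lim: "2 * L i = L (i + 2) * L (i + 1)" for i
  proof -
    have "(\<lambda>j. t (3 * j + (i + 2)) * t (3 * j + (i + 1)) - t (3 * j + i)) \<longlonglongrightarrow> L (i + 2) * L (i + 1) - L i"
      by (intro tendsto_intros L)
    moreover have "t (3 * j + (i + 2)) * t (3 * j + (i + 1)) - t (3 * j + i) = t (3 * j + (i + 3))" for j
      using rec[of "3 * j + i"] by (simp add: add.assoc)
    ultimately have "L (i + 3) = L (i + 2) * L (i + 1) - L i" using L[of "i + 3"] LIMSEQ_unique by auto
    then show ?thesis unfolding per by simp
  qed
  have frL: "(L 0)\<^sup>2 + (L 1)\<^sup>2 + (L 2)\<^sup>2 - L 0 * L 1 * L 2 = 4 + V\<^sup>2"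
  proof (rule LIMSEQ_unique)
    show "(\<lambda>j. (t (3 * j + 0))\<^sup>2 + (t (3 * j + 1))\<^sup>2 + (t (3 * j + 2))\<^sup>2 - t (3 * j + 0) * t (3 * j + 1) * t (3 * j + 2)) \<longlonglongrightarrow>
      (L 0)\<^sup>2 + (L 1)\<^sup>2 + (L 2)\<^sup>2 - L 0 * L 1 * L 2" by (intro tendsto_intros L)
    show "(\<lambda>j. (t (3 * j + 0))\<^sup>2 + (t (3 * j + 1))\<^sup>2 + (t (3 * j + 2))\<^sup>2 - t (3 * j + 0) * t (3 * j + 1) * t (3 * j + 2)) \<longlonglongrightarrow>
      4 + V\<^sup>2" by (simp only: add_0_right fr tendsto_const)
  qed
  have e: "2 * L 0 = L 2 * L 1" "2 * L 1 = L 0 * L 2" "2 * L 2 = L 1 * L 0"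
    using lim[of 0] lim[of 1] lim[of 2] per[of 0] per[of 1] by (simp_all add: eval_nat_numeral)
  have "L 0 * (2 * L 0) = L 0 * (L 2 * L 1)" "L 1 * (2 * L 1) = L 1 * (L 0 * L 2)" "L 2 * (2 * L 2) = L 2 * (L 1 * L 0)"
    unfolding e by simp_all
  then have "2 * (L 0)\<^sup>2 = L 0 * L 1 * L 2" "2 * (L 1)\<^sup>2 = L 0 * L 1 * L 2" "2 * (L 2)\<^sup>2 = L 0 * L 1 * L 2"
    by (simp_all add: power2_eq_square algebra_simps)
  then have "(L 0)\<^sup>2 = 4 + V\<^sup>2" using frL by linarith
  moreover have "\<bar>L 0\<bar> \<le> 2"
    by (rule tendsto_upperbound[OF tendsto_rabs[OF L[of 0]]]) (auto simp: b)
  then have "(L 0)\<^sup>2 \<le> 2\<^sup>2" using abs_le_square_iff[of "L 0" 2] by simp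
  moreover have "0 < V\<^sup>2" using V by simp
  ultimately show False by simp
qed

text \<open>If \<open>t2\<close> were nonpositive, \<open>t3\<close> could reach -2 only with
  \<open>t0 = 2\<close> and \<open>t2 = 0\<close>. Then \<open>t1 = -2\<close>, and the invariant
  would be 8, against \<open>V\<^sup>2 < 4\<close>.\<close>

lemma trace_alternating_pos:
  fixes t0 t1 t2 t3 t4 V :: real
  assumes "\<bar>t0\<bar> \<le> 2" "t1 \<le> -2" "t3 \<le> -2" "\<bar>t4\<bar> \<le> 2"
    and r: "t3 = t2 * t1 - t0" "t4 = t3 * t2 - t1"
    and fr: "t0\<^sup>2 + t1\<^sup>2 + t2\<^sup>2 - t0 * t1 * t2 = 4 + V\<^sup>2" and V: "V\<^sup>2 < 4"
  shows "0 < t2"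
proof (rule ccontr)
  assume "\<not> 0 < t2"
  then have "0 \<le> t2 * t1" using assms(2) by (intro mult_nonpos_nonpos) auto
  moreover have "t0 \<le> 2" using assms(1) by simp
  ultimately have p: "t2 * t1 = 0" "t0 = 2" using assms(3) r(1) by linarith+
  then have 2: "t2 = 0" using assms(2) by auto
  then have "t1 = -2" using r(2) assms(2,4) by auto
  then show False using fr V 2 p(2) by simp
qed

text \<open>With \<open>y = - t 3 \<ge> 2\<close> the invariant leaves only \<open>V\<^sup>2\<close>
  for \<open>(x + z)\<^sup>2\<close>, so \<open>x + z \<le> 1/2\<close>, while
  \<open>y \<le> 3\<close>. One step backwards, \<open>- t 1 = y * x + z\<close> would then be at
  most 3/2 and not at least 2.\<close>

lemma trace_alternating_impossible:
  fixes t :: "nat \<Rightarrow> real"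
  assumes rec: "\<And>k. t (k + 3) = t (k + 2) * t (k + 1) - t k"
    and fr: "\<And>k. (t k)\<^sup>2 + (t (k + 1))\<^sup>2 + (t (k + 2))\<^sup>2 - t k * t (k + 1) * t (k + 2) = 4 + V\<^sup>2"
    and b: "\<And>j. \<bar>t (2 * j)\<bar> \<le> 2" "\<And>j. t (2 * j + 1) \<le> -2" and V: "0 < V" "V \<le> 1/2"
  shows False
proof -
  have V2: "V\<^sup>2 \<le> (1/2)\<^sup>2" using V by (intro power_mono) auto
  have pos: "0 < t (2 * j + 2)" for j
  proof (rule trace_alternating_pos)
    show "\<bar>t (2 * j)\<bar> \<le> 2" "t (2 * j + 1) \<le> -2" by (rule b)+
    show "t (2 * j + 3) \<le> -2" "\<bar>t (2 * j + 4)\<bar> \<le> 2" using b(1)[of "j + 2"] b(2)[of "j + 1"] by (simp_all add: eval_nat_numeral)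
    show "t (2 * j + 3) = t (2 * j + 2) * t (2 * j + 1) - t (2 * j)" by (rule rec)
    show "t (2 * j + 4) = t (2 * j + 3) * t (2 * j + 2) - t (2 * j + 1)"
      using rec[of "2 * j + 1"] by (simp add: eval_nat_numeral)
    show "(t (2 * j))\<^sup>2 + (t (2 * j + 1))\<^sup>2 + (t (2 * j + 2))\<^sup>2 - t (2 * j) * t (2 * j + 1) * t (2 * j + 2) = 4 + V\<^sup>2"
      by (rule fr)
    show "V\<^sup>2 < 4" using V2 by (simp add: power2_eq_square)
  qed
  define x y z where "x = t 2" and "y = - t 3" and "z = t 4"
  have n: "2 * 0 + 2 = (2 :: nat)" "2 * 1 + 2 = (4 :: nat)" by simp_all
  have xz: "0 < x" "0 < z" using pos[of 0, unfolded n] pos[of 1, unfolded n] by (simp_all only: x_def z_def)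
  have y: "2 \<le> y" using b(2)[of 1] by (simp add: y_def)
  have f: "x\<^sup>2 + y\<^sup>2 + z\<^sup>2 + x * y * z = 4 + V\<^sup>2" using fr[of 2] by (simp add: x_def y_def z_def)
  have "2 * (x * z) \<le> y * (x * z)" using xz y by (intro mult_right_mono) auto
  then have xyz: "2 * x * z \<le> x * y * z" by (simp add: ac_simps)
  have y4: "2\<^sup>2 \<le> y\<^sup>2" using y by (intro power_mono) auto
  have "(x + z)\<^sup>2 = x\<^sup>2 + z\<^sup>2 + 2 * x * z" by (simp add: power2_eq_square algebra_simps)
  then have "(x + z)\<^sup>2 \<le> (1/2)\<^sup>2" using f xyz y4 V2 by simp
  then have s: "x + z \<le> 1/2" by (rule power2_le_imp_le) simp
  have "0 \<le> x * y * z" using xz y by simp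
  then have "y\<^sup>2 \<le> 4 + V\<^sup>2" using f zero_le_power2[of x] zero_le_power2[of z] by linarith
  also have "\<dots> \<le> 3\<^sup>2" using V2 by (simp add: power_divide)
  finally have "y\<^sup>2 \<le> 3\<^sup>2" .
  then have y3: "y \<le> 3" by (rule power2_le_imp_le) simp
  have "t 1 = - (y * x + z)" using rec[of 1] by (simp add: x_def y_def z_def eval_nat_numeral)
  then have "2 \<le> y * x + z" using b(2)[of 0] by simp
  also have "\<dots> \<le> 3 * x + 3 * z" using y3 xz by (intro add_mono mult_right_mono) auto
  finally show False using s by simp
qed

lemma ivt_real:
  fixes h :: "real \<Rightarrow> real"
  assumes "continuous_on UNIV h" "h a \<le> c" "c \<le> h b" shows "\<exists>x. h x = c"
proof -
  have "continuous_on {a..b} h" "continuous_on {b..a} h" using assms(1) continuous_on_subset by blast+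
  then show ?thesis using IVT'[of h a c b] IVT2'[of h a c b] assms(2,3) by (cases "a \<le> b") auto
qed

text \<open>Composition with maps below or above the identity makes the odd lifts decrease and the
  even ones increase with the index. For each parity, either displacements are eventually at most a
  half turn everywhere, giving a semidefinite form, or a half turn is attained exactly, giving
  traces at most -2. The four combinations are refuted in turn.\<close>

lemma alternating_words_impossible:
  fixes F :: "nat \<Rightarrow> real \<Rightarrow> real" and N :: "nat \<Rightarrow> mat2"
  assumes L: "\<And>k. lifts (N k) (F k)" and det: "\<And>k. mdet (N k) = 1"
    and rec: "\<And>k. ((\<forall>\<phi>. F (k + 2) \<phi> = F (k + 1) (F k \<phi>)) \<and> N (k + 2) = mmul (N (k + 1)) (N k)) \<or>
      ((\<forall>\<phi>. F (k + 2) \<phi> = F k (F (k + 1) \<phi>)) \<and> N (k + 2) = mmul (N k) (N (k + 1)))"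
    and trec: "\<And>k. mtr (N (k + 3)) = mtr (N (k + 2)) * mtr (N (k + 1)) - mtr (N k)"
    and fr: "\<And>k. (mtr (N k))\<^sup>2 + (mtr (N (k + 1)))\<^sup>2 + (mtr (N (k + 2)))\<^sup>2 -
      mtr (N k) * mtr (N (k + 1)) * mtr (N (k + 2)) = 4 + V\<^sup>2"
    and ev: "\<And>j \<phi>. F (2 * j) \<phi> \<le> \<phi>" and od: "\<And>j \<phi>. \<phi> \<le> F (2 * j + 1) \<phi>"
    and V: "0 < V" "V \<le> 1/2"
  shows False
proof -
  have mono: "F k x \<le> F k y" if "x \<le> y" for k x y
    using strict_mono_less_eq[OF lifts_strict_mono[OF L det]] that by blast
  have shift: "F k (\<phi> + pi) = F k \<phi> + pi" "F k (\<phi> - pi) = F k \<phi> - pi" for k \<phi>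
    using liftsD(2)[OF L, of k \<phi>] liftsD(2)[OF L, of k "\<phi> - pi"] by simp_all
  have comp: "F (k + 2) \<phi> = F (k + 1) (F k \<phi>) \<or> F (k + 2) \<phi> = F k (F (k + 1) \<phi>)" for k \<phi>
    using rec[of k] by blast
  have od_dec: "F (2 * j + 3) \<phi> \<le> F (2 * j + 1) \<phi>" for j \<phi>
  proof -
    have e: "2 * j + 3 = (2 * j + 1) + 2" "2 * j + 1 + 1 = 2 * (j + 1)" by simp_all
    show ?thesis unfolding e(1) using comp[of "2 * j + 1" \<phi>] ev[of "j + 1"] mono[of "F (2 * (j + 1)) \<phi>" \<phi>] unfolding e(2) by auto
  qed
  have ev_inc: "F (2 * j) \<phi> \<le> F (2 * j + 2) \<phi>" for j \<phi>
    using comp[of "2 * j" \<phi>] od[of _ j] mono[of \<phi> "F (2 * j + 1) \<phi>"] by auto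
  have od_dec': "F (2 * j + 1) \<phi> \<le> F (2 * i + 1) \<phi>" if "i \<le> j" for i j \<phi>
    using that
  proof (induction j rule: dec_induct)
    case (step n)
    then show ?case using od_dec[of n \<phi>] by (simp add: eval_nat_numeral)
  qed simp
  have ev_inc': "F (2 * i) \<phi> \<le> F (2 * j) \<phi>" if "i \<le> j" for i j \<phi>
    using that
  proof (induction j rule: dec_induct)
    case (step n)
    then show ?case using ev_inc[of n \<phi>] by simp
  qed simp
  \<comment> \<open>If all odd lifts moved every direction by at least \<open>pi\<close>, each even
    lift would exceed the previous one by \<open>pi\<close> at 0 and finally pass the
    identity.\<close>
  have od_lt: "\<exists>i \<phi>. F (2 * i + 1) \<phi> < \<phi> + pi"
  proof (rule ccontr)
    assume "\<not> ?thesis"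
    then have big: "\<phi> + pi \<le> F (2 * i + 1) \<phi>" for i \<phi> by (simp add: not_less)
    have grow: "F (2 * j) 0 + pi \<le> F (2 * j + 2) 0" for j
      using comp[of "2 * j" 0] big[of _ j] mono[OF big[of 0 j], of "2 * j"] shift(1)[of "2 * j" 0] by auto
    have "F 0 0 + pi * real j \<le> F (2 * j) 0" for j
    proof (induction j)
      case (Suc j)
      then show ?case using grow[of j] by (simp add: algebra_simps)
    qed simp
    moreover obtain j :: nat where "- F 0 0 / pi < real j" using reals_Archimedean2 by blast
    ultimately have "0 < F (2 * j) 0" by (metis (no_types) add.commute diff_0 diff_less_eq less_le_trans mult.commute pi_gt_zero pos_divide_less_eq)
    then show False using ev[of j 0] by simp
  qed
  have ev_gt: "\<exists>i \<phi>. \<phi> - pi < F (2 * i) \<phi>"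
  proof (rule ccontr)
    assume "\<not> ?thesis"
    then have big: "F (2 * i) \<phi> \<le> \<phi> - pi" for i \<phi> by (simp add: not_less)
    have drop: "F (2 * j + 3) 0 \<le> F (2 * j + 1) 0 - pi" for j
    proof -
      have e: "2 * j + 3 = (2 * j + 1) + 2" "2 * j + 1 + 1 = 2 * (j + 1)" by simp_all
      show ?thesis unfolding e(1) using comp[of "2 * j + 1" 0] big[of "j + 1"] mono[OF big[of "j + 1" 0], of "2 * j + 1"]
          shift(2)[of "2 * j + 1" 0] unfolding e(2) by auto
    qed
    have "F (2 * j + 1) 0 \<le> F 1 0 - pi * real j" for j
    proof (induction j)
      case (Suc j)
      then show ?case using drop[of j] by (simp add: algebra_simps eval_nat_numeral)
    qed simp
    moreover obtain j :: nat where "F 1 0 / pi < real j" using reals_Archimedean2 by blast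
    then have "F 1 0 < pi * real j" by (simp add: divide_less_eq mult.commute)
    ultimately have "F (2 * j + 1) 0 < 0" by (metis diff_less_0_iff_less le_less_trans)
    then show False using od[of 0 j] by simp
  qed
  have cont: "continuous_on UNIV (\<lambda>\<phi>. F k \<phi> - \<phi>)" for k
    by (intro continuous_intros liftsD(1)[OF L])
  have od_cases: "(\<exists>i. \<forall>j\<ge>i. msemi 1 (N (2 * j + 1))) \<or> (\<exists>i. \<forall>j\<ge>i. mtr (N (2 * j + 1)) \<le> -2)"
  proof (cases "\<exists>i. \<forall>\<phi>. F (2 * i + 1) \<phi> < \<phi> + pi")
    case True
    then obtain i where i: "\<And>\<phi>. F (2 * i + 1) \<phi> < \<phi> + pi" by blast
    have "msemi 1 (N (2 * j + 1))" if "i \<le> j" for j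
      unfolding msemi_def
    proof (intro allI lifts_form_sign[OF L])
      fix \<phi>
      have "F (2 * j + 1) \<phi> - \<phi> \<le> pi" using od_dec'[OF that, of \<phi>] i[of \<phi>] by linarith
      then show "0 \<le> 1 * sin (F (2 * j + 1) \<phi> - \<phi>)" using od[of \<phi> j] by (simp add: sin_ge_zero)
    qed
    then show ?thesis by blast
  next
    case False
    \<comment> \<open>This direction stays within a half turn at all later odd indices, while at
      each index some other direction turns by at least as much; in between a half turn is
      exact.\<close>
    obtain i \<phi>1 where i: "F (2 * i + 1) \<phi>1 < \<phi>1 + pi" using od_lt by blast
    have "mtr (N (2 * j + 1)) \<le> -2" if "i \<le> j" for j
    proof -
      obtain \<phi>2 where "\<phi>2 + pi \<le> F (2 * j + 1) \<phi>2" using False by (auto simp: not_less)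
      moreover have "F (2 * j + 1) \<phi>1 \<le> \<phi>1 + pi" using od_dec'[OF that, of \<phi>1] i by linarith
      ultimately obtain \<phi> where "F (2 * j + 1) \<phi> - \<phi> = pi"
        using ivt_real[OF cont, of "2 * j + 1" \<phi>1 pi \<phi>2] by auto
      then show ?thesis using half_turn_trace[OF L det, of "2 * j + 1" \<phi>] by (simp add: algebra_simps)
    qed
    then show ?thesis by blast
  qed
  have ev_cases: "(\<exists>i. \<forall>j\<ge>i. msemi (-1) (N (2 * j))) \<or> (\<exists>i. \<forall>j\<ge>i. mtr (N (2 * j)) \<le> -2)"
  proof (cases "\<exists>i. \<forall>\<phi>. \<phi> - pi < F (2 * i) \<phi>")
    case True
    then obtain i where i: "\<And>\<phi>. \<phi> - pi < F (2 * i) \<phi>" by blast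
    have "msemi (-1) (N (2 * j))" if "i \<le> j" for j
      unfolding msemi_def
    proof (intro allI lifts_form_sign[OF L])
      fix \<phi>
      have "\<phi> - F (2 * j) \<phi> \<le> pi" using ev_inc'[OF that, of \<phi>] i[of \<phi>] by linarith
      then have "0 \<le> sin (\<phi> - F (2 * j) \<phi>)" using ev[of j \<phi>] by (simp add: sin_ge_zero)
      also have "\<dots> = - 1 * sin (F (2 * j) \<phi> - \<phi>)" using sin_minus[of "F (2 * j) \<phi> - \<phi>"] by simp
      finally show "0 \<le> - 1 * sin (F (2 * j) \<phi> - \<phi>)" .
    qed
    then show ?thesis by blast
  next
    case False
    obtain i \<phi>1 where i: "\<phi>1 - pi < F (2 * i) \<phi>1" using ev_gt by blast
    have "mtr (N (2 * j)) \<le> -2" if "i \<le> j" for j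
    proof -
      obtain \<phi>2 where "F (2 * j) \<phi>2 \<le> \<phi>2 - pi" using False by (auto simp: not_less)
      moreover have "\<phi>1 - pi \<le> F (2 * j) \<phi>1" using ev_inc'[OF that, of \<phi>1] i by linarith
      ultimately obtain \<phi> where "F (2 * j) \<phi> - \<phi> = - pi"
        using ivt_real[OF cont, of "2 * j" \<phi>2 "- pi" \<phi>1] by auto
      then show ?thesis using half_turn_trace[OF L det, of "2 * j" \<phi>] by (simp add: algebra_simps)
    qed
    then show ?thesis by blast
  qed
  from od_cases show False
  proof
    assume "\<exists>i. \<forall>j\<ge>i. msemi 1 (N (2 * j + 1))"
    then obtain i where i: "\<And>j. i \<le> j \<Longrightarrow> msemi 1 (N (2 * j + 1))" by blast
    have ti: "\<bar>mtr (N (2 * j + 1))\<bar> \<le> 2" if "i \<le> j" for j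
      by (rule msemi_trace[OF i[OF that] det]) simp
    from ev_cases show False
    proof
      assume "\<exists>i. \<forall>j\<ge>i. msemi (-1) (N (2 * j))"
      then obtain i' where i': "\<And>j. i' \<le> j \<Longrightarrow> msemi (-1) (N (2 * j))" by blast
      define n where "n = 2 * (i + i')"
      have ms: "msemi (if even k then -1 else 1) (N k)" if "n \<le> k" for k
      proof (cases "even k")
        case True
        then obtain j where "k = 2 * j" by (elim evenE)
        then show ?thesis using i'[of j] that True by (simp add: n_def)
      next
        case False
        then obtain j where "k = 2 * j + 1" by (elim oddE)
        then show ?thesis using i[of j] that False by (simp add: n_def)
      qed
      have "mtr (N k) \<le> mtr (N (k + 3))" if "n \<le> k" for k
      proof -
        have "mtr (N (k + 3)) = mtr (mmul (N (k + 2)) (N (k + 1)))"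
          using rec[of "k + 1"] mtr_mmul_commute[of "N (k + 1)" "N (k + 2)"] by (auto simp: eval_nat_numeral)
        \<comment> \<open>By \<open>trec\<close> the left side is the sum of the traces at
          \<open>k + 3\<close> and \<open>k\<close>, the right side twice the trace at
          \<open>k + 3\<close>.\<close>
        moreover have "mtr (N (k + 2)) * mtr (N (k + 1)) \<le> 2 * mtr (mmul (N (k + 2)) (N (k + 1)))"
        proof (cases "even k")
          case True
          then have "msemi (-1) (N (k + 2))" "msemi 1 (N (k + 1))" using ms[of "k + 1"] ms[of "k + 2"] that by simp_all
          then show ?thesis using msemi_opposite[of "N (k + 1)" "N (k + 2)"]
            by (metis mtr_mmul_commute mult.commute)
        next
          case False
          then have "msemi 1 (N (k + 2))" "msemi (-1) (N (k + 1))" using ms[of "k + 1"] ms[of "k + 2"] that by simp_all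
          then show ?thesis by (rule msemi_opposite)
        qed
        ultimately show ?thesis using trec[of k] by linarith
      qed
      moreover have "\<bar>mtr (N k)\<bar> \<le> 2" if "n \<le> k" for k
        by (rule msemi_trace[OF ms[OF that] det]) simp
      ultimately show False
        using trace_cube_impossible[of "\<lambda>k. mtr (N (n + k))" V] trec fr V(1) by (simp add: add.assoc[symmetric])
    next
      assume "\<exists>i. \<forall>j\<ge>i. mtr (N (2 * j)) \<le> -2"
      then obtain i' where i': "\<And>j. i' \<le> j \<Longrightarrow> mtr (N (2 * j)) \<le> -2" by blast
      define n where "n = 2 * (i + i') + 1"
      show False
      proof (rule trace_alternating_impossible[of "\<lambda>k. mtr (N (n + k))" V])
        show "\<bar>mtr (N (n + 2 * j))\<bar> \<le> 2" for j using ti[of "i + i' + j"] by (simp add: n_def algebra_simps)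
        show "mtr (N (n + (2 * j + 1))) \<le> -2" for j using i'[of "i + i' + j + 1"] by (simp add: n_def algebra_simps)
      qed (use trec fr V in \<open>simp_all add: add.assoc[symmetric]\<close>)
    qed
  next
    assume "\<exists>i. \<forall>j\<ge>i. mtr (N (2 * j + 1)) \<le> -2"
    then obtain i where i: "\<And>j. i \<le> j \<Longrightarrow> mtr (N (2 * j + 1)) \<le> -2" by blast
    from ev_cases show False
    proof
      assume "\<exists>i. \<forall>j\<ge>i. msemi (-1) (N (2 * j))"
      then obtain i' where "\<And>j. i' \<le> j \<Longrightarrow> msemi (-1) (N (2 * j))" by blast
      then have ti: "\<bar>mtr (N (2 * j))\<bar> \<le> 2" if "i' \<le> j" for j
        using that msemi_trace[of "-1" "N (2 * j)"] det by simp
      define n where "n = 2 * (i + i')"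
      show False
      proof (rule trace_alternating_impossible[of "\<lambda>k. mtr (N (n + k))" V])
        show "\<bar>mtr (N (n + 2 * j))\<bar> \<le> 2" for j using ti[of "i + i' + j"] by (simp add: n_def algebra_simps)
        show "mtr (N (n + (2 * j + 1))) \<le> -2" for j using i[of "i + i' + j"] by (simp add: n_def algebra_simps)
      qed (use trec fr V in \<open>simp_all add: add.assoc[symmetric]\<close>)
    next
      assume "\<exists>i. \<forall>j\<ge>i. mtr (N (2 * j)) \<le> -2"
      then obtain i' where i': "\<And>j. i' \<le> j \<Longrightarrow> mtr (N (2 * j)) \<le> -2" by blast
      define n where "n = 2 * (i + i')"
      have t: "mtr (N n) \<le> -2" "mtr (N (n + 1)) \<le> -2" "mtr (N (n + 2)) \<le> -2" "mtr (N (n + 3)) \<le> -2"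
        using i'[of "i + i'"] i[of "i + i'"] i'[of "i + i' + 1"] i[of "i + i' + 1"]
        by (simp_all add: n_def eval_nat_numeral)
      have "0 \<le> mtr (N (n + 2)) * mtr (N (n + 1))" using t by (intro mult_nonpos_nonpos) auto
      then show False using trec[of n] t by linarith
    qed
  qed
qed


abbreviation id_ge :: "(real \<Rightarrow> real) \<Rightarrow> bool" where "id_ge f \<equiv> \<forall>\<phi>. f \<phi> \<le> \<phi>"
abbreviation id_le :: "(real \<Rightarrow> real) \<Rightarrow> bool" where "id_le f \<equiv> \<forall>\<phi>. \<phi> \<le> f \<phi>"

lemma trap_from_crossings:
  assumes V: "0 \<le> V"
    and e: "e < flift m l V E k e" "e < flift m l V E (Suc k) e"
    and g: "flift m l V E k g < g" "flift m l V E (Suc k) g < g"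
  shows "complex_of_real E \<notin> Sigma_V V \<and> ids E V = 1 - (of_int m * alpha + of_int l)"
proof -
  \<comment> \<open>The crossing at \<open>g\<close> recurs at all translates by \<open>pi\<close>;
    the one in \<open>[e, e + pi)\<close> bounds a cone together with \<open>e\<close>.\<close>
  define n where "n = - \<lfloor>(g - e) / pi\<rfloor>"
  define f where "f = g + pi * of_int n"
  have "0 \<le> (g - e) / pi + of_int n" "(g - e) / pi + of_int n < 1" unfolding n_def by linarith+
  then have "0 \<le> ((g - e) / pi + of_int n) * pi" "((g - e) / pi + of_int n) * pi < 1 * pi"
    by (intro mult_nonneg_nonneg mult_strict_right_mono; simp)+
  moreover have "((g - e) / pi + of_int n) * pi = f - e" unfolding f_def by (simp add: distrib_right)
  ultimately have b: "e \<le> f" "f < e + pi" by simp_all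
  have f: "flift m l V E k f < f" "flift m l V E (Suc k) f < f"
    unfolding f_def lifts_shift[OF lifts_clift] using g by auto
  then have "e < f" using e(1) b(1) by (cases "e = f") auto
  then show ?thesis using trap_gap[OF V, of m l E e f k] e f b(2) unfolding trap_def by blast
qed

lemma gap_open:
  assumes V: "0 < V" "V \<le> 1/2" and m: "m \<noteq> 0"
    and \<theta>: "0 < of_int m * alpha + of_int l" "of_int m * alpha + of_int l < (1::real)"
  shows "\<exists>E. complex_of_real E \<notin> Sigma_V V \<and> ids E V = 1 - (of_int m * alpha + of_int l)"
proof (rule ccontr)
  assume none: "\<not> ?thesis"
  define C where "C k E = flift m l V E k" for k E
  \<comment> \<open>The sign that a uniform rotation by the prescribed number would give
    \<open>C k\<close>; negative \<open>m\<close> exchanges the parities.\<close>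
  define G where "G k E = (if even k = (m < 0) then id_ge (C k E) else id_le (C k E))" for k E
  have mono: "C k E x \<le> C k E y" if "x \<le> y" for k E x y
    using that unfolding C_def by (simp only: strict_mono_less_eq[OF strict_mono_clift])
  have rec: "C (Suc (Suc k)) E \<phi> = C (Suc k) E (C k E \<phi>) \<or> C (Suc (Suc k)) E \<phi> = C k E (C (Suc k) E \<phi>)" for k E \<phi>
    unfolding C_def using flift_rec[of m l V E k \<phi>] by (cases "even k") simp_all
  have no_trap: "\<not> (e < C k E e \<and> e < C (Suc k) E e \<and> C k E g < g \<and> C (Suc k) E g < g)" for k E e g
    using trap_from_crossings[of V e m l E k g] none V(1) unfolding C_def by fastforce
  have down: "C (Suc (Suc k)) E \<phi> \<le> C (Suc k) E \<phi>" if "id_ge (C k E)" for k E \<phi>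
    using rec[of k E \<phi>] that mono[of "C k E \<phi>" \<phi> "Suc k"] by metis
  have up: "C (Suc k) E \<phi> \<le> C (Suc (Suc k)) E \<phi>" if "id_le (C k E)" for k E \<phi>
    using rec[of k E \<phi>] that mono[of \<phi> "C k E \<phi>" "Suc k"] by metis
  have down': "C (Suc (Suc k)) E \<phi> \<le> C k E \<phi>" if "id_ge (C (Suc k) E)" for k E \<phi>
    using rec[of k E \<phi>] that mono[of "C (Suc k) E \<phi>" \<phi> k] by metis
  have up': "C k E \<phi> \<le> C (Suc (Suc k)) E \<phi>" if "id_le (C (Suc k) E)" for k E \<phi>
    using rec[of k E \<phi>] that mono[of \<phi> "C (Suc k) E \<phi>" k] by metis
  \<comment> \<open>For ordered neighbours, a direction that the smaller map moves forward is moved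
    forward by both, and one that the larger moves backward is moved backward by both. If both
    existed, there would be a trap.\<close>
  have cross: "id_le (C k E) \<or> id_ge (C (Suc k) E)" if "\<And>\<phi>. C (Suc k) E \<phi> \<le> C k E \<phi>" for k E
    using no_trap[of _ k E] that by (meson less_le_trans le_less_trans not_le)
  have cross': "id_ge (C k E) \<or> id_le (C (Suc k) E)" if "\<And>\<phi>. C k E \<phi> \<le> C (Suc k) E \<phi>" for k E
    using no_trap[of _ k E] that by (meson less_le_trans le_less_trans not_le)
  have GG: "G k E \<or> G (Suc k) E" for k E
  proof (induction k)
    case 0
    have c: "C 0 E \<phi> = step_lift E \<phi> - pi * of_int l" "C (Suc 0) E \<phi> = step_lift (E - V) \<phi> - pi * of_int (m + l)" for \<phi>
      unfolding C_def clift_def by (simp_all add: wlab_def)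
    show ?case
    proof (cases "m < 0")
      case True
      have "pi * of_int (m + l) \<le> pi * of_int l" using True by (intro mult_left_mono) auto
      moreover have "step_lift E \<phi> \<le> step_lift (E - V) \<phi>" for \<phi>
        by (rule step_lift_antimono) (use V in simp)
      ultimately have "C 0 E \<phi> \<le> C (Suc 0) E \<phi>" for \<phi> unfolding c by (rule diff_mono[rotated])
      then show ?thesis using cross'[of 0 E] True unfolding G_def by auto
    next
      case False
      then have "1 \<le> m" using m by simp
      then have "pi * of_int (1 + l) \<le> pi * of_int (m + l)" by (intro mult_left_mono) auto
      then have a: "pi + pi * of_int l \<le> pi * of_int (m + l)" by (simp add: distrib_left)
      \<comment> \<open>Lowering the energy by \<open>V\<close> undoes a shear and gains less than
        \<open>pi\<close>, whereas for \<open>m \<ge> 1\<close> the label of the occupied site is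
        larger by at least one half turn. For negative \<open>m\<close> energy and label favour the
        same side.\<close>
      have "step_lift (E - V) \<phi> < step_lift E \<phi> + pi" for \<phi>
        using shear_lift_add[of V "E - V" "\<phi> + pi/2"] shear_lift_bound[of V "shear_lift (E - V) (\<phi> + pi/2)"]
        unfolding step_lift_def by (simp add: abs_less_iff)
      note step = this
      have "C (Suc 0) E \<phi> \<le> C 0 E \<phi>" for \<phi> unfolding c using step[of \<phi>] a by linarith
      then show ?thesis using cross[of 0 E] False unfolding G_def by auto
    qed
  next
    case (Suc k)
    show ?case
    proof (cases "G (Suc k) E")
      case False
      then have Gk: "G k E" using Suc by blast
      show ?thesis
      proof (cases "even k = (m < 0)")
        case True
        then have "id_ge (C k E)" using Gk unfolding G_def by simp
        then show ?thesis using cross[OF down, of k E] True unfolding G_def by auto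
      next
        case False
        then have "id_le (C k E)" using Gk unfolding G_def by simp
        then show ?thesis using cross'[OF up, of k E] False unfolding G_def by auto
      qed
    qed simp
  qed
  define W where "W = {E. \<exists>k. even k = (m < 0) \<and> \<not> id_ge (C k E)}"
  define W' where "W' = {E. \<exists>k. even k \<noteq> (m < 0) \<and> \<not> id_le (C k E)}"
  have "open W"
  proof -
    have "W = (\<Union>k\<in>{k. even k = (m < 0)}. \<Union>\<phi>. {E. \<phi> < C k E \<phi>})" unfolding W_def by (auto simp: not_le)
    moreover have "open {E. \<phi> < C k E \<phi>}" for k \<phi>
      unfolding C_def by (intro open_Collect_less continuous_intros continuous_clift_energy)
    ultimately show ?thesis by auto
  qed
  moreover have "open W'"
  proof -
    have "W' = (\<Union>k\<in>{k. even k \<noteq> (m < 0)}. \<Union>\<phi>. {E. C k E \<phi> < \<phi>})" unfolding W'_def by (auto simp: not_le)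
    moreover have "open {E. C k E \<phi> < \<phi>}" for k \<phi>
      unfolding C_def by (intro open_Collect_less continuous_intros continuous_clift_energy)
    ultimately show ?thesis by auto
  qed
  \<comment> \<open>By \<open>GG\<close>, a violation at \<open>k\<close> forces the expected sign
    at \<open>k + 1\<close>, and this carries the violation on to \<open>k + 2\<close>. Hence one
    kind of violation forbids the other at all later indices, although that one persists
    too.\<close>
  moreover have "W \<inter> W' = {}"
  proof (rule ccontr)
    assume "W \<inter> W' \<noteq> {}"
    then obtain E k k' where k: "even k = (m < 0)" "\<not> id_ge (C k E)" and k': "even k' \<noteq> (m < 0)" "\<not> id_le (C k' E)"
      unfolding W_def W'_def by blast
    have next1: "\<not> id_ge (C (k + 2) E) \<and> id_le (C (k + 1) E)" if "even k = (m < 0)" "\<not> id_ge (C k E)" for k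
    proof -
      have "id_le (C (Suc k) E)" using GG[of k E] that unfolding G_def by auto
      then show ?thesis using that(2) up'[of k E] by (auto simp: not_le intro: less_le_trans)
    qed
    have next2: "\<not> id_le (C (k + 2) E)" if "even k \<noteq> (m < 0)" "\<not> id_le (C k E)" for k
    proof -
      have "id_ge (C (Suc k) E)" using GG[of k E] that unfolding G_def by auto
      then show ?thesis using that(2) down'[of k E] by (auto simp: not_le intro: le_less_trans)
    qed
    have all1: "\<not> id_ge (C (k + 2 * j) E)" for j
    proof (induction j)
      case (Suc j)
      then show ?case using next1[of "k + 2 * j"] k(1) by simp
    qed (use k in simp)
    have all2: "\<not> id_le (C (k' + 2 * j) E)" for j
    proof (induction j)
      case (Suc j)
      then show ?case using next2[of "k' + 2 * j"] k'(1) by simp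
    qed (use k' in simp)
    have "odd (k + k')" using k(1) k'(1) by auto
    then obtain i where i: "k + k' = 2 * i + 1" by (elim oddE)
    have "k + 2 * k' + 1 = k' + 2 * (i + 1)" using i by simp
    moreover have "id_le (C (k + 2 * k' + 1) E)" using next1[of "k + 2 * k'"] all1[of k'] k(1) by simp
    ultimately show False using all2[of "i + 1"] by metis
  qed
  moreover have "W \<noteq> {}" "W' \<noteq> {}"
  proof -
    let ?\<theta> = "of_int m * alpha + of_int l :: real"
    obtain n :: nat where n: "\<bar>real_of_int m\<bar> / ?\<theta> < n" using reals_Archimedean2 by blast
    obtain n' :: nat where n': "\<bar>real_of_int m\<bar> / (1 - ?\<theta>) < n'" using reals_Archimedean2 by blast
    \<comment> \<open>The label of a word is its length times \<open>?\<theta>\<close> up to the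
      modulus of \<open>m\<close>, so for \<open>?\<theta>\<close> strictly between 0 and 1 long
      words have labels between 0 and their length. At energy -3 words turn some direction by more
      than \<open>pi\<close> times their length, at \<open>3 + V\<close> some direction
      backward.\<close>
    have lab: "0 \<le> wlab m l (fibw k)" "wlab m l (fibw k) \<le> int (length (fibw k))" if k: "n + n' \<le> k" for k
    proof -
      have len: "real n + real n' \<le> length (fibw k)" using length_fibw_ge[of k] k by linarith
      have "\<bar>real_of_int m\<bar> \<le> n * ?\<theta>" "\<bar>real_of_int m\<bar> \<le> n' * (1 - ?\<theta>)"
        using n n' \<theta> by (simp_all only: divide_less_eq) auto
      moreover have "n * ?\<theta> \<le> length (fibw k) * ?\<theta>" "n' * (1 - ?\<theta>) \<le> length (fibw k) * (1 - ?\<theta>)"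
        using len \<theta> by (intro mult_right_mono; simp)+
      ultimately have "\<bar>real_of_int m\<bar> \<le> length (fibw k) * ?\<theta>" "\<bar>real_of_int m\<bar> \<le> length (fibw k) * (1 - ?\<theta>)"
        by linarith+
      moreover have "length (fibw k) * (1 - ?\<theta>) = length (fibw k) - length (fibw k) * ?\<theta>" by (simp add: algebra_simps)
      ultimately have "0 \<le> real_of_int (wlab m l (fibw k))" "real_of_int (wlab m l (fibw k)) \<le> real (length (fibw k))"
        using wlab_fibw_bound[of m l k] by (simp_all only: abs_le_iff) linarith+
      then show "0 \<le> wlab m l (fibw k)" "wlab m l (fibw k) \<le> int (length (fibw k))" by linarith+
    qed
    have ne: "fibw k \<noteq> []" for k using length_fibw_pos by blast
    have lo: "\<not> id_ge (C k (-3))" if k: "n + n' \<le> k" for k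
    proof -
      have "pi * of_int (wlab m l (fibw k)) \<le> pi * length (fibw k)"
        using lab(2)[OF k] by (intro mult_left_mono) (linarith, simp)
      moreover have "3 * pi / 4 + pi * length (fibw k) < wlift V (-3) (fibw k) (3 * pi / 4)"
        using trap_low_energy[of "-3" V "fibw k"] V ne by (simp add: trap_def clift_def wlab_def)
      ultimately have "3 * pi / 4 < C k (-3) (3 * pi / 4)" unfolding C_def clift_def by linarith
      then show ?thesis by (meson not_le)
    qed
    have hi: "\<not> id_le (C k (3 + V))" if k: "n + n' \<le> k" for k
    proof -
      have "0 \<le> pi * of_int (wlab m l (fibw k))" using lab(1)[OF k] by simp
      moreover have "wlift V (3 + V) (fibw k) (pi / 4) < pi / 4"
        using trap_high_energy[of V "3 + V" "fibw k"] V ne by (simp add: trap_def clift_def wlab_def)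
      ultimately have "C k (3 + V) (pi / 4) < pi / 4" unfolding C_def clift_def by linarith
      then show ?thesis by (meson not_le)
    qed
    have par: "\<exists>k\<ge>n + n'. even k = b" for b
      by (cases "even (n + n') = b") (auto intro: exI[of _ "n + n'"] exI[of _ "Suc (n + n')"])
    obtain k where "n + n' \<le> k" "even k = (m < 0)" using par by blast
    then have "-3 \<in> W" using lo[of k] unfolding W_def by blast
    then show "W \<noteq> {}" by blast
    obtain k' where "n + n' \<le> k'" "even k' = (\<not> m < 0)" using par by blast
    then have "n + n' \<le> k'" "even k' \<noteq> (m < 0)" by simp_all
    then have "3 + V \<in> W'" using hi[of k'] unfolding W'_def by blast
    then show "W' \<noteq> {}" by blast
  qed
  ultimately have "W \<union> W' \<noteq> UNIV"
    using connected_UNIV[where 'a = real] unfolding connected_def by auto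
  then obtain E where E: "E \<notin> W" "E \<notin> W'" by blast
  \<comment> \<open>A shift of the index by \<open>n\<close> makes the even lifts those below the
    identity.\<close>
  define n where "n = (if m < 0 then 0 else 1 :: nat)"
  show False
  proof (rule alternating_words_impossible[of "\<lambda>k. fmat m l V E (n + k)" "\<lambda>k. C (n + k) E" V])
    show "C (n + 2 * j) E \<phi> \<le> \<phi>" for j \<phi> 
    proof -
      have "even (n + 2 * j) = (m < 0)" unfolding n_def by simp
      then show ?thesis using E(1) unfolding W_def by blast
    qed
    show "\<phi> \<le> C (n + (2 * j + 1)) E \<phi>" for j \<phi> 
    proof -
      have "even (n + (2 * j + 1)) \<noteq> (m < 0)" unfolding n_def by simp
      then show ?thesis using E(2) unfolding W'_def by blast
    qed
    show "lifts (fmat m l V E (n + k)) (C (n + k) E)" for k unfolding C_def by (rule lifts_clift)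
    show "((\<forall>\<phi>. C (n + (k + 2)) E \<phi> = C (n + (k + 1)) E (C (n + k) E \<phi>)) \<and>
        fmat m l V E (n + (k + 2)) = mmul (fmat m l V E (n + (k + 1))) (fmat m l V E (n + k))) \<or>
      ((\<forall>\<phi>. C (n + (k + 2)) E \<phi> = C (n + k) E (C (n + (k + 1)) E \<phi>)) \<and>
        fmat m l V E (n + (k + 2)) = mmul (fmat m l V E (n + k)) (fmat m l V E (n + (k + 1))))" for k
    proof -
      have i: "n + (k + 2) = Suc (Suc (n + k))" "n + (k + 1) = Suc (n + k)" by simp_all
      show ?thesis unfolding i C_def flift_rec fmat_rec by (cases "even (n + k)") simp_all
    qed
    show "mtr (fmat m l V E (n + (k + 3))) =
        mtr (fmat m l V E (n + (k + 2))) * mtr (fmat m l V E (n + (k + 1))) - mtr (fmat m l V E (n + k))" for k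
      using trace_rec[of m l V E "n + k"] by (simp only: add.assoc)
    show "(mtr (fmat m l V E (n + k)))\<^sup>2 + (mtr (fmat m l V E (n + (k + 1))))\<^sup>2 + (mtr (fmat m l V E (n + (k + 2))))\<^sup>2 -
        mtr (fmat m l V E (n + k)) * mtr (fmat m l V E (n + (k + 1))) * mtr (fmat m l V E (n + (k + 2))) = 4 + V\<^sup>2" for k
      using fricke[of m l V E "n + k"] by (simp only: add.assoc)
  qed (use V in simp_all)
qed

text \<open>Irrationality of \<open>alpha\<close>: if \<open>m * alpha\<close> were an integer, so
  would be \<open>m * alpha ^ (2 * i + 1)\<close>, which is nonzero and arbitrarily small.\<close>

lemma frac_alpha_pos:
  assumes "m \<noteq> 0" shows "0 < frac (of_int m * alpha)"
proof (rule ccontr)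
  assume "\<not> 0 < frac (of_int m * alpha)"
  then have "frac (of_int m * alpha) = 0" using frac_ge_0[of "of_int m * alpha"] by linarith
  then obtain z where z: "of_int m * alpha = of_int z" by (auto elim: Ints_cases)
  obtain i where i: "alpha ^ i < 1 / \<bar>real_of_int m\<bar>" using alpha_power_small[of "1 / \<bar>real_of_int m\<bar>"] assms by auto
  have "alpha ^ (2*i+1) \<le> alpha ^ i" using alpha_bounds by (intro power_decreasing) auto
  then have "\<bar>real_of_int m\<bar> * alpha ^ (2*i+1) \<le> \<bar>real_of_int m\<bar> * alpha ^ i" by (rule mult_left_mono) simp
  also have "\<dots> < 1" using i assms by (simp add: field_simps)
  finally have s: "\<bar>real_of_int m\<bar> * alpha ^ (2*i+1) < 1" .
  have "of_int m * alpha ^ (2*i+1) = real (length (fibw (2*i))) * (of_int m * alpha) - of_int m * real (occn (fibw (2*i)))"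
  proof -
    have "real (length (fibw (2*i))) * alpha = occn (fibw (2*i)) + alpha ^ (2*i+1)"
      using fibw_rotation[of i] by blast
    then have "of_int m * (real (length (fibw (2*i))) * alpha) = of_int m * (occn (fibw (2*i)) + alpha ^ (2*i+1))"
      by (simp only:)
    then show ?thesis by (simp only: distrib_left mult.left_commute)
  qed
  then have e: "of_int m * alpha ^ (2*i+1) = of_int (int (length (fibw (2*i))) * z - m * int (occn (fibw (2*i))))"
    unfolding z by simp
  then have "\<bar>of_int (int (length (fibw (2*i))) * z - m * int (occn (fibw (2*i))))\<bar> < (1::real)"
    using s alpha_power_pos[of "2*i+1"] by (simp only: e[symmetric] abs_mult)
  then have "int (length (fibw (2*i))) * z - m * int (occn (fibw (2*i))) = 0" by linarith
  then have "of_int m * alpha ^ (2*i+1) = 0" using e by simp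
  then show False using assms alpha_bounds by simp
qed

theorem theorem1p5:
  shows "\<exists>V\<^sub>0>0. \<forall>V\<in>{0<..V\<^sub>0}.
           {ids E V | E. complex_of_real E \<notin> Sigma_V V} =
           {frac (of_int m * alpha) | m :: int. True} \<union> {1}"
proof (intro exI[of _ "1/2 :: real"] conjI ballI)
  \<comment> \<open>The threshold 1/2 stems from
    \<open>trace_alternating_impossible\<close>.\<close>
  fix V :: real assume "V \<in> {0<..1/2}"
  then have V: "0 < V" "V \<le> 1/2" "0 \<le> V" "V \<le> 1" by auto
  have ne: "fibw 0 \<noteq> []" "fibw (Suc 0) \<noteq> []" by simp_all
  \<comment> \<open>The unbounded gaps have \<open>m = 0\<close> and rotation numbers 0 and 1, the
    end points that \<open>gap_open\<close> excludes.\<close>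
  have top: "complex_of_real (3 + V) \<notin> Sigma_V V" "ids (3 + V) V = 1"
    using trap_gap[of V 0 0 "3 + V" 0 "pi/4" 0] trap_high_energy[of V "3 + V"] V ne by auto
  have bottom: "complex_of_real (-3) \<notin> Sigma_V V" "ids (-3) V = 0"
    using trap_gap[of V 0 1 "-3" "3 * pi / 4" pi 0] trap_low_energy[of "-3" V] V ne by auto
  show "{ids E V | E. complex_of_real E \<notin> Sigma_V V} = {frac (of_int m * alpha) | m :: int. True} \<union> {1}"
  proof (intro equalityI subsetI)
    fix x assume "x \<in> {ids E V | E. complex_of_real E \<notin> Sigma_V V}"
    then obtain E where E: "complex_of_real E \<notin> Sigma_V V" "x = ids E V" by blast
    obtain m l where ml: "x = 1 - (of_int m * alpha + of_int l)" "0 \<le> x" "x \<le> 1"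
      using gap_label[OF V(3,4) E(1)] E(2) by blast
    have "x = frac (of_int (- m) * alpha)" if "x \<noteq> 1"
    proof -
      have "of_int (- m) * alpha - x = of_int (l - 1)" using ml(1) by simp
      then have "of_int (- m) * alpha - x \<in> \<int>" by (metis Ints_of_int)
      then show ?thesis using that ml by (metis frac_unique_iff less_le)
    qed
    then show "x \<in> {frac (of_int m * alpha) | m :: int. True} \<union> {1}" by blast
  next
    fix x assume "x \<in> {frac (of_int m * alpha) | m :: int. True} \<union> {1}"
    then consider "x = 1" | m where "x = frac (of_int m * alpha)" by blast
    then show "x \<in> {ids E V | E. complex_of_real E \<notin> Sigma_V V}"
    proof cases
      case 1
      then show ?thesis using top by force
    next
      case (2 m)
      show ?thesis
      proof (cases "m = 0")
        case True
        then show ?thesis using 2 bottom by force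
      next
        case False
        \<comment> \<open>The density of states is one minus the rotation number, whence the label
          \<open>- m\<close>; this \<open>?l\<close> brings the rotation number to
          \<open>1 - x\<close>, strictly between 0 and 1.\<close>
        let ?l = "\<lfloor>of_int m * alpha\<rfloor> + 1"
        have e: "of_int (- m) * alpha + of_int ?l = 1 - x" unfolding 2 frac_def by simp
        have "0 < x" "x < 1" unfolding 2 using frac_alpha_pos[OF False] frac_lt_1 by auto
        then obtain E where "complex_of_real E \<notin> Sigma_V V" "ids E V = 1 - (of_int (- m) * alpha + of_int ?l)"
          using gap_open[OF V(1,2), of "- m" ?l] False unfolding e by auto
        then show ?thesis unfolding e by force
      qed
    qed
  qed
qed simp

end
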